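(* Let $L>0$ be a pseudo-Finsler metric on $A$. The map $$\Pi:\mathrm{Sol}_L(A)\to\mathrm{Sol}^{\mathrm{sym}}_L(A),\qquad \mathrm{N}=\mathrm{N}^L+\dot\partial\mathcal{Z}+\mathcal{A}\otimes\mathbb{C}\longmapsto\mathrm{N}^L+\dot\partial\mathcal{Z},$$ where $\mathcal{Z}\in\mathrm{h}^2\mathcal{T}^1_0(M_A)$ and $\mathcal{A}\in\mathrm{h}^0\mathcal{T}^0_1(M_A)$, is a well-defined projection with the following properties. (i) For $\mathrm{N}^L+\dot\partial\mathcal{Z}\in\mathrm{Sol}^{\mathrm{sym}}_L(A)$, the only symmetric element of the fiber $\Pi^{-1}(\mathrm{N}^L+\dot\partial\mathcal{Z})$ is $\mathrm{N}^L+\dot\partial\mathcal{Z}$ itself. (ii) Two elements $\mathrm{N},\mathrm{N}_0\in\mathrm{Sol}_L(A)$ share pregeodesics if and only if they are on the same fiber of $\Pi$. (iii) The pregeodesics of $\mathrm{N}\in\mathrm{Sol}_L(A)$ are those of $L$ only in case that $\Pi(\mathrm{N})=\mathrm{N}^L$. (iv) All elements of a fiber of $\Pi$ have the same Ricci scalar.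
   Context: $M$ is a connected smooth manifold of dimension $n\ge 2$, $\pi:TM\to M$ the projection. Charts $(x^i)$ of $M$ induce charts $(x^i,y^i)$ of $TM$; $\partial_i=\partial/\partial x^i$, $\dot\partial_i=\partial/\partial y^i$; repeated indices are summed. $A\subseteq TM\setminus\mathbf{0}$ is open and conic ($\lambda v\in A$ for $v\in A$, $\lambda>0$) with $\pi(A)=M$. An anisotropic tensor of type $(r,s)$ is a smooth section of the pullback to $A$ of $\bigotimes^rTM\otimes\bigotimes^sT^*M$, with components $T^{i_1\dots i_r}_{j_1\dots j_s}(x,y)$; the space of those with components positively $\alpha$-homogeneous in $y$ is $\mathrm{h}^\alpha\mathcal{T}^r_s(M_A)$. A subscript $\cdot i$ denotes $\dot\partial_i$; $(\dot\partial\mathcal{Z})_i^k=\mathcal{Z}^k_{\cdot i}$. $\mathbb{C}=y^a\partial_a$, $(\mathcal{A}\otimes\mathbb{C})_i^k=\mathcal{A}_iy^k$. A homogeneous nonlinear connection $\mathrm{N}$ on $A$ is given in each chart by smooth functions $\mathrm{N}_i^k(x,y)$, positively $1$-homogeneous in $y$, transforming by $\bar{\mathrm{N}}_i^k=\frac{\partial\bar x^k}{\partial x^c}\frac{\partial^2x^c}{\partial\bar x^i\partial\bar x^b}\bar y^b+\frac{\partial\bar x^k}{\partial x^c}\frac{\partial x^a}{\partial\bar x^i}\mathrm{N}_a^c$. Differences of two such lie in $\mathrm{h}^1\mathcal{T}^1_1(M_A)$. $\mathrm{N}$ is symmetric if $\mathrm{N}^k_{i\cdot j}=\mathrm{N}^k_{j\cdot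 i}$. With $\delta_i=\partial_i-\mathrm{N}_i^a\dot\partial_a$: $\mathcal{R}_{ij}^k=\delta_j\mathrm{N}_i^k-\delta_i\mathrm{N}_j^k$ and the Ricci scalar is $\mathrm{Ric}=y^b\mathcal{R}_{ba}^a$. Geodesics of $\mathrm{N}$: curves with $\dot\gamma\in A$ and $\frac{d\dot\gamma^k}{dt}+\mathrm{N}^k_c(\gamma,\dot\gamma)\dot\gamma^c=0$; pregeodesics: curves that can be positively reparametrized to be geodesics. A pseudo-Finsler metric on $A$ is a smooth positively $2$-homogeneous $L:A\to\mathbb{R}$ with $g_{ij}=\frac12L_{\cdot i\cdot j}$ non-degenerate everywhere; here $L>0$. Indices are moved with $g$; $y_i=g_{ia}y^a$. $(\mathrm{G}^L)^i=\frac14g^{ia}(2\partial_cg_{ab}-\partial_ag_{bc})y^by^c$; $(\mathrm{N}^L)_i^k=\dot\partial_i(\mathrm{G}^L)^k$; $L$-(pre)geodesics are the $\mathrm{N}^L$-(pre)geodesics. $\mathrm{C}_{ijk}=\frac12g_{ij\cdot k}$, $\mathrm{C}_i=g^{ab}\mathrm{C}_{abi}$. $\mathrm{Lan}_{ijk}=\frac12\nabla^L_kg_{ij}$ with $\nabla^L_kg_{ij}=(\partial_k-(\mathrm{N}^L)_k^a\dot\partial_a)g_{ij}-(\mathrm{N}^L)^a_{k\cdot i}g_{aj}-(\mathrm{N}^L)^a_{k\cdot j}g_{ia}$, $\mathrm{Lan}_i=g^{ab}\mathrm{Lan}_{abi}$. $\mathrm{Sol}_L(A)$ is the set of homogeneous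 nonlinear connections $\mathrm{N}=\mathrm{N}^L+\mathcal{J}$, $\mathcal{J}\in\mathrm{h}^1\mathcal{T}^1_1(M_A)$, satisfying the affine equation on $A$: $$\Big\{2\mathrm{Lan}_b+(n+2)\tfrac{y_a}{L}\mathcal{J}^a_b-2\mathrm{C}_a\mathcal{J}^a_b-(\mathcal{J}^a_{b\cdot a}+\mathcal{J}^a_{a\cdot b})\Big\}(\delta^b_iy^j-y^b\delta^j_i)-(\mathcal{J}^j_{i\cdot a}-\mathcal{J}^j_{a\cdot i})y^a=0 ;$$ $\mathrm{Sol}^{\mathrm{sym}}_L(A)$ is the subset of symmetric ones. (Every element of $\mathrm{Sol}_L(A)$ can be written in the form $\mathrm{N}^L+\dot\partial\mathcal{Z}+\mathcal{A}\otimes\mathbb{C}$ with $\mathrm{N}^L+\dot\partial\mathcal Z\in\mathrm{Sol}^{\mathrm{sym}}_L(A)$.) *)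

theory Defs
  imports "HOL-Analysis.Analysis"
begin

section \<open>Smooth maps between Euclidean spaces\<close>

(* Only ever used on open S.  In finite dimension, continuity of x |-> Df(x) v for every fixed v
   is continuity of Df, so Ck_on k is the usual class C^k. *)
primrec Ck_on :: "nat \<Rightarrow> ('a::euclidean_space \<Rightarrow> 'b::euclidean_space) \<Rightarrow> 'a set \<Rightarrow> bool" where
  "Ck_on 0 f S \<longleftrightarrow> continuous_on S f"
| "Ck_on (Suc k) f S \<longleftrightarrow>
     (\<forall>x\<in>S. f differentiable (at x)) \<and> (\<forall>v. Ck_on k (\<lambda>x. frechet_derivative f (at x) v) S)"

definition smooth_on :: "('a::euclidean_space \<Rightarrow> 'b::euclidean_space) \<Rightarrow> 'a set \<Rightarrow> bool" where
  "smooth_on f S \<longleftrightarrow> (\<forall>k. Ck_on k f S)"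


section \<open>Smooth manifolds and the tangent bundle\<close>

(* The manifold is the whole type 'm; its dimension is CARD('n).  A chart is its domain together
   with the coordinate map, whose values outside the domain are irrelevant. *)
type_synonym ('m, 'n) chart = "'m set \<times> ('m \<Rightarrow> real^'n)"

abbreviation cdom :: "('m, 'n) chart \<Rightarrow> 'm set" where "cdom c \<equiv> fst c"
abbreviation cmap :: "('m, 'n) chart \<Rightarrow> 'm \<Rightarrow> real^'n" where "cmap c \<equiv> snd c"

definition cinv :: "('m, 'n) chart \<Rightarrow> real^'n \<Rightarrow> 'm" where
  "cinv c = inv_into (cdom c) (cmap c)"

definition is_chart :: "('m::topological_space, 'n::finite) chart \<Rightarrow> bool" where
  "is_chart c \<longleftrightarrow> open (cdom c) \<and> open (cmap c ` cdom c) \<and>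
     homeomorphism (cdom c) (cmap c ` cdom c) (cmap c) (cinv c)"

definition transition :: "('m, 'n) chart \<Rightarrow> ('m, 'n) chart \<Rightarrow> real^'n \<Rightarrow> real^'n" where
  "transition c c' = cmap c' \<circ> cinv c"

definition compatible :: "('m, 'n::finite) chart \<Rightarrow> ('m, 'n) chart \<Rightarrow> bool" where
  "compatible c c' \<longleftrightarrow>
     smooth_on (transition c c') (cmap c ` (cdom c \<inter> cdom c')) \<and>
     smooth_on (transition c' c) (cmap c' ` (cdom c \<inter> cdom c'))"

(* A smooth structure is a maximal smooth atlas, so that "chart of M" means "element of C". *)
definition smooth_structure ::
  "('m::{second_countable_topology, t2_space}, 'n::finite) chart set \<Rightarrow> bool" where
  "smooth_structure C \<longleftrightarrow>
     (\<forall>c\<in>C. is_chart c) \<and> (\<Union>c\<in>C. cdom c) = UNIV \<and>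
     (\<forall>c\<in>C. \<forall>c'\<in>C. compatible c c') \<and>
     (\<forall>c. is_chart c \<and> (\<forall>c'\<in>C. compatible c c') \<longrightarrow> c \<in> C)"

(* jac c c' x k a is d(x'^k)/d(x^a) at x, and hess c c' x k a b is d^2(x'^k)/(d(x^a) d(x^b)),
   where x are the coordinates of c and x' those of c'. *)
definition jac :: "('m, 'n::finite) chart \<Rightarrow> ('m, 'n) chart \<Rightarrow> real^'n \<Rightarrow> 'n \<Rightarrow> 'n \<Rightarrow> real" where
  "jac c c' x k a = frechet_derivative (transition c c') (at x) (axis a 1) $ k"

definition hess ::
  "('m, 'n::finite) chart \<Rightarrow> ('m, 'n) chart \<Rightarrow> real^'n \<Rightarrow> 'n \<Rightarrow> 'n \<Rightarrow> 'n \<Rightarrow> real" where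
  "hess c c' x k a b = frechet_derivative (\<lambda>z. jac c c' z k a) (at x) (axis b 1)"

(* A tangent vector is a base point together with its component vectors in all charts around
   that point, related by the Jacobians of the chart changes; the components with respect to
   anything else are 0, so that equality of tangent vectors is equality in HOL. *)
type_synonym ('m, 'n) tvec = "'m \<times> (('m, 'n) chart \<Rightarrow> real^'n)"

definition TM :: "('m, 'n::finite) chart set \<Rightarrow> ('m, 'n) tvec set" where
  "TM C = {(p, w).
     (\<forall>c\<in>C. \<forall>c'\<in>C. p \<in> cdom c \<and> p \<in> cdom c' \<longrightarrow>
        (\<forall>k. w c' $ k = (\<Sum>a\<in>UNIV. jac c c' (cmap c p) k a * w c $ a))) \<and>
     (\<forall>c. \<not> (c \<in> C \<and> p \<in> cdom c) \<longrightarrow> w c = 0)}"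

definition zero_section :: "('m, 'n::finite) tvec set" where
  "zero_section = range (\<lambda>p. (p, \<lambda>c. 0))"

definition tscale :: "real \<Rightarrow> ('m, 'n::finite) tvec \<Rightarrow> ('m, 'n) tvec" where
  "tscale l v = (fst v, \<lambda>c. l *\<^sub>R snd v c)"

(* Points (x, y) of the range of an induced chart of TM. *)
type_synonym 'n pt = "(real^'n) \<times> (real^'n)"

definition tcoord :: "('m, 'n::finite) chart \<Rightarrow> ('m, 'n) tvec \<Rightarrow> 'n pt" where
  "tcoord c v = (cmap c (fst v), snd v c)"

definition tpoint :: "('m, 'n::finite) chart set \<Rightarrow> ('m, 'n) chart \<Rightarrow> 'n pt \<Rightarrow> ('m, 'n) tvec" where
  "tpoint C c = inv_into {v \<in> TM C. fst v \<in> cdom c} (tcoord c)"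

definition adom :: "('m, 'n::finite) tvec set \<Rightarrow> ('m, 'n) chart \<Rightarrow> 'n pt set" where
  "adom A c = tcoord c ` {v \<in> A. fst v \<in> cdom c}"

(* Openness of A in TM is tested in the induced charts. *)
definition conic_domain :: "('m, 'n::finite) chart set \<Rightarrow> ('m, 'n) tvec set \<Rightarrow> bool" where
  "conic_domain C A \<longleftrightarrow>
     A \<subseteq> TM C - zero_section \<and> (\<forall>c\<in>C. open (adom A c)) \<and>
     (\<forall>v\<in>A. \<forall>l>0. tscale l v \<in> A) \<and> fst ` A = UNIV"


section \<open>Anisotropic tensors and homogeneous nonlinear connections\<close>

definition pdx :: "'n::finite \<Rightarrow> ('n pt \<Rightarrow> real) \<Rightarrow> 'n pt \<Rightarrow> real" where
  "pdx i f p = frechet_derivative f (at p) (axis i 1, 0)"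

definition pdy :: "'n::finite \<Rightarrow> ('n pt \<Rightarrow> real) \<Rightarrow> 'n pt \<Rightarrow> real" where
  "pdy i f p = frechet_derivative f (at p) (0, axis i 1)"

definition pos_homogeneous :: "real \<Rightarrow> ('n::finite pt \<Rightarrow> real) \<Rightarrow> 'n pt set \<Rightarrow> bool" where
  "pos_homogeneous \<alpha> f S \<longleftrightarrow> (\<forall>(x, y)\<in>S. \<forall>l>0. f (x, l *\<^sub>R y) = l powr \<alpha> * f (x, y))"

(* Anisotropic objects are families of component functions, one for each chart.  Components are
   set to 0 off the domain, so that equality of objects is equality in HOL. *)
definition component ::
  "('m, 'n::finite) chart set \<Rightarrow> ('m, 'n) tvec set \<Rightarrow> real \<Rightarrow> (('m, 'n) chart \<Rightarrow> 'n pt \<Rightarrow> real) \<Rightarrow> bool"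
where
  "component C A \<alpha> f \<longleftrightarrow>
     (\<forall>c\<in>C. smooth_on (f c) (adom A c) \<and> pos_homogeneous \<alpha> (f c) (adom A c)) \<and>
     (\<forall>c p. \<not> (c \<in> C \<and> p \<in> adom A c) \<longrightarrow> f c p = 0)"

type_synonym ('m, 'n) fam1 = "('m, 'n) chart \<Rightarrow> 'n \<Rightarrow> 'n pt \<Rightarrow> real"
type_synonym ('m, 'n) fam2 = "('m, 'n) chart \<Rightarrow> 'n \<Rightarrow> 'n \<Rightarrow> 'n pt \<Rightarrow> real"

(* The spaces h^\<alpha> T^1_0, h^\<alpha> T^0_1 and h^\<alpha> T^1_1.  In all two-index families the lower index comes
   first: T c i k stands for T_i^k in the chart c. *)
definition hT10 :: "('m, 'n::finite) chart set \<Rightarrow> ('m, 'n) tvec set \<Rightarrow> real \<Rightarrow> ('m, 'n) fam1 set" where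
  "hT10 C A \<alpha> = {Z. (\<forall>k. component C A \<alpha> (\<lambda>c. Z c k)) \<and>
     (\<forall>c\<in>C. \<forall>c'\<in>C. \<forall>v\<in>A. fst v \<in> cdom c \<inter> cdom c' \<longrightarrow> (\<forall>k.
        Z c' k (tcoord c' v) = (\<Sum>a\<in>UNIV. jac c c' (cmap c (fst v)) k a * Z c a (tcoord c v))))}"

definition hT01 :: "('m, 'n::finite) chart set \<Rightarrow> ('m, 'n) tvec set \<Rightarrow> real \<Rightarrow> ('m, 'n) fam1 set" where
  "hT01 C A \<alpha> = {B. (\<forall>i. component C A \<alpha> (\<lambda>c. B c i)) \<and>
     (\<forall>c\<in>C. \<forall>c'\<in>C. \<forall>v\<in>A. fst v \<in> cdom c \<inter> cdom c' \<longrightarrow> (\<forall>i.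
        B c' i (tcoord c' v) = (\<Sum>a\<in>UNIV. jac c' c (cmap c' (fst v)) a i * B c a (tcoord c v))))}"

definition hT11 :: "('m, 'n::finite) chart set \<Rightarrow> ('m, 'n) tvec set \<Rightarrow> real \<Rightarrow> ('m, 'n) fam2 set" where
  "hT11 C A \<alpha> = {J. (\<forall>i k. component C A \<alpha> (\<lambda>c. J c i k)) \<and>
     (\<forall>c\<in>C. \<forall>c'\<in>C. \<forall>v\<in>A. fst v \<in> cdom c \<inter> cdom c' \<longrightarrow> (\<forall>i k.
        J c' i k (tcoord c' v) =
          (\<Sum>b\<in>UNIV. \<Sum>a\<in>UNIV. jac c c' (cmap c (fst v)) k b * jac c' c (cmap c' (fst v)) a i *
             J c a b (tcoord c v))))}"

definition nonlinear_connection ::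
  "('m, 'n::finite) chart set \<Rightarrow> ('m, 'n) tvec set \<Rightarrow> ('m, 'n) fam2 \<Rightarrow> bool" where
  "nonlinear_connection C A N \<longleftrightarrow> (\<forall>i k. component C A 1 (\<lambda>c. N c i k)) \<and>
     (\<forall>c\<in>C. \<forall>c'\<in>C. \<forall>v\<in>A. fst v \<in> cdom c \<inter> cdom c' \<longrightarrow> (\<forall>i k.
        N c' i k (tcoord c' v) =
          (\<Sum>d\<in>UNIV. \<Sum>b\<in>UNIV. jac c c' (cmap c (fst v)) k d *
             hess c' c (cmap c' (fst v)) d i b * snd v c' $ b) +
          (\<Sum>d\<in>UNIV. \<Sum>a\<in>UNIV. jac c c' (cmap c (fst v)) k d * jac c' c (cmap c' (fst v)) a i *
             N c a d (tcoord c v))))"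

definition symmetric_connection ::
  "('m, 'n::finite) chart set \<Rightarrow> ('m, 'n) tvec set \<Rightarrow> ('m, 'n) fam2 \<Rightarrow> bool" where
  "symmetric_connection C A N \<longleftrightarrow>
     (\<forall>c\<in>C. \<forall>p\<in>adom A c. \<forall>i j k. pdy j (N c i k) p = pdy i (N c j k) p)"

definition fam_add :: "('m, 'n) fam2 \<Rightarrow> ('m, 'n) fam2 \<Rightarrow> ('m, 'n) fam2" (infixl \<open>\<oplus>\<^sub>f\<close> 65) where
  "fam_add N J = (\<lambda>c i k p. N c i k p + J c i k p)"

definition vertical_deriv ::
  "('m, 'n::finite) chart set \<Rightarrow> ('m, 'n) tvec set \<Rightarrow> ('m, 'n) fam1 \<Rightarrow> ('m, 'n) fam2" where
  "vertical_deriv C A Z = (\<lambda>c i k p. if c \<in> C \<and> p \<in> adom A c then pdy i (Z c k) p else 0)"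

definition tensor_liouville :: "('m, 'n::finite) fam1 \<Rightarrow> ('m, 'n) fam2" where
  "tensor_liouville B = (\<lambda>c i k p. B c i p * snd p $ k)"

definition hderiv ::
  "('n::finite \<Rightarrow> 'n \<Rightarrow> 'n pt \<Rightarrow> real) \<Rightarrow> 'n \<Rightarrow> ('n pt \<Rightarrow> real) \<Rightarrow> 'n pt \<Rightarrow> real" where
  "hderiv N i f p = pdx i f p - (\<Sum>a\<in>UNIV. N i a p * pdy a f p)"

definition curv :: "('n::finite \<Rightarrow> 'n \<Rightarrow> 'n pt \<Rightarrow> real) \<Rightarrow> 'n \<Rightarrow> 'n \<Rightarrow> 'n \<Rightarrow> 'n pt \<Rightarrow> real" where
  "curv N i j k p = hderiv N j (N i k) p - hderiv N i (N j k) p"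

definition Ricci_scalar :: "('n::finite \<Rightarrow> 'n \<Rightarrow> 'n pt \<Rightarrow> real) \<Rightarrow> 'n pt \<Rightarrow> real" where
  "Ricci_scalar N p = (\<Sum>b\<in>UNIV. \<Sum>a\<in>UNIV. snd p $ b * curv N b a a p)"


section \<open>Geodesics and pregeodesics\<close>

definition open_interval :: "real set \<Rightarrow> bool" where
  "open_interval I \<longleftrightarrow> open I \<and> is_interval I \<and> I \<noteq> {}"

definition smooth_curve ::
  "('m::topological_space, 'n::finite) chart set \<Rightarrow> real set \<Rightarrow> (real \<Rightarrow> 'm) \<Rightarrow> bool" where
  "smooth_curve C I \<gamma> \<longleftrightarrow> open_interval I \<and> continuous_on I \<gamma> \<and>
     (\<forall>c\<in>C. smooth_on (cmap c \<circ> \<gamma>) {t \<in> I. \<gamma> t \<in> cdom c})"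

definition velocity ::
  "('m, 'n::finite) chart set \<Rightarrow> (real \<Rightarrow> 'm) \<Rightarrow> real \<Rightarrow> ('m, 'n) tvec" where
  "velocity C \<gamma> t =
     (\<gamma> t, \<lambda>c. if c \<in> C \<and> \<gamma> t \<in> cdom c then vector_derivative (cmap c \<circ> \<gamma>) (at t) else 0)"

definition geodesic ::
  "('m::topological_space, 'n::finite) chart set \<Rightarrow> ('m, 'n) tvec set \<Rightarrow> ('m, 'n) fam2 \<Rightarrow>
   real set \<Rightarrow> (real \<Rightarrow> 'm) \<Rightarrow> bool" where
  "geodesic C A N I \<gamma> \<longleftrightarrow> smooth_curve C I \<gamma> \<and> (\<forall>t\<in>I. velocity C \<gamma> t \<in> A) \<and>
     (\<forall>c\<in>C. \<forall>t\<in>I. \<gamma> t \<in> cdom c \<longrightarrow> (\<forall>k.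
        deriv (\<lambda>s. snd (velocity C \<gamma> s) c $ k) t +
        (\<Sum>a\<in>UNIV. N c a k (tcoord c (velocity C \<gamma> t)) * snd (velocity C \<gamma> t) c $ a) = 0))"

definition pregeodesic ::
  "('m::topological_space, 'n::finite) chart set \<Rightarrow> ('m, 'n) tvec set \<Rightarrow> ('m, 'n) fam2 \<Rightarrow>
   real set \<Rightarrow> (real \<Rightarrow> 'm) \<Rightarrow> bool" where
  "pregeodesic C A N I \<gamma> \<longleftrightarrow> smooth_curve C I \<gamma> \<and>
     (\<exists>I' \<phi>. open_interval I' \<and> smooth_on \<phi> I' \<and> (\<forall>t\<in>I'. deriv \<phi> t > 0) \<and> \<phi> ` I' = I \<and>
        geodesic C A N I' (\<gamma> \<circ> \<phi>))"

definition share_pregeodesics ::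
  "('m::topological_space, 'n::finite) chart set \<Rightarrow> ('m, 'n) tvec set \<Rightarrow>
   ('m, 'n) fam2 \<Rightarrow> ('m, 'n) fam2 \<Rightarrow> bool" where
  "share_pregeodesics C A N N' \<longleftrightarrow>
     (\<forall>I \<gamma>. pregeodesic C A N I \<gamma> \<longleftrightarrow> pregeodesic C A N' I \<gamma>)"


section \<open>Pseudo-Finsler metrics\<close>

(* The quantities in this block are local: f is the expression of L in one chart. *)
definition metric :: "('n::finite pt \<Rightarrow> real) \<Rightarrow> 'n \<Rightarrow> 'n \<Rightarrow> 'n pt \<Rightarrow> real" where
  "metric f i j p = pdy j (pdy i f) p / 2"

definition metric_matrix :: "('n::finite pt \<Rightarrow> real) \<Rightarrow> 'n pt \<Rightarrow> real^'n^'n" where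
  "metric_matrix f p = (\<chi> i j. metric f i j p)"

definition metric_up :: "('n::finite pt \<Rightarrow> real) \<Rightarrow> 'n \<Rightarrow> 'n \<Rightarrow> 'n pt \<Rightarrow> real" where
  "metric_up f i j p = matrix_inv (metric_matrix f p) $ i $ j"

definition ylow :: "('n::finite pt \<Rightarrow> real) \<Rightarrow> 'n \<Rightarrow> 'n pt \<Rightarrow> real" where
  "ylow f i p = (\<Sum>a\<in>UNIV. metric f i a p * snd p $ a)"

definition spray :: "('n::finite pt \<Rightarrow> real) \<Rightarrow> 'n \<Rightarrow> 'n pt \<Rightarrow> real" where
  "spray f i p = (\<Sum>a\<in>UNIV. \<Sum>b\<in>UNIV. \<Sum>c\<in>UNIV.
     metric_up f i a p * (2 * pdx c (metric f a b) p - pdx a (metric f b c) p) *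
     snd p $ b * snd p $ c) / 4"

definition NL_loc :: "('n::finite pt \<Rightarrow> real) \<Rightarrow> 'n \<Rightarrow> 'n \<Rightarrow> 'n pt \<Rightarrow> real" where
  "NL_loc f i k p = pdy i (spray f k) p"

definition Cartan :: "('n::finite pt \<Rightarrow> real) \<Rightarrow> 'n \<Rightarrow> 'n \<Rightarrow> 'n \<Rightarrow> 'n pt \<Rightarrow> real" where
  "Cartan f i j k p = pdy k (metric f i j) p / 2"

definition mean_Cartan :: "('n::finite pt \<Rightarrow> real) \<Rightarrow> 'n \<Rightarrow> 'n pt \<Rightarrow> real" where
  "mean_Cartan f i p = (\<Sum>a\<in>UNIV. \<Sum>b\<in>UNIV. metric_up f a b p * Cartan f a b i p)"

definition nabla_metric :: "('n::finite pt \<Rightarrow> real) \<Rightarrow> 'n \<Rightarrow> 'n \<Rightarrow> 'n \<Rightarrow> 'n pt \<Rightarrow> real" where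
  "nabla_metric f k i j p = hderiv (NL_loc f) k (metric f i j) p -
     (\<Sum>a\<in>UNIV. pdy i (NL_loc f k a) p * metric f a j p) -
     (\<Sum>a\<in>UNIV. pdy j (NL_loc f k a) p * metric f i a p)"

definition Landsberg :: "('n::finite pt \<Rightarrow> real) \<Rightarrow> 'n \<Rightarrow> 'n \<Rightarrow> 'n \<Rightarrow> 'n pt \<Rightarrow> real" where
  "Landsberg f i j k p = nabla_metric f k i j p / 2"

definition mean_Landsberg :: "('n::finite pt \<Rightarrow> real) \<Rightarrow> 'n \<Rightarrow> 'n pt \<Rightarrow> real" where
  "mean_Landsberg f i p = (\<Sum>a\<in>UNIV. \<Sum>b\<in>UNIV. metric_up f a b p * Landsberg f a b i p)"

(* The affine equation at p; bracket f J b p is the factor in braces. *)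
definition bracket ::
  "('n::finite pt \<Rightarrow> real) \<Rightarrow> ('n \<Rightarrow> 'n \<Rightarrow> 'n pt \<Rightarrow> real) \<Rightarrow> 'n \<Rightarrow> 'n pt \<Rightarrow> real" where
  "bracket f J b p = 2 * mean_Landsberg f b p +
     (real CARD('n) + 2) * (\<Sum>a\<in>UNIV. ylow f a p / f p * J b a p) -
     2 * (\<Sum>a\<in>UNIV. mean_Cartan f a p * J b a p) -
     (\<Sum>a\<in>UNIV. pdy a (J b a) p + pdy b (J a a) p)"

definition affine_equation ::
  "('n::finite pt \<Rightarrow> real) \<Rightarrow> ('n \<Rightarrow> 'n \<Rightarrow> 'n pt \<Rightarrow> real) \<Rightarrow> 'n pt \<Rightarrow> bool" where
  "affine_equation f J p \<longleftrightarrow> (\<forall>i j.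
     (\<Sum>b\<in>UNIV. bracket f J b p *
        ((if b = i then 1 else 0) * snd p $ j - snd p $ b * (if j = i then 1 else 0))) -
     (\<Sum>a\<in>UNIV. (pdy a (J i j) p - pdy i (J a j) p) * snd p $ a) = 0)"

(* L is a function of tangent vectors; its values outside A are irrelevant. *)
definition local_expr ::
  "('m, 'n::finite) chart set \<Rightarrow> (('m, 'n) tvec \<Rightarrow> real) \<Rightarrow> ('m, 'n) chart \<Rightarrow> 'n pt \<Rightarrow> real" where
  "local_expr C L c p = L (tpoint C c p)"

definition pseudo_Finsler ::
  "('m, 'n::finite) chart set \<Rightarrow> ('m, 'n) tvec set \<Rightarrow> (('m, 'n) tvec \<Rightarrow> real) \<Rightarrow> bool" where
  "pseudo_Finsler C A L \<longleftrightarrow>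
     (\<forall>c\<in>C. smooth_on (local_expr C L c) (adom A c)) \<and>
     (\<forall>v\<in>A. \<forall>l>0. L (tscale l v) = l\<^sup>2 * L v) \<and>
     (\<forall>c\<in>C. \<forall>p\<in>adom A c. invertible (metric_matrix (local_expr C L c) p))"

definition NL ::
  "('m, 'n::finite) chart set \<Rightarrow> ('m, 'n) tvec set \<Rightarrow> (('m, 'n) tvec \<Rightarrow> real) \<Rightarrow> ('m, 'n) fam2" where
  "NL C A L = (\<lambda>c i k p. if c \<in> C \<and> p \<in> adom A c then NL_loc (local_expr C L c) i k p else 0)"


section \<open>The solution sets and the projection\<close>

definition Sol ::
  "('m, 'n::finite) chart set \<Rightarrow> ('m, 'n) tvec set \<Rightarrow> (('m, 'n) tvec \<Rightarrow> real) \<Rightarrow> ('m, 'n) fam2 set" where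
  "Sol C A L = {N. nonlinear_connection C A N \<and>
     (\<exists>J\<in>hT11 C A 1. N = NL C A L \<oplus>\<^sub>f J \<and>
        (\<forall>c\<in>C. \<forall>p\<in>adom A c. affine_equation (local_expr C L c) (J c) p))}"

definition Sol_sym ::
  "('m, 'n::finite) chart set \<Rightarrow> ('m, 'n) tvec set \<Rightarrow> (('m, 'n) tvec \<Rightarrow> real) \<Rightarrow> ('m, 'n) fam2 set" where
  "Sol_sym C A L = {N \<in> Sol C A L. symmetric_connection C A N}"

definition decomposes ::
  "('m, 'n::finite) chart set \<Rightarrow> ('m, 'n) tvec set \<Rightarrow> (('m, 'n) tvec \<Rightarrow> real) \<Rightarrow>
   ('m, 'n) fam2 \<Rightarrow> ('m, 'n) fam1 \<Rightarrow> ('m, 'n) fam1 \<Rightarrow> bool" where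
  "decomposes C A L N Z B \<longleftrightarrow> Z \<in> hT10 C A 2 \<and> B \<in> hT01 C A 0 \<and>
     N = NL C A L \<oplus>\<^sub>f vertical_deriv C A Z \<oplus>\<^sub>f tensor_liouville B"

(* THE is meaningful only because the value does not depend on the decomposition chosen. *)
definition Pi_map ::
  "('m, 'n::finite) chart set \<Rightarrow> ('m, 'n) tvec set \<Rightarrow> (('m, 'n) tvec \<Rightarrow> real) \<Rightarrow>
   ('m, 'n) fam2 \<Rightarrow> ('m, 'n) fam2" where
  "Pi_map C A L N =
     (THE S. \<exists>Z B. decomposes C A L N Z B \<and> S = NL C A L \<oplus>\<^sub>f vertical_deriv C A Z)"

definition fiber ::
  "('m, 'n::finite) chart set \<Rightarrow> ('m, 'n) tvec set \<Rightarrow> (('m, 'n) tvec \<Rightarrow> real) \<Rightarrow>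
   ('m, 'n) fam2 \<Rightarrow> ('m, 'n) fam2 set" where
  "fiber C A L S = {N \<in> Sol C A L. Pi_map C A L N = S}"

end

theory Submission
  imports Defs
begin

text \<open>
  Here \<open>y\<close> is the fibre coordinate, \<open>\<partial>\<close> the vertical derivative, also written with an index
  \<open>\<cdot>i\<close>, and \<open>\<delta>\<^sub>i\<close> the horizontal derivative of a connection.  For
  \<open>J = N - N\<^sup>L\<close> and its contraction \<open>W\<^sup>j = J\<^sub>a\<^sup>j y\<^sup>a\<close>, Euler's theorem turns the affine equation into
  \<open>2 J - \<partial>W = b \<otimes> y - \<beta> id\<close> with \<open>\<beta> = b(y)\<close>, whatever the factor \<open>b\<close> in braces is.  Since
  \<open>\<beta> id\<close> is the vertical derivative of \<open>\<beta> y\<close> up to a multiple of \<open>y\<close>, this gives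
  \<open>J = \<partial>Z + B \<otimes> y\<close> with \<open>Z = (W - \<beta> y) / 2\<close> (\<open>affine_equation_decomposition\<close>).  The trace
  \<open>(1 - n) \<beta>\<close> of the equation exhibits \<open>\<beta>\<close> as a smooth scalar, so that \<open>Z\<close> and \<open>B\<close> are tensors
  (\<open>affine_solution_decomposition\<close>).  The part \<open>Z\<close> is unique, because a vertical derivative
  \<open>\<partial>D = a \<otimes> y\<close> of a 2-homogeneous \<open>D\<close> forces \<open>D = 0\<close> when \<open>n \<ge> 2\<close> (\<open>vertical_radial_imp_zero\<close>), and \<open>N\<^sup>L + \<partial>Z\<close> is
  again a solution, because adding \<open>B \<otimes> y\<close> to \<open>J\<close> changes both sides of the affine equation equally
  (\<open>affine_equation_add_radial\<close>).  It is symmetric, as \<open>N\<^sup>L\<close> and \<open>\<partial>Z\<close> both are vertical derivatives,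
  whereas \<open>B \<otimes> y\<close> is symmetric only for \<open>B = 0\<close> (\<open>symmetric_radial_imp_zero\<close>).  This is the projection and its
  property (i).

  Adding \<open>B \<otimes> y\<close> to a connection adds a multiple of the velocity to the geodesic equation, which a
  reparametrization absorbs (\<open>pregeodesic_add_radial\<close>), and changes the curvature by
  \<open>(\<delta>\<^sub>j B\<^sub>i - \<delta>\<^sub>i B\<^sub>j) y\<^sup>k\<close>, whose contribution to the Ricci scalar cancels
  (\<open>Ricci_scalar_add_radial\<close>).  Hence the elements of a fibre share pregeodesics and have equal Ricci scalars.

  Conversely, let \<open>N\<^sup>L + \<partial>Z\<close> and \<open>N\<^sup>L + \<partial>Z'\<close> share pregeodesics.  Through every vector of \<open>A\<close>
  passes a geodesic (\<open>geodesic_exists\<close>, by the Picard-Lindelof theorem), and comparing the two geodesic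
  equations there shows \<open>Z' - Z = \<sigma> y\<close> (\<open>share_pregeodesics_imp_radial\<close>).  For symmetric
  solutions \<open>2 J - \<partial>W\<close> vanishes, hence \<open>b(y) = 0\<close>; and \<open>b(y)\<close> depends on \<open>\<sigma>\<close> by
  \<open>2 (n + 2) \<sigma> - 2 (n + 1) \<sigma> = 2 \<sigma>\<close>, so \<open>\<sigma> = 0\<close> (\<open>radial_imp_zero\<close>,
  \<open>hshift_share_unique\<close>).  For property (iii), \<open>N\<^sup>L\<close> itself may fail to be a solution; but
  \<open>b(y) = 0\<close> still holds for \<open>J = 0\<close>, because the metric is parallel along the spray of \<open>L\<close>
  (\<open>mean_Landsberg_contract\<close>).
\<close>

section \<open>Calculus of smooth maps on open sets\<close>

lemma Ck_on_cong:
  assumes "Ck_on k f S" "open S" "\<And>x. x \<in> S \<Longrightarrow> f x = g x"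
  shows "Ck_on k g S"
  using assms
proof (induction k arbitrary: f g)
  case 0
  then show ?case using continuous_on_cong[of S S f g] by simp
next
  case (Suc k)
  have d: "(g has_derivative frechet_derivative f (at x)) (at x)" if "x \<in> S" for x
    using has_derivative_transform_within_open[of f "frechet_derivative f (at x)" x UNIV S g]
      Suc.prems that frechet_derivative_works[of f "at x"] by auto
  then have e: "frechet_derivative f (at x) = frechet_derivative g (at x)" if "x \<in> S" for x
    using that frechet_derivative_at by blast
  show ?case
    using Suc.IH[OF _ Suc.prems(2)] Suc.prems(1) d e unfolding Ck_on.simps differentiable_def
    by (metis (no_types, lifting))
qed

lemma Ck_on_SucI:
  assumes "open S" "\<And>x. x \<in> S \<Longrightarrow> (f has_derivative f' x) (at x)"
    "\<And>v. Ck_on k (\<lambda>x. f' x v) S"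
  shows "Ck_on (Suc k) f S"
proof -
  have "Ck_on k (\<lambda>x. frechet_derivative f (at x) v) S" for v
    by (rule Ck_on_cong[OF assms(3)[of v] assms(1)]) (simp add: frechet_derivative_at[OF assms(2)])
  then show ?thesis using assms(2) by (auto simp: differentiable_def)
qed

lemma Ck_on_has_derivative:
  assumes "Ck_on (Suc k) f S" "x \<in> S"
  shows "(f has_derivative frechet_derivative f (at x)) (at x)"
  using assms frechet_derivative_works by auto

lemma Ck_on_SucD: "Ck_on (Suc k) f S \<Longrightarrow> Ck_on k f S"
proof (induction k arbitrary: f)
  case 0
  then show ?case
    by (metis Ck_on.simps(1) Ck_on_has_derivative continuous_at_imp_continuous_on has_derivative_continuous)
next
  case (Suc k)
  then show ?case by (metis Ck_on.simps(2))
qed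

lemma Ck_on_subset: "Ck_on k f S \<Longrightarrow> T \<subseteq> S \<Longrightarrow> Ck_on k f T"
  by (induction k arbitrary: f) (auto intro: continuous_on_subset)

lemma Ck_on_const: "Ck_on k (\<lambda>x. c) S"
  by (induction k arbitrary: c) (auto intro: continuous_intros)

lemma Ck_on_bounded_linear:
  assumes "bounded_linear h" "Ck_on k f S" "open S"
  shows "Ck_on k (\<lambda>x. h (f x)) S"
  using assms(2)
proof (induction k arbitrary: f)
  case 0
  then show ?case using assms(1) by (simp add: bounded_linear.continuous_on)
next
  case (Suc k)
  show ?case
  proof (rule Ck_on_SucI[OF assms(3)])
    fix x assume "x \<in> S"
    show "((\<lambda>x. h (f x)) has_derivative (\<lambda>v. h (frechet_derivative f (at x) v))) (at x)"
      by (rule bounded_linear.has_derivative[OF assms(1) Ck_on_has_derivative[OF Suc.prems \<open>x \<in> S\<close>]])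
  qed (use Suc in auto)
qed

lemma Ck_on_linear: "bounded_linear h \<Longrightarrow> open S \<Longrightarrow> Ck_on k h S"
proof (cases k)
  case 0
  moreover assume "bounded_linear h"
  ultimately show ?thesis by (simp add: linear_continuous_on)
next
  case (Suc j)
  moreover assume "bounded_linear h" "open S"
  ultimately show ?thesis using Ck_on_SucI[of S h "\<lambda>_. h" j]
    by (simp add: bounded_linear_imp_has_derivative Ck_on_const)
qed

lemma Ck_on_add:
  assumes "Ck_on k f S" "Ck_on k g S" "open S"
  shows "Ck_on k (\<lambda>x. f x + g x) S"
  using assms(1,2)
proof (induction k arbitrary: f g)
  case 0
  then show ?case by (simp add: continuous_on_add)
next
  case (Suc k)
  show ?case
  proof (rule Ck_on_SucI[OF assms(3)])
    fix x assume "x \<in> S"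
    show "((\<lambda>x. f x + g x) has_derivative (\<lambda>v. frechet_derivative f (at x) v + frechet_derivative g (at x) v)) (at x)"
      by (intro has_derivative_add Ck_on_has_derivative[OF Suc.prems(1) \<open>x \<in> S\<close>] Ck_on_has_derivative[OF Suc.prems(2) \<open>x \<in> S\<close>])
  qed (use Suc in auto)
qed

lemma Ck_on_bilinear:
  assumes "bounded_bilinear h" "Ck_on k f S" "Ck_on k g S" "open S"
  shows "Ck_on k (\<lambda>x. h (f x) (g x)) S"
  using assms(2,3)
proof (induction k arbitrary: f g)
  case 0
  then show ?case using assms(1) by (simp add: bounded_bilinear.continuous_on)
next
  case (Suc k)
  show ?case
  proof (rule Ck_on_SucI[OF assms(4)])
    fix x assume "x \<in> S"
    show "((\<lambda>x. h (f x) (g x)) has_derivative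
        (\<lambda>v. h (f x) (frechet_derivative g (at x) v) + h (frechet_derivative f (at x) v) (g x))) (at x)"
      by (rule bounded_bilinear.FDERIV[OF assms(1) Ck_on_has_derivative[OF Suc.prems(1) \<open>x \<in> S\<close>]
         Ck_on_has_derivative[OF Suc.prems(2) \<open>x \<in> S\<close>]])
  next
    fix v
    show "Ck_on k (\<lambda>x. h (f x) (frechet_derivative g (at x) v) + h (frechet_derivative f (at x) v) (g x)) S"
      using Suc.prems Ck_on_SucD[OF Suc.prems(1)] Ck_on_SucD[OF Suc.prems(2)]
      by (intro Ck_on_add Suc.IH assms(4)) auto
  qed
qed

lemma Ck_on_sum:
  assumes "\<And>i. i \<in> I \<Longrightarrow> Ck_on k (f i) S" "open S"
  shows "Ck_on k (\<lambda>x. \<Sum>i\<in>I. f i x) S"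
  using assms(1) by (induction I rule: infinite_finite_induct) (auto intro: Ck_on_const Ck_on_add assms(2))

lemma Ck_on_compose:
  assumes "Ck_on k f S" "Ck_on k g T" "f ` S \<subseteq> T" "open S" "open T"
  shows "Ck_on k (\<lambda>x. g (f x)) S"
  using assms(1,2)
proof (induction k arbitrary: g)
  case 0
  then show ?case using assms(3) continuous_on_compose2 by auto
next
  case (Suc k)
  have dg: "(g has_derivative frechet_derivative g (at (f x))) (at (f x))" if "x \<in> S" for x
    using Ck_on_has_derivative[OF Suc.prems(2)] assms(3) that by auto
  show ?case
  proof (rule Ck_on_SucI[OF assms(4)])
    fix x assume x: "x \<in> S"
    let ?D = "frechet_derivative g (at (f x))"
    have "((\<lambda>x. g (f x)) has_derivative (\<lambda>v. ?D (frechet_derivative f (at x) v))) (at x)"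
      using diff_chain_at[OF Ck_on_has_derivative[OF Suc.prems(1) x] dg[OF x]] by (simp add: o_def)
    moreover have "?D w = (\<Sum>b\<in>Basis. (w \<bullet> b) *\<^sub>R ?D b)" for w
    proof -
      have "linear ?D" by (rule has_derivative_linear[OF dg[OF x]])
      then have "?D (\<Sum>b\<in>Basis. (w \<bullet> b) *\<^sub>R b) = (\<Sum>b\<in>Basis. (w \<bullet> b) *\<^sub>R ?D b)"
        by (simp add: linear_sum linear_scale)
      then show ?thesis by (simp only: euclidean_representation)
    qed
    then have "(\<lambda>v. ?D (frechet_derivative f (at x) v)) =
        (\<lambda>v. \<Sum>b\<in>Basis. (frechet_derivative f (at x) v \<bullet> b) *\<^sub>R ?D b)"
      by (rule ext)
    ultimately show "((\<lambda>x. g (f x)) has_derivative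
        (\<lambda>v. \<Sum>b\<in>Basis. (frechet_derivative f (at x) v \<bullet> b) *\<^sub>R ?D b)) (at x)"
      by (rule subst[rotated])
  next
    fix v
    have "Ck_on k (\<lambda>x. frechet_derivative g (at (f x)) b) S" for b
      using Suc.IH[of "\<lambda>y. frechet_derivative g (at y) b"] Suc.prems Ck_on_SucD[OF Suc.prems(1)] by simp
    then show "Ck_on k (\<lambda>x. \<Sum>b\<in>Basis. (frechet_derivative f (at x) v \<bullet> b) *\<^sub>R frechet_derivative g (at (f x)) b) S"
      using Suc.prems(1)
      by (intro Ck_on_sum Ck_on_bilinear[OF bounded_bilinear_scaleR] assms(4)
          Ck_on_bounded_linear[OF bounded_linear_inner_left]) auto
  qed
qed

lemma Ck_on_inverse:
  assumes "Ck_on k f S" "open S" "\<And>x. x \<in> S \<Longrightarrow> f x \<noteq> (0::real)"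
  shows "Ck_on k (\<lambda>x. inverse (f x)) S"
  using assms(1)
proof (induction k)
  case 0
  then show ?case using assms(3) by (auto intro: continuous_on_inverse)
next
  case (Suc k)
  show ?case
  proof (rule Ck_on_SucI[OF assms(2)])
    fix x assume x: "x \<in> S"
    show "((\<lambda>x. inverse (f x)) has_derivative (\<lambda>v. - (inverse (f x) * frechet_derivative f (at x) v * inverse (f x)))) (at x)"
      by (rule Deriv.has_derivative_inverse[OF assms(3)[OF x] Ck_on_has_derivative[OF Suc.prems x]])
  next
    fix v
    have "Ck_on k (\<lambda>x. inverse (f x)) S" using Suc.IH[OF Ck_on_SucD[OF Suc.prems]] .
    then have "Ck_on k (\<lambda>x. inverse (f x) * frechet_derivative f (at x) v * inverse (f x)) S"
      using Suc.prems by (intro Ck_on_bilinear[OF bounded_bilinear_mult] assms(2)) auto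
    then show "Ck_on k (\<lambda>x. - (inverse (f x) * frechet_derivative f (at x) v * inverse (f x))) S"
      using Ck_on_bounded_linear[of uminus, OF _ _ assms(2)] bounded_linear_minus[OF bounded_linear_ident] by blast
  qed
qed

lemma smooth_on_differentiable: "smooth_on f S \<Longrightarrow> x \<in> S \<Longrightarrow> f differentiable (at x)"
  unfolding smooth_on_def by (metis Ck_on.simps(2))

lemma smooth_on_has_derivative:
  "smooth_on f S \<Longrightarrow> x \<in> S \<Longrightarrow> (f has_derivative frechet_derivative f (at x)) (at x)"
  using smooth_on_differentiable frechet_derivative_works by blast

lemma smooth_on_continuous: "smooth_on f S \<Longrightarrow> continuous_on S f"
  unfolding smooth_on_def by (metis Ck_on.simps(1))

lemma smooth_on_frechet: "smooth_on f S \<Longrightarrow> smooth_on (\<lambda>x. frechet_derivative f (at x) v) S"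
  unfolding smooth_on_def by (metis Ck_on.simps(2))

lemma smooth_on_cong: "smooth_on f S \<Longrightarrow> open S \<Longrightarrow> (\<And>x. x \<in> S \<Longrightarrow> f x = g x) \<Longrightarrow> smooth_on g S"
  unfolding smooth_on_def using Ck_on_cong by blast

lemma smooth_on_subset: "smooth_on f S \<Longrightarrow> T \<subseteq> S \<Longrightarrow> smooth_on f T"
  unfolding smooth_on_def using Ck_on_subset by blast

lemma smooth_on_const: "smooth_on (\<lambda>x. c) S"
  unfolding smooth_on_def using Ck_on_const by blast

lemma smooth_on_linear: "bounded_linear h \<Longrightarrow> open S \<Longrightarrow> smooth_on h S"
  unfolding smooth_on_def using Ck_on_linear by blast

lemma smooth_on_bounded_linear:
  "bounded_linear h \<Longrightarrow> smooth_on f S \<Longrightarrow> open S \<Longrightarrow> smooth_on (\<lambda>x. h (f x)) S"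
  unfolding smooth_on_def using Ck_on_bounded_linear by blast

lemma smooth_on_add: "smooth_on f S \<Longrightarrow> smooth_on g S \<Longrightarrow> open S \<Longrightarrow> smooth_on (\<lambda>x. f x + g x) S"
  unfolding smooth_on_def using Ck_on_add by blast

lemma smooth_on_bilinear:
  "bounded_bilinear h \<Longrightarrow> smooth_on f S \<Longrightarrow> smooth_on g S \<Longrightarrow> open S \<Longrightarrow> smooth_on (\<lambda>x. h (f x) (g x)) S"
  unfolding smooth_on_def using Ck_on_bilinear by blast

lemma smooth_on_mult:
  fixes f g :: "_ \<Rightarrow> real"
  shows "smooth_on f S \<Longrightarrow> smooth_on g S \<Longrightarrow> open S \<Longrightarrow> smooth_on (\<lambda>x. f x * g x) S"
  by (rule smooth_on_bilinear[OF bounded_bilinear_mult])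

lemma smooth_on_scaleR:
  "smooth_on f S \<Longrightarrow> smooth_on g S \<Longrightarrow> open S \<Longrightarrow> smooth_on (\<lambda>x. f x *\<^sub>R g x) S"
  by (rule smooth_on_bilinear[OF bounded_bilinear_scaleR])

lemma smooth_on_minus: "smooth_on f S \<Longrightarrow> open S \<Longrightarrow> smooth_on (\<lambda>x. - f x) S"
  by (rule smooth_on_bounded_linear[OF bounded_linear_minus[OF bounded_linear_ident]])

lemma smooth_on_diff: "smooth_on f S \<Longrightarrow> smooth_on g S \<Longrightarrow> open S \<Longrightarrow> smooth_on (\<lambda>x. f x - g x) S"
  using smooth_on_add[of f S "\<lambda>x. - g x"] smooth_on_minus[of g S] by simp

lemma smooth_on_sum:
  "(\<And>i. i \<in> I \<Longrightarrow> smooth_on (f i) S) \<Longrightarrow> open S \<Longrightarrow> smooth_on (\<lambda>x. \<Sum>i\<in>I. f i x) S"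
  by (simp add: smooth_on_def Ck_on_sum)

lemma smooth_on_divide:
  fixes f g :: "_ \<Rightarrow> real"
  assumes "smooth_on f S" "smooth_on g S" "open S" "\<And>x. x \<in> S \<Longrightarrow> g x \<noteq> 0"
  shows "smooth_on (\<lambda>x. f x / g x) S"
proof -
  have "smooth_on (\<lambda>x. inverse (g x)) S"
    using assms(2-4) unfolding smooth_on_def using Ck_on_inverse by blast
  then show ?thesis unfolding divide_inverse using assms smooth_on_mult by blast
qed

lemma smooth_on_prod:
  fixes f :: "_ \<Rightarrow> _ \<Rightarrow> real"
  assumes "\<And>i. i \<in> I \<Longrightarrow> smooth_on (f i) S" "open S"
  shows "smooth_on (\<lambda>x. \<Prod>i\<in>I. f i x) S"
  using assms(1)
  by (induction I rule: infinite_finite_induct) (auto intro: smooth_on_const smooth_on_mult assms(2))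

lemma smooth_on_compose:
  "smooth_on f S \<Longrightarrow> smooth_on g T \<Longrightarrow> f ` S \<subseteq> T \<Longrightarrow> open S \<Longrightarrow> open T \<Longrightarrow> smooth_on (\<lambda>x. g (f x)) S"
  unfolding smooth_on_def using Ck_on_compose by blast

lemma smooth_on_vec_nth: "smooth_on f S \<Longrightarrow> open S \<Longrightarrow> smooth_on (\<lambda>x. f x $ i) S"
  for f :: "_ \<Rightarrow> real^'n"
  by (rule smooth_on_bounded_linear[OF bounded_linear_vec_nth])

lemma smooth_on_fst: "smooth_on f S \<Longrightarrow> open S \<Longrightarrow> smooth_on (\<lambda>x. fst (f x)) S"
  by (rule smooth_on_bounded_linear[OF bounded_linear_fst])

lemma smooth_on_snd: "smooth_on f S \<Longrightarrow> open S \<Longrightarrow> smooth_on (\<lambda>x. snd (f x)) S"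
  by (rule smooth_on_bounded_linear[OF bounded_linear_snd])

lemma smooth_on_ident: "open S \<Longrightarrow> smooth_on (\<lambda>x. x) S"
  by (rule smooth_on_linear[OF bounded_linear_ident])

lemma smooth_on_vecI:
  fixes f :: "_ \<Rightarrow> real^'n"
  assumes "\<And>i. smooth_on (\<lambda>x. f x $ i) S" "open S"
  shows "smooth_on f S"
proof -
  have "(\<lambda>x. \<Sum>i\<in>UNIV. f x $ i *\<^sub>R axis i 1) = f"
    by (simp only: basis_expansion scalar_mult_eq_scaleR[symmetric])
  moreover have "smooth_on (\<lambda>x. \<Sum>i\<in>UNIV. f x $ i *\<^sub>R axis i (1::real)) S"
    using assms by (intro smooth_on_sum smooth_on_scaleR smooth_on_const)
  ultimately show ?thesis by simp
qed

lemma smooth_on_Pair: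
  assumes "smooth_on f S" "smooth_on g S" "open S"
  shows "smooth_on (\<lambda>x. (f x, g x)) S"
proof -
  have "smooth_on (\<lambda>x. (f x, 0) + (0, g x)) S"
    using smooth_on_bounded_linear[OF bounded_linear_Pair[OF bounded_linear_ident bounded_linear_zero] assms(1,3)]
      smooth_on_bounded_linear[OF bounded_linear_Pair[OF bounded_linear_zero bounded_linear_ident] assms(2,3)]
    by (rule smooth_on_add[OF _ _ assms(3)])
  then show ?thesis by simp
qed

lemma smooth_on_det:
  fixes M :: "_ \<Rightarrow> real^'n^'n"
  assumes "\<And>i j. smooth_on (\<lambda>x. M x $ i $ j) S" "open S"
  shows "smooth_on (\<lambda>x. det (M x)) S"
  unfolding det_def
  by (intro smooth_on_sum smooth_on_mult smooth_on_prod smooth_on_const assms)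

lemma matrix_inv_mult:
  fixes M :: "real^'n^'n"
  assumes "invertible M"
  shows "M ** matrix_inv M = mat 1" "matrix_inv M ** M = mat 1"
  using someI_ex[OF assms[unfolded invertible_def]] unfolding matrix_inv_def by auto

text \<open>By Cramer's rule the entries of the inverse are quotients of determinants.\<close>

lemma smooth_on_matrix_inv:
  fixes M :: "_ \<Rightarrow> real^'n^'n"
  assumes "\<And>i j. smooth_on (\<lambda>x. M x $ i $ j) S" "open S" "\<And>x. x \<in> S \<Longrightarrow> invertible (M x)"
  shows "smooth_on (\<lambda>x. matrix_inv (M x) $ i $ j) S"
proof -
  let ?R = "\<lambda>x. \<chi> r s. if s = i then axis j 1 $ r else M x $ r $ s"
  have "smooth_on (\<lambda>x. det (?R x) / det (M x)) S"
  proof (rule smooth_on_divide)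
    have "smooth_on (\<lambda>x. ?R x $ r $ s) S" for r s
      using assms(1) by (cases "s = i") (auto intro: smooth_on_const)
    then show "smooth_on (\<lambda>x. det (?R x)) S" by (rule smooth_on_det) (rule assms)
  qed (use assms in \<open>auto simp: invertible_det_nz intro: smooth_on_det\<close>)
  moreover have "det (?R x) / det (M x) = matrix_inv (M x) $ i $ j" if "x \<in> S" for x
  proof -
    have "M x *v (matrix_inv (M x) *v axis j 1) = axis j 1"
      using matrix_inv_mult(1)[OF assms(3)[OF that]] by (simp add: matrix_vector_mul_assoc)
    moreover have "det (M x) \<noteq> 0" using assms(3)[OF that] by (simp add: invertible_det_nz)
    ultimately have "matrix_inv (M x) *v axis j 1 = (\<chi> k. det (\<chi> r s. if s = k then axis j 1 $ r else M x $ r $ s) / det (M x))"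
      using cramer by blast
    moreover have "(matrix_inv (M x) *v axis j 1) $ i = matrix_inv (M x) $ i $ j"
      by (simp add: matrix_vector_mult_basis column_def)
    ultimately show ?thesis by (metis (no_types, lifting) vec_lambda_beta)
  qed
  ultimately show ?thesis by (rule smooth_on_cong[OF _ assms(2)])
qed

text \<open>A mixed second difference over a small parallelogram is, by two applications of the mean
  value theorem, a mixed second derivative at a nearby point, in either order of the
  differentiations; both second derivatives are continuous.\<close>

lemma second_difference_mean_value:
  fixes f :: "'a::euclidean_space \<Rightarrow> real"
  assumes f: "smooth_on f S" and h: "h > 0"
    and sub: "\<And>s t. 0 \<le> s \<Longrightarrow> s \<le> h \<Longrightarrow> 0 \<le> t \<Longrightarrow> t \<le> h \<Longrightarrow> x + s *\<^sub>R u + t *\<^sub>R v \<in> S"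
  obtains s t where "0 < s" "s < h" "0 < t" "t < h"
    "f (x + h *\<^sub>R u + h *\<^sub>R v) - f (x + h *\<^sub>R u) - f (x + h *\<^sub>R v) + f x =
       h * h * frechet_derivative (\<lambda>z. frechet_derivative f (at z) u) (at (x + s *\<^sub>R u + t *\<^sub>R v)) v"
proof -
  let ?F = "\<lambda>z. frechet_derivative f (at z) u"
  define \<psi> where "\<psi> s = f (x + s *\<^sub>R u + h *\<^sub>R v) - f (x + s *\<^sub>R u)" for s
  have lin: "frechet_derivative f (at z) (r *\<^sub>R w) = r * frechet_derivative f (at z) w" if "z \<in> S" for z r w
    using linear_scale[OF has_derivative_linear[OF smooth_on_has_derivative[OF f that]], of r w] by simp
  have lin2: "frechet_derivative ?F (at z) (r *\<^sub>R w) = r * frechet_derivative ?F (at z) w" if "z \<in> S" for z r w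
    using linear_scale[OF has_derivative_linear[OF smooth_on_has_derivative[OF smooth_on_frechet[OF f, of u] that]], of r w] by simp
  have d1: "((\<lambda>s. f (x + s *\<^sub>R u + t *\<^sub>R v)) has_real_derivative ?F (x + s *\<^sub>R u + t *\<^sub>R v)) (at s)"
    if "0 \<le> s" "s \<le> h" "0 \<le> t" "t \<le> h" for s t
  proof -
    have "((\<lambda>s. x + s *\<^sub>R u + t *\<^sub>R v) has_derivative (\<lambda>r. r *\<^sub>R u)) (at s)"
      by (auto intro!: derivative_eq_intros)
    from diff_chain_at[OF this smooth_on_has_derivative[OF f sub[OF that]]]
    show ?thesis unfolding has_field_derivative_def
      by (simp add: o_def lin[OF sub[OF that]] mult_commute_abs)
  qed
  have d2: "((\<lambda>t. ?F (x + s *\<^sub>R u + t *\<^sub>R v)) has_real_derivative frechet_derivative ?F (at (x + s *\<^sub>R u + t *\<^sub>R v)) v) (at t)"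
    if "0 \<le> s" "s \<le> h" "0 \<le> t" "t \<le> h" for s t
  proof -
    have "((\<lambda>t. x + s *\<^sub>R u + t *\<^sub>R v) has_derivative (\<lambda>r. r *\<^sub>R v)) (at t)"
      by (auto intro!: derivative_eq_intros)
    from diff_chain_at[OF this smooth_on_has_derivative[OF smooth_on_frechet[OF f, of u] sub[OF that]]]
    show ?thesis unfolding has_field_derivative_def
      by (simp add: o_def lin2[OF sub[OF that]] mult_commute_abs)
  qed
  have "(\<psi> has_real_derivative ?F (x + s *\<^sub>R u + h *\<^sub>R v) - ?F (x + s *\<^sub>R u)) (at s)" if "0 \<le> s" "s \<le> h" for s
    unfolding \<psi>_def using DERIV_diff[OF d1[OF that, of h] d1[OF that, of 0]] h by simp
  then obtain s where s: "0 < s" "s < h" "\<psi> h - \<psi> 0 = (h - 0) * (?F (x + s *\<^sub>R u + h *\<^sub>R v) - ?F (x + s *\<^sub>R u))"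
    using MVT2[OF h, of \<psi> "\<lambda>s. ?F (x + s *\<^sub>R u + h *\<^sub>R v) - ?F (x + s *\<^sub>R u)"] by blast
  obtain t where t: "0 < t" "t < h" "?F (x + s *\<^sub>R u + h *\<^sub>R v) - ?F (x + s *\<^sub>R u + 0 *\<^sub>R v) =
      (h - 0) * frechet_derivative ?F (at (x + s *\<^sub>R u + t *\<^sub>R v)) v"
    using MVT2[OF h, of "\<lambda>t. ?F (x + s *\<^sub>R u + t *\<^sub>R v)"
        "\<lambda>t. frechet_derivative ?F (at (x + s *\<^sub>R u + t *\<^sub>R v)) v"] d2[of s] s by (meson less_imp_le)
  show thesis
    by (rule that[of s t]) (use s t in \<open>auto simp: \<psi>_def algebra_simps\<close>)
qed

lemma frechet_derivative_commute:
  fixes f :: "'a::euclidean_space \<Rightarrow> real"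
  assumes f: "smooth_on f S" and S: "open S" and x: "x \<in> S"
  shows "frechet_derivative (\<lambda>z. frechet_derivative f (at z) u) (at x) v =
    frechet_derivative (\<lambda>z. frechet_derivative f (at z) v) (at x) u"
proof -
  let ?G = "\<lambda>u v z. frechet_derivative (\<lambda>z. frechet_derivative f (at z) u) (at z) v"
  obtain e where e: "e > 0" "ball x e \<subseteq> S" using S x open_contains_ball by blast
  define h where "h n = e / (2 * (1 + norm u + norm v) * real (Suc n))" for n
  have h0: "h n > 0" for n unfolding h_def using e by (auto intro!: divide_pos_pos mult_pos_pos add_pos_nonneg)
  have hn: "h n * (norm u + norm v) < e" for n
  proof -
    have "norm u + norm v < 2 * (1 + norm u + norm v) * 1"
      by (rule order.strict_trans2[of _ "1 + norm u + norm v"]) auto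
    also have "\<dots> \<le> 2 * (1 + norm u + norm v) * real (Suc n)"
      by (intro mult_left_mono) (auto simp: add_nonneg_nonneg)
    finally show ?thesis unfolding h_def using e
      by (simp add: divide_less_eq add_nonneg_pos add_pos_nonneg del: of_nat_Suc)
  qed
  have near: "norm (s *\<^sub>R u + t *\<^sub>R v) \<le> h n * (norm u + norm v)" if "0 \<le> s" "s \<le> h n" "0 \<le> t" "t \<le> h n" for s t n
  proof -
    have "norm (s *\<^sub>R u + t *\<^sub>R v) \<le> s * norm u + t * norm v"
      using norm_triangle_ineq[of "s *\<^sub>R u" "t *\<^sub>R v"] that by simp
    also have "\<dots> \<le> h n * norm u + h n * norm v" using that by (intro add_mono mult_right_mono) auto
    finally show ?thesis by (simp add: algebra_simps)
  qed
  have sub: "x + s *\<^sub>R u + t *\<^sub>R v \<in> S" if "0 \<le> s" "s \<le> h n" "0 \<le> t" "t \<le> h n" for s t n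
  proof -
    have "dist (x + (s *\<^sub>R u + t *\<^sub>R v)) x < e" using near[OF that] hn[of n] by (simp add: dist_norm)
    then show ?thesis using e(2) by (simp add: add.assoc dist_commute subset_iff)
  qed
  have sub': "x + s *\<^sub>R v + t *\<^sub>R u \<in> S" if "0 \<le> s" "s \<le> h n" "0 \<le> t" "t \<le> h n" for s t n
    using sub[of t n s] that by (simp add: add.assoc add.commute[of "s *\<^sub>R v"])
  have hl: "h \<longlonglongrightarrow> 0"
  proof -
    have "(\<lambda>n. e / (2 * (1 + norm u + norm v)) * inverse (real (Suc n))) \<longlonglongrightarrow> e / (2 * (1 + norm u + norm v)) * 0"
      by (intro tendsto_intros LIMSEQ_inverse_real_of_nat)
    then show ?thesis unfolding h_def by (simp add: divide_inverse mult.assoc del: of_nat_Suc)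
  qed
  have "\<exists>p q. dist p x \<le> h n * (norm u + norm v) \<and> dist q x \<le> h n * (norm u + norm v) \<and> p \<in> S \<and> q \<in> S \<and> ?G u v p = ?G v u q" for n
  proof -
    obtain s t where 1: "0 < s" "s < h n" "0 < t" "t < h n"
      "f (x + h n *\<^sub>R u + h n *\<^sub>R v) - f (x + h n *\<^sub>R u) - f (x + h n *\<^sub>R v) + f x = h n * h n * ?G u v (x + s *\<^sub>R u + t *\<^sub>R v)"
      using second_difference_mean_value[OF f h0[of n], of x u v] sub by blast
    obtain s' t' where 2: "0 < s'" "s' < h n" "0 < t'" "t' < h n"
      "f (x + h n *\<^sub>R v + h n *\<^sub>R u) - f (x + h n *\<^sub>R v) - f (x + h n *\<^sub>R u) + f x = h n * h n * ?G v u (x + s' *\<^sub>R v + t' *\<^sub>R u)"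
      using second_difference_mean_value[OF f h0[of n], of x v u] sub' by blast
    have sw: "x + s' *\<^sub>R v + t' *\<^sub>R u = x + t' *\<^sub>R u + s' *\<^sub>R v" by simp
    have "h n * h n * ?G u v (x + s *\<^sub>R u + t *\<^sub>R v) = h n * h n * ?G v u (x + s' *\<^sub>R v + t' *\<^sub>R u)"
      using 1(5) 2(5) add.commute[of "h n *\<^sub>R u" "h n *\<^sub>R v"] by (simp only: add.assoc)
    then have "?G u v (x + s *\<^sub>R u + t *\<^sub>R v) = ?G v u (x + t' *\<^sub>R u + s' *\<^sub>R v)" using h0[of n] sw by simp
    moreover have "dist (x + s *\<^sub>R u + t *\<^sub>R v) x \<le> h n * (norm u + norm v)"
      "dist (x + t' *\<^sub>R u + s' *\<^sub>R v) x \<le> h n * (norm u + norm v)"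
      using near[of s n t] near[of t' n s'] 1 2 by (auto simp: dist_norm add.assoc)
    moreover have "x + s *\<^sub>R u + t *\<^sub>R v \<in> S" "x + t' *\<^sub>R u + s' *\<^sub>R v \<in> S"
      using sub[of s n t] sub[of t' n s'] 1 2 by auto
    ultimately show ?thesis by blast
  qed
  then obtain p q where pq: "\<And>n. dist (p n) x \<le> h n * (norm u + norm v)" "\<And>n. dist (q n) x \<le> h n * (norm u + norm v)"
    "\<And>n. p n \<in> S" "\<And>n. q n \<in> S" "\<And>n. ?G u v (p n) = ?G v u (q n)" by metis
  have hl': "(\<lambda>n. h n * (norm u + norm v)) \<longlonglongrightarrow> 0" using tendsto_mult_left_zero[OF hl] by blast
  have lim: "r \<longlonglongrightarrow> x" if "\<And>n. dist (r n) x \<le> h n * (norm u + norm v)" for r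
  proof -
    have "(\<lambda>n. dist (r n) x) \<longlonglongrightarrow> 0"
      by (rule tendsto_sandwich[OF _ _ tendsto_const hl']) (use that in auto)
    then show ?thesis using tendsto_dist_iff by blast
  qed
  have c: "isCont (?G u v) x" for u v
    using smooth_on_continuous[OF smooth_on_frechet[OF smooth_on_frechet[OF f]]] S x continuous_on_eq_continuous_at by blast
  have "(\<lambda>n. ?G u v (p n)) \<longlonglongrightarrow> ?G u v x"
    by (rule isCont_tendsto_compose[OF c lim[OF pq(1)]])
  moreover have "(\<lambda>n. ?G u v (p n)) \<longlonglongrightarrow> ?G v u x"
    unfolding pq(5) by (rule isCont_tendsto_compose[OF c lim[OF pq(2)]])
  ultimately show ?thesis by (rule LIMSEQ_unique)
qed

section \<open>Partial derivatives and homogeneous functions on a conic region\<close>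

lemma frechet_derivative_rules:
  fixes f g :: "'a::euclidean_space \<Rightarrow> real"
  assumes "f differentiable (at p)" "g differentiable (at p)"
  shows "frechet_derivative (\<lambda>p. f p + g p) (at p) v = frechet_derivative f (at p) v + frechet_derivative g (at p) v"
    and "frechet_derivative (\<lambda>p. f p - g p) (at p) v = frechet_derivative f (at p) v - frechet_derivative g (at p) v"
    and "frechet_derivative (\<lambda>p. f p * g p) (at p) v = f p * frechet_derivative g (at p) v + frechet_derivative f (at p) v * g p"
proof -
  note f = assms(1)[unfolded frechet_derivative_works] and g = assms(2)[unfolded frechet_derivative_works]
  show "frechet_derivative (\<lambda>p. f p + g p) (at p) v = frechet_derivative f (at p) v + frechet_derivative g (at p) v"
    by (rule fun_cong[OF frechet_derivative_at[OF has_derivative_add[OF f g], symmetric]])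
  show "frechet_derivative (\<lambda>p. f p - g p) (at p) v = frechet_derivative f (at p) v - frechet_derivative g (at p) v"
    by (rule fun_cong[OF frechet_derivative_at[OF has_derivative_diff[OF f g], symmetric]])
  show "frechet_derivative (\<lambda>p. f p * g p) (at p) v = f p * frechet_derivative g (at p) v + frechet_derivative f (at p) v * g p"
    by (rule fun_cong[OF frechet_derivative_at[OF has_derivative_mult[OF f g], symmetric]])
qed

lemma frechet_derivative_sum:
  fixes f :: "'i \<Rightarrow> 'a::euclidean_space \<Rightarrow> real"
  assumes "\<And>i. i \<in> I \<Longrightarrow> f i differentiable (at p)"
  shows "frechet_derivative (\<lambda>p. \<Sum>i\<in>I. f i p) (at p) v = (\<Sum>i\<in>I. frechet_derivative (f i) (at p) v)"
proof -
  have "((\<lambda>p. \<Sum>i\<in>I. f i p) has_derivative (\<lambda>v. \<Sum>i\<in>I. frechet_derivative (f i) (at p) v)) (at p)"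
    using assms frechet_derivative_works by (intro has_derivative_sum) blast
  then show ?thesis by (rule fun_cong[OF frechet_derivative_at[symmetric]])
qed

lemma frechet_derivative_snd_nth:
  "frechet_derivative (\<lambda>p::'n::finite pt. snd p $ k) (at p) v = snd v $ k"
proof -
  have "((\<lambda>p::'n pt. snd p $ k) has_derivative (\<lambda>v. snd v $ k)) (at p)"
    by (intro bounded_linear_imp_has_derivative bounded_linear_compose[OF bounded_linear_vec_nth bounded_linear_snd])
  then show ?thesis by (rule fun_cong[OF frechet_derivative_at[symmetric]])
qed

lemma smooth_on_snd_nth: "open S \<Longrightarrow> smooth_on (\<lambda>p::'n::finite pt. snd p $ k) S"
  by (intro smooth_on_vec_nth smooth_on_snd smooth_on_ident)

lemma smooth_on_pdx: "smooth_on f S \<Longrightarrow> smooth_on (pdx i f) S"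
  unfolding pdx_def by (rule smooth_on_frechet)

lemma smooth_on_pdy: "smooth_on f S \<Longrightarrow> smooth_on (pdy i f) S"
  unfolding pdy_def by (rule smooth_on_frechet)

lemma pd_const: "pdx i (\<lambda>_. c) p = 0" "pdy i (\<lambda>_. c) p = 0"
  by (simp_all add: pdx_def pdy_def)

lemma pd_snd_nth: "pdx i (\<lambda>p. snd p $ k) p = 0" "pdy i (\<lambda>p. snd p $ k) p = (if k = i then 1 else 0)"
  by (simp_all add: pdx_def pdy_def frechet_derivative_snd_nth axis_def)

lemma pd_add:
  assumes "smooth_on f S" "smooth_on g S" "p \<in> S"
  shows "pdx i (\<lambda>p. f p + g p) p = pdx i f p + pdx i g p" "pdy i (\<lambda>p. f p + g p) p = pdy i f p + pdy i g p"
  unfolding pdx_def pdy_def using smooth_on_differentiable[OF assms(1,3)] smooth_on_differentiable[OF assms(2,3)]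
  by (simp_all add: frechet_derivative_rules)

lemma pd_diff:
  assumes "smooth_on f S" "smooth_on g S" "p \<in> S"
  shows "pdx i (\<lambda>p. f p - g p) p = pdx i f p - pdx i g p" "pdy i (\<lambda>p. f p - g p) p = pdy i f p - pdy i g p"
  unfolding pdx_def pdy_def using smooth_on_differentiable[OF assms(1,3)] smooth_on_differentiable[OF assms(2,3)]
  by (simp_all add: frechet_derivative_rules)

lemma pd_mult:
  assumes "smooth_on f S" "smooth_on g S" "p \<in> S"
  shows "pdx i (\<lambda>p. f p * g p) p = f p * pdx i g p + pdx i f p * g p"
    "pdy i (\<lambda>p. f p * g p) p = f p * pdy i g p + pdy i f p * g p"
  unfolding pdx_def pdy_def using smooth_on_differentiable[OF assms(1,3)] smooth_on_differentiable[OF assms(2,3)]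
  by (simp_all add: frechet_derivative_rules)

lemma pd_sum:
  assumes "\<And>a. a \<in> I \<Longrightarrow> smooth_on (f a) S" "p \<in> S"
  shows "pdx i (\<lambda>p. \<Sum>a\<in>I. f a p) p = (\<Sum>a\<in>I. pdx i (f a) p)"
    "pdy i (\<lambda>p. \<Sum>a\<in>I. f a p) p = (\<Sum>a\<in>I. pdy i (f a) p)"
  unfolding pdx_def pdy_def using smooth_on_differentiable[OF assms] by (simp_all add: frechet_derivative_sum)

lemma pd_cmult:
  assumes "smooth_on f S" "p \<in> S"
  shows "pdx i (\<lambda>p. c * f p) p = c * pdx i f p" "pdy i (\<lambda>p. c * f p) p = c * pdy i f p"
  using pd_mult[OF smooth_on_const[of c] assms] by (simp_all add: pd_const)

lemma pd_cong:
  assumes "smooth_on f S" "open S" "p \<in> S" "\<And>q. q \<in> S \<Longrightarrow> f q = g q"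
  shows "pdx i f p = pdx i g p" "pdy i f p = pdy i g p"
proof -
  have "frechet_derivative f (at p) = frechet_derivative g (at p)"
    by (rule frechet_derivative_transform_within_open[OF smooth_on_differentiable[OF assms(1,3)] assms(2,3,4)])
  then show "pdx i f p = pdx i g p" "pdy i f p = pdy i g p" by (simp_all add: pdx_def pdy_def)
qed

lemma pd_commute:
  assumes "smooth_on f S" "open S" "p \<in> S"
  shows "pdy i (pdy j f) p = pdy j (pdy i f) p" "pdy i (pdx j f) p = pdx j (pdy i f) p"
  unfolding pdx_def pdy_def using frechet_derivative_commute[OF assms] by blast+

lemma frechet_derivative_pt:
  assumes "f differentiable (at p)"
  shows "frechet_derivative f (at p) (u, w) = (\<Sum>a\<in>UNIV. u $ a * pdx a f p) + (\<Sum>a\<in>UNIV. w $ a * pdy a f p)"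
proof -
  let ?D = "frechet_derivative f (at p)"
  have l: "linear ?D" using assms frechet_derivative_works has_derivative_linear by blast
  have e: "u = (\<Sum>a\<in>UNIV. u $ a *\<^sub>R axis a 1)" for u :: "real^'a"
    by (simp only: basis_expansion scalar_mult_eq_scaleR[symmetric])
  have s1: "(\<Sum>a\<in>UNIV. u $ a *\<^sub>R (axis a 1, 0)) = ((u, 0) :: 'a pt)" (is "?s = _")
  proof -
    have "?s = (\<Sum>a\<in>UNIV. u $ a *\<^sub>R axis a 1, 0)" by (simp add: prod_eq_iff fst_sum snd_sum)
    then show ?thesis using e[of u] by simp
  qed
  have s2: "(\<Sum>a\<in>UNIV. w $ a *\<^sub>R (0, axis a 1)) = ((0, w) :: 'a pt)" (is "?s = _")
  proof -
    have "?s = (0, \<Sum>a\<in>UNIV. w $ a *\<^sub>R axis a 1)" by (simp add: prod_eq_iff fst_sum snd_sum)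
    then show ?thesis using e[of w] by simp
  qed
  have "?D (u, w) = ?D (u, 0) + ?D (0, w)" using linear_add[OF l, of "(u, 0)" "(0, w)"] by simp
  moreover have "?D (u, 0) = (\<Sum>a\<in>UNIV. u $ a * pdx a f p)"
    unfolding s1[symmetric] pdx_def by (simp only: linear_sum[OF l] linear_scale[OF l] real_scaleR_def)
  moreover have "?D (0, w) = (\<Sum>a\<in>UNIV. w $ a * pdy a f p)"
    unfolding s2[symmetric] pdy_def by (simp only: linear_sum[OF l] linear_scale[OF l] real_scaleR_def)
  ultimately show ?thesis by simp
qed

lemma sum_kronecker:
  fixes f :: "'n::finite \<Rightarrow> real"
  shows "(\<Sum>a\<in>UNIV. (if a = i then 1 else 0) * f a) = f i" "(\<Sum>a\<in>UNIV. (if i = a then 1 else 0) * f a) = f i"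
    "(\<Sum>a\<in>UNIV. f a * (if a = i then 1 else 0)) = f i" "(\<Sum>a\<in>UNIV. f a * (if i = a then 1 else 0)) = f i"
  by (simp_all add: if_distrib[of "\<lambda>z. z * _"] if_distrib[of "(*) _"] cong: if_cong)

lemma pos_homogeneous_iff:
  "pos_homogeneous \<alpha> f S \<longleftrightarrow> (\<forall>x y l. (x, y) \<in> S \<longrightarrow> l > 0 \<longrightarrow> f (x, l *\<^sub>R y) = l powr \<alpha> * f (x, y))"
  unfolding pos_homogeneous_def by blast

text \<open>The setting of all computations in one chart \<open>c\<close>, where \<open>S\<close> is \<open>adom A c\<close>.\<close>

locale conic_region =
  fixes S :: "'n::finite pt set"
  assumes open_S: "open S"
    and conic_S: "\<And>x y l. (x, y) \<in> S \<Longrightarrow> l > 0 \<Longrightarrow> (x, l *\<^sub>R y) \<in> S"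
    and nonzero_S: "\<And>x y. (x, y) \<in> S \<Longrightarrow> y \<noteq> 0"
begin

definition smooth_hom :: "real \<Rightarrow> ('n pt \<Rightarrow> real) \<Rightarrow> bool" where
  "smooth_hom \<alpha> f \<longleftrightarrow> smooth_on f S \<and> pos_homogeneous \<alpha> f S"

lemma smooth_homD: "smooth_hom \<alpha> f \<Longrightarrow> smooth_on f S" by (simp add: smooth_hom_def)

lemma smooth_hom_snd_nth: "smooth_hom 1 (\<lambda>p. snd p $ k)"
  unfolding smooth_hom_def pos_homogeneous_iff by (auto intro: smooth_on_snd_nth open_S)

lemma smooth_hom_const: "smooth_hom 0 (\<lambda>p. c)"
  unfolding smooth_hom_def pos_homogeneous_iff by (auto intro: smooth_on_const)

lemma smooth_hom_add: "smooth_hom \<alpha> f \<Longrightarrow> smooth_hom \<alpha> g \<Longrightarrow> smooth_hom \<alpha> (\<lambda>p. f p + g p)"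
  unfolding smooth_hom_def pos_homogeneous_iff
  by (auto intro!: smooth_on_add open_S simp: distrib_left)

lemma smooth_hom_diff: "smooth_hom \<alpha> f \<Longrightarrow> smooth_hom \<alpha> g \<Longrightarrow> smooth_hom \<alpha> (\<lambda>p. f p - g p)"
  unfolding smooth_hom_def pos_homogeneous_iff
  by (auto intro!: smooth_on_diff open_S simp: right_diff_distrib)

lemma smooth_hom_mult:
  "smooth_hom \<alpha> f \<Longrightarrow> smooth_hom \<beta> g \<Longrightarrow> \<gamma> = \<alpha> + \<beta> \<Longrightarrow> smooth_hom \<gamma> (\<lambda>p. f p * g p)"
  unfolding smooth_hom_def pos_homogeneous_iff
  by (auto intro!: smooth_on_mult open_S simp: powr_add)

lemma smooth_hom_divide:
  assumes "smooth_hom \<alpha> f" "smooth_hom \<beta> g" "\<gamma> = \<alpha> - \<beta>" "\<And>p. p \<in> S \<Longrightarrow> g p \<noteq> 0"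
  shows "smooth_hom \<gamma> (\<lambda>p. f p / g p)"
  using assms unfolding smooth_hom_def pos_homogeneous_iff
  by (auto intro!: smooth_on_divide open_S simp: powr_diff)

lemma smooth_hom_sum: "(\<And>a. a \<in> I \<Longrightarrow> smooth_hom \<alpha> (f a)) \<Longrightarrow> smooth_hom \<alpha> (\<lambda>p. \<Sum>a\<in>I. f a p)"
  unfolding smooth_hom_def pos_homogeneous_iff
  by (auto intro!: smooth_on_sum open_S sum.cong simp: sum_distrib_left)

lemma smooth_hom_cmult: "smooth_hom \<alpha> f \<Longrightarrow> smooth_hom \<alpha> (\<lambda>p. c * f p)"
  using smooth_hom_mult[OF smooth_hom_const, of \<alpha> f \<alpha> c] by simp

lemma smooth_hom_cong: "smooth_hom \<alpha> f \<Longrightarrow> (\<And>p. p \<in> S \<Longrightarrow> f p = g p) \<Longrightarrow> smooth_hom \<alpha> g"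
  unfolding smooth_hom_def pos_homogeneous_iff
  using smooth_on_cong[OF _ open_S, of f g] conic_S by simp

lemma euler:
  assumes "smooth_hom \<alpha> f" "p \<in> S"
  shows "(\<Sum>a\<in>UNIV. pdy a f p * snd p $ a) = \<alpha> * f p"
proof -
  obtain x y where p: "p = (x, y)" by fastforce
  have d: "f differentiable (at p)" using assms smooth_homD smooth_on_differentiable by blast
  have "((\<lambda>l. (x, l *\<^sub>R y)) has_derivative (\<lambda>r. (0, r *\<^sub>R y))) (at 1)"
    by (auto intro!: derivative_eq_intros)
  moreover have "(f has_derivative frechet_derivative f (at p)) (at (x, 1 *\<^sub>R y))"
    using d p frechet_derivative_works by auto
  ultimately have "((\<lambda>l. f (x, l *\<^sub>R y)) has_derivative (\<lambda>r. frechet_derivative f (at p) (0, r *\<^sub>R y))) (at 1)"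
    using diff_chain_at unfolding o_def by fast
  then have "((\<lambda>l. l powr \<alpha> * f p) has_derivative (\<lambda>r. frechet_derivative f (at p) (0, r *\<^sub>R y))) (at 1)"
    by (rule has_derivative_transform_within_open[of _ _ _ _ "{0<..}"])
       (use assms p in \<open>auto simp: smooth_hom_def pos_homogeneous_def\<close>)
  moreover have "((\<lambda>l. l powr \<alpha> * f p) has_derivative (\<lambda>r. \<alpha> * f p * r)) (at 1)"
    by (auto intro!: derivative_eq_intros simp: fun_eq_iff)
  ultimately have "(\<lambda>r. frechet_derivative f (at p) (0, r *\<^sub>R y)) = (\<lambda>r. \<alpha> * f p * r)"
    by (rule has_derivative_unique)
  from fun_cong[OF this, of 1] have "frechet_derivative f (at p) (0, y) = \<alpha> * f p" by simp
  then show ?thesis using frechet_derivative_pt[OF d, of 0 y] p by (simp add: mult.commute)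
qed

text \<open>The exponent \<open>\<kappa>\<close> is the weight of the direction \<open>v\<close> under the scaling of the fibres:
  \<open>0\<close> along the base and \<open>1\<close> along the fibre.\<close>

lemma smooth_hom_frechet:
  assumes "smooth_hom \<alpha> f" and v: "\<And>l. l > 0 \<Longrightarrow> (fst v, l *\<^sub>R snd v) = l powr \<kappa> *\<^sub>R v"
  shows "smooth_hom (\<alpha> - \<kappa>) (\<lambda>p. frechet_derivative f (at p) v)"
  unfolding smooth_hom_def
proof
  show "smooth_on (\<lambda>p. frechet_derivative f (at p) v) S" using smooth_on_frechet[OF smooth_homD[OF assms(1)]] .
  have "frechet_derivative f (at (x, l *\<^sub>R y)) v = l powr (\<alpha> - \<kappa>) * frechet_derivative f (at (x, y)) v"
    if "(x, y) \<in> S" "l > 0" for x y l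
  proof -
    let ?D = "frechet_derivative f (at (x, l *\<^sub>R y))" and ?E = "frechet_derivative f (at (x, y))"
    have D: "(f has_derivative ?D) (at (x, l *\<^sub>R y))" and E: "(f has_derivative ?E) (at (x, y))"
      using smooth_on_has_derivative[OF smooth_homD[OF assms(1)]] that conic_S by auto
    have "((\<lambda>q. (fst q, l *\<^sub>R snd q)) has_derivative (\<lambda>q. (fst q, l *\<^sub>R snd q))) (at (x, y))"
      by (auto intro!: derivative_eq_intros)
    from diff_chain_at[OF this, of f ?D] D
    have "((\<lambda>q. f (fst q, l *\<^sub>R snd q)) has_derivative (\<lambda>q. ?D (fst q, l *\<^sub>R snd q))) (at (x, y))"
      by (simp add: o_def)
    then have "((\<lambda>q. l powr \<alpha> * f q) has_derivative (\<lambda>q. ?D (fst q, l *\<^sub>R snd q))) (at (x, y))"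
      by (rule has_derivative_transform_within_open[of _ _ _ _ S])
         (use assms that open_S in \<open>auto simp: smooth_hom_def pos_homogeneous_def\<close>)
    moreover have "((\<lambda>q. l powr \<alpha> * f q) has_derivative (\<lambda>q. l powr \<alpha> * ?E q)) (at (x, y))"
      by (rule has_derivative_mult_right[OF E])
    ultimately have "(\<lambda>q. ?D (fst q, l *\<^sub>R snd q)) = (\<lambda>q. l powr \<alpha> * ?E q)"
      by (rule has_derivative_unique)
    from fun_cong[OF this, of v] have "l powr \<kappa> * ?D v = l powr \<alpha> * ?E v"
      using linear_scale[OF has_derivative_linear[OF D]] v[OF that(2)] by simp
    then show ?thesis using that(2) by (simp add: powr_diff field_simps)
  qed
  then show "pos_homogeneous (\<alpha> - \<kappa>) (\<lambda>p. frechet_derivative f (at p) v) S"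
    unfolding pos_homogeneous_def by blast
qed

lemma smooth_hom_pdy: "smooth_hom \<alpha> f \<Longrightarrow> \<beta> = \<alpha> - 1 \<Longrightarrow> smooth_hom \<beta> (pdy i f)"
  unfolding pdy_def using smooth_hom_frechet[of \<alpha> f "(0, axis i 1)" 1] by simp

lemma smooth_hom_pdx: "smooth_hom \<alpha> f \<Longrightarrow> smooth_hom \<alpha> (pdx i f)"
  unfolding pdx_def using smooth_hom_frechet[of \<alpha> f "(axis i 1, 0)" 0] by simp

lemmas smooth_intros = smooth_on_add[OF _ _ open_S] smooth_on_diff[OF _ _ open_S] smooth_on_mult[OF _ _ open_S]
  smooth_on_sum[OF _ open_S] smooth_on_const smooth_on_snd_nth[OF open_S] smooth_on_pdx smooth_on_pdy

end

section \<open>The affine equation in a chart\<close>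

context conic_region
begin

definition contract :: "('n \<Rightarrow> 'n \<Rightarrow> 'n pt \<Rightarrow> real) \<Rightarrow> 'n \<Rightarrow> 'n pt \<Rightarrow> real" where
  "contract J j p = (\<Sum>a\<in>UNIV. J a j p * snd p $ a)"

lemma smooth_hom_contract: "(\<And>i. smooth_hom 1 (J i j)) \<Longrightarrow> smooth_hom 2 (contract J j)"
  unfolding contract_def by (intro smooth_hom_sum smooth_hom_mult[OF _ smooth_hom_snd_nth]) auto

lemma pdy_contract:
  assumes "\<And>i. smooth_on (J i j) S" "p \<in> S"
  shows "pdy i (contract J j) p = J i j p + (\<Sum>a\<in>UNIV. pdy i (J a j) p * snd p $ a)"
proof -
  have "pdy i (\<lambda>p. \<Sum>a\<in>UNIV. J a j p * snd p $ a) p = (\<Sum>a\<in>UNIV. pdy i (\<lambda>p. J a j p * snd p $ a) p)"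
    by (rule pd_sum(2)[OF _ assms(2)]) (intro smooth_intros assms)
  also have "\<dots> = (\<Sum>a\<in>UNIV. J a j p * (if a = i then 1 else 0) + pdy i (J a j) p * snd p $ a)"
    by (simp only: pd_mult(2)[OF assms(1) smooth_on_snd_nth[OF open_S] assms(2)] pd_snd_nth)
  also have "\<dots> = J i j p + (\<Sum>a\<in>UNIV. pdy i (J a j) p * snd p $ a)"
    by (simp only: sum.distrib sum_kronecker)
  finally show ?thesis unfolding contract_def .
qed

text \<open>The torsion term is a difference of two sums.  The first is \<open>J\<^sub>i\<^sup>j\<close> by Euler, and \<open>pdy_contract\<close>
  expresses the second by the contraction.\<close>

lemma affine_equation_iff:
  assumes "\<And>i j. smooth_hom 1 (J i j)" "p \<in> S"
  shows "affine_equation f J p \<longleftrightarrow> (\<forall>i j.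
    bracket f J i p * snd p $ j - (\<Sum>b\<in>UNIV. bracket f J b p * snd p $ b) * (if i = j then 1 else 0) =
    2 * J i j p - pdy i (contract J j) p)"
proof -
  have "(\<Sum>b\<in>UNIV. bracket f J b p * ((if b = i then 1 else 0) * snd p $ j - snd p $ b * (if j = i then 1 else 0)))
     = bracket f J i p * snd p $ j - (\<Sum>b\<in>UNIV. bracket f J b p * snd p $ b) * (if i = j then 1 else 0)" for i j
  proof -
    have "(\<Sum>b\<in>UNIV. bracket f J b p * ((if b = i then 1 else 0) * snd p $ j - snd p $ b * (if j = i then 1 else 0)))
     = (\<Sum>b\<in>UNIV. (if b = i then 1 else 0) * (bracket f J b p * snd p $ j) - bracket f J b p * snd p $ b * (if i = j then 1 else 0))"
      by (intro sum.cong) (auto simp: algebra_simps)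
    then show ?thesis by (simp only: sum_subtractf sum_kronecker sum_distrib_right)
  qed
  moreover have "(\<Sum>a\<in>UNIV. (pdy a (J i j) p - pdy i (J a j) p) * snd p $ a) =
     J i j p - (pdy i (contract J j) p - J i j p)" for i j
    using pdy_contract[of J j p i] euler[OF assms, of i j] smooth_homD[OF assms(1)] assms(2) by (simp add: left_diff_distrib sum_subtractf)
  moreover have "x - (a - (w - a)) = 0 \<longleftrightarrow> x = 2 * a - w" for x a w :: real by auto
  ultimately show ?thesis unfolding affine_equation_def by (simp only:)
qed

text \<open>For a solution \<open>J\<close> of the affine equation the first function is the coefficient \<open>\<beta>\<close> of the identity,
  recovered from the trace, and the second is the field \<open>Z\<close> of the decomposition
  \<open>J = \<partial>Z + B \<otimes> y\<close>.\<close>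

definition radial_part :: "('n \<Rightarrow> 'n \<Rightarrow> 'n pt \<Rightarrow> real) \<Rightarrow> 'n pt \<Rightarrow> real" where
  "radial_part J p = (\<Sum>i\<in>UNIV. 2 * J i i p - pdy i (contract J i) p) / (1 - real CARD('n))"

definition zpart :: "('n \<Rightarrow> 'n \<Rightarrow> 'n pt \<Rightarrow> real) \<Rightarrow> 'n \<Rightarrow> 'n pt \<Rightarrow> real" where
  "zpart J j p = (1/2) * (contract J j p - radial_part J p * snd p $ j)"

lemma smooth_hom_radial_part: "(\<And>i j. smooth_hom 1 (J i j)) \<Longrightarrow> smooth_hom 1 (radial_part J)"
  unfolding radial_part_def divide_inverse mult.commute[of _ "inverse _"]
  by (intro smooth_hom_cmult smooth_hom_sum smooth_hom_diff smooth_hom_pdy[OF smooth_hom_contract]) auto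

lemma smooth_hom_zpart: "(\<And>i j. smooth_hom 1 (J i j)) \<Longrightarrow> smooth_hom 2 (zpart J j)"
  unfolding zpart_def
  by (intro smooth_hom_cmult smooth_hom_diff smooth_hom_contract
      smooth_hom_mult[OF smooth_hom_radial_part smooth_hom_snd_nth]) auto

lemma radial_part_eq:
  assumes "CARD('n) \<ge> 2" "\<And>i j. b i * y j - \<beta> * (if i = j then 1 else 0) = 2 * J i j p - pdy i (contract J j) p"
    "\<beta> = (\<Sum>i\<in>UNIV. b i * y i)"
  shows "radial_part J p = \<beta>"
proof -
  have "(\<Sum>i\<in>UNIV. 2 * J i i p - pdy i (contract J i) p) = (\<Sum>i\<in>UNIV. b i * y i - \<beta>)"
    by (intro sum.cong refl) (simp add: assms(2)[symmetric])
  also have "\<dots> = \<beta> * (1 - real CARD('n))" by (simp add: sum_subtractf assms(3) algebra_simps)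
  finally show ?thesis unfolding radial_part_def using assms(1) by simp
qed

text \<open>The affine equation says that \<open>2 * J\<close> minus the vertical derivative of its contraction \<open>W\<close>
  is \<open>b \<otimes> y - \<beta> id\<close>, whatever the factor \<open>b\<close> is.  Taking the trace yields \<open>\<beta>\<close>, and
  \<open>\<beta> id\<close> is the vertical derivative of \<open>\<beta> y\<close> up to a multiple of \<open>y\<close>; hence
  \<open>Z = (W - \<beta> y) / 2\<close> has the vertical derivative \<open>J\<close> up to a multiple of \<open>y\<close>.\<close>

lemma affine_equation_decomposition:
  assumes n: "CARD('n) \<ge> 2" and J: "\<And>i j. smooth_hom 1 (J i j)"
    and aff: "\<And>q. q \<in> S \<Longrightarrow> affine_equation f J q" and p: "p \<in> S"
  shows "\<exists>a. \<forall>i j. J i j p - pdy i (zpart J j) p = a i * snd p $ j"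
proof -
  let ?b = "\<lambda>i. bracket f J i p" let ?\<beta> = "\<Sum>b\<in>UNIV. ?b b * snd p $ b"
  have eq: "?b i * snd p $ j - ?\<beta> * (if i = j then 1 else 0) = 2 * J i j p - pdy i (contract J j) p" for i j
    using aff[OF p] unfolding affine_equation_iff[OF J p] by blast
  have rp: "radial_part J p = ?\<beta>" by (rule radial_part_eq[OF n eq refl])
  note sm = smooth_homD[OF smooth_hom_radial_part[OF J]] smooth_homD[OF smooth_hom_contract[OF J]]
  have "pdy i (zpart J j) p = (1/2) * (pdy i (contract J j) p -
      (radial_part J p * (if i = j then 1 else 0) + pdy i (radial_part J) p * snd p $ j))" for i j
  proof -
    have s: "smooth_on (\<lambda>p. radial_part J p * snd p $ j) S" by (intro smooth_intros sm)
    have "pdy i (\<lambda>p. (1/2) * (contract J j p - radial_part J p * snd p $ j)) p =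
       (1/2) * (pdy i (contract J j) p - pdy i (\<lambda>p. radial_part J p * snd p $ j) p)"
      by (subst pd_cmult(2)[OF smooth_on_diff[OF sm(2) s open_S] p]) (simp add: pd_diff(2)[OF sm(2) s p])
    then show ?thesis unfolding zpart_def pd_mult(2)[OF sm(1) smooth_on_snd_nth[OF open_S] p] pd_snd_nth
      by (simp add: eq_commute)
  qed
  note dz = this
  have "J i j p - pdy i (zpart J j) p = ((?b i + pdy i (radial_part J) p) / 2) * snd p $ j" for i j
    using eq[of i j] dz[of i j] rp by (cases "i = j") (simp_all add: field_simps)
  then show ?thesis by (intro exI[of _ "\<lambda>i. (?b i + pdy i (radial_part J) p) / 2"] allI)
qed

text \<open>If the vertical derivative of \<open>Z\<close> is radial, so is \<open>Z\<close>, by Euler; and the vertical derivatives of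
  \<open>y\<^sup>k Z\<^sup>j = y\<^sup>j Z\<^sup>k\<close> collapse to \<open>\<delta>\<^sub>i\<^sup>k Z\<^sup>j = \<delta>\<^sub>i\<^sup>j Z\<^sup>k\<close>.\<close>

lemma vertical_radial_imp_zero:
  assumes n: "CARD('n) \<ge> 2" and Z: "\<And>k. smooth_hom 2 (Z k)"
    and rad: "\<And>q. q \<in> S \<Longrightarrow> \<exists>a. \<forall>i k. pdy i (Z k) q = a i * snd q $ k" and p: "p \<in> S"
  shows "Z j p = 0"
proof -
  note sm = smooth_homD[OF Z] smooth_on_snd_nth[OF open_S]
  have sym: "snd q $ k * Z j q = snd q $ j * Z k q" if "q \<in> S" for q j k
  proof -
    obtain a where a: "\<And>i k. pdy i (Z k) q = a i * snd q $ k" using rad[OF \<open>q \<in> S\<close>] by blast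
    have "2 * Z k q = (\<Sum>i\<in>UNIV. a i * snd q $ i) * snd q $ k" for k
      using euler[OF Z that, of k] by (simp add: a sum_distrib_left sum_distrib_right mult_ac)
    then have "snd q $ k * (2 * Z j q) = snd q $ j * (2 * Z k q)" by simp
    then show ?thesis by simp
  qed
  have "\<exists>k. k \<noteq> j"
  proof (rule ccontr)
    assume "\<nexists>k. k \<noteq> j"
    then have "UNIV = {j}" by auto
    then have "CARD('n) = 1" by (metis card.empty card_insert_disjoint finite.emptyI One_nat_def empty_iff)
    then show False using n by simp
  qed
  then obtain k where k: "k \<noteq> j" by blast
  obtain a where a: "\<And>i k. pdy i (Z k) p = a i * snd p $ k" using rad[OF p] by blast
  have "pdy k (\<lambda>q. snd q $ k * Z j q) p = pdy k (\<lambda>q. snd q $ j * Z k q) p"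
    by (rule pd_cong(2)[OF _ open_S p sym]) (intro smooth_intros sm)
  then show ?thesis unfolding pd_mult(2)[OF sm(2) sm(1) p] pd_snd_nth using k by (simp add: a)
qed

text \<open>This is the trace of the vertical derivative of \<open>y\<^sup>k D\<^sup>j = y\<^sup>j D\<^sup>k\<close>; that equation involves only
  \<open>D\<close>, so the factor \<open>\<sigma>\<close> is never differentiated.\<close>

lemma radial_divergence:
  assumes D: "\<And>k. smooth_hom 2 (D k)" and rad: "\<And>q. q \<in> S \<Longrightarrow> \<exists>\<sigma>. \<forall>k. D k q = \<sigma> * snd q $ k" and p: "p \<in> S"
  shows "(real CARD('n) + 1) * D j p = snd p $ j * (\<Sum>k\<in>UNIV. pdy k (D k) p)"
proof -
  note sm = smooth_homD[OF D] smooth_on_snd_nth[OF open_S]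
  have "pdy k (\<lambda>q. snd q $ k * D j q) p = pdy k (\<lambda>q. snd q $ j * D k q) p" for k
  proof (rule pd_cong(2)[OF _ open_S p])
    fix q assume "q \<in> S"
    then show "snd q $ k * D j q = snd q $ j * D k q" using rad by fastforce
  qed (intro smooth_intros sm)
  then have "snd p $ k * pdy k (D j) p + D j p = snd p $ j * pdy k (D k) p + (if j = k then 1 else 0) * D k p" for k
    unfolding pd_mult(2)[OF sm(2) sm(1) p] pd_snd_nth by simp
  then have "(\<Sum>k\<in>UNIV. snd p $ k * pdy k (D j) p + D j p) =
      (\<Sum>k\<in>UNIV. snd p $ j * pdy k (D k) p + (if j = k then 1 else 0) * D k p)" by simp
  then have "(\<Sum>k\<in>UNIV. pdy k (D j) p * snd p $ k) + real CARD('n) * D j p =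
      snd p $ j * (\<Sum>k\<in>UNIV. pdy k (D k) p) + D j p"
    by (simp only: sum.distrib sum_kronecker sum_distrib_left[symmetric] mult.commute[of "snd p $ _" "pdy _ (D j) p"])
       (simp add: mult.commute)
  then show ?thesis using euler[OF D p, of j] by (simp add: algebra_simps)
qed

text \<open>By \<open>radial_divergence\<close> a radial field \<open>D = \<sigma> y\<close> has divergence \<open>(n + 1) \<sigma>\<close>, so the equation reads
  \<open>2 (n + 2) \<sigma> = 2 (n + 1) \<sigma>\<close>.  The covectors \<open>u\<close> and \<open>w\<close> stand for \<open>y\<^sub>a / L\<close> and the mean
  Cartan tensor.\<close>

lemma radial_imp_zero:
  assumes D: "\<And>k. smooth_hom 2 (D k)" and rad: "\<And>q. q \<in> S \<Longrightarrow> \<exists>\<sigma>. \<forall>k. D k q = \<sigma> * snd q $ k" and p: "p \<in> S"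
    and u: "(\<Sum>a\<in>UNIV. u a * snd p $ a) = 1" and w: "(\<Sum>a\<in>UNIV. w a * snd p $ a) = 0"
    and eq: "2 * (real CARD('n) + 2) * (\<Sum>a\<in>UNIV. u a * D a p) - 4 * (\<Sum>a\<in>UNIV. w a * D a p) =
      2 * (\<Sum>a\<in>UNIV. pdy a (D a) p)"
  shows "D j p = 0"
proof -
  let ?d = "\<Sum>a\<in>UNIV. pdy a (D a) p"
  obtain \<sigma> where \<sigma>: "\<And>k. D k p = \<sigma> * snd p $ k" using rad[OF p] by blast
  have ud: "(\<Sum>a\<in>UNIV. u a * D a p) = \<sigma>"
  proof -
    have "(\<Sum>a\<in>UNIV. u a * D a p) = \<sigma> * (\<Sum>a\<in>UNIV. u a * snd p $ a)"
      unfolding sum_distrib_left by (intro sum.cong) (auto simp: \<sigma>)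
    then show ?thesis by (simp add: u)
  qed
  have wd: "(\<Sum>a\<in>UNIV. w a * D a p) = 0"
  proof -
    have "(\<Sum>a\<in>UNIV. w a * D a p) = \<sigma> * (\<Sum>a\<in>UNIV. w a * snd p $ a)"
      unfolding sum_distrib_left by (intro sum.cong) (auto simp: \<sigma>)
    then show ?thesis by (simp add: w)
  qed
  obtain k where k: "snd p $ k \<noteq> 0"
    using nonzero_S[of "fst p" "snd p"] p by (auto simp: vec_eq_iff)
  have "(real CARD('n) + 1) * \<sigma> * snd p $ k = ?d * snd p $ k"
    using radial_divergence[OF D rad p, of k] by (simp add: \<sigma> mult_ac)
  then have "(real CARD('n) + 1) * \<sigma> = ?d" using k by simp
  then have "\<sigma> = 0" using eq unfolding ud wd by (simp add: algebra_simps)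
  then show ?thesis by (simp add: \<sigma>)
qed

lemma smooth_hom_vertical:
  assumes "\<And>k. smooth_hom 2 (Z k)" "\<And>i k q. q \<in> S \<Longrightarrow> J i k q = pdy i (Z k) q"
  shows "smooth_hom 1 (J i k)"
  by (rule smooth_hom_cong[OF smooth_hom_pdy[OF assms(1)[of k], of 1 i]]) (auto simp: assms(2))

lemma contract_vertical:
  assumes "\<And>k. smooth_hom 2 (Z k)" "\<And>i k q. q \<in> S \<Longrightarrow> J i k q = pdy i (Z k) q" "q \<in> S"
  shows "contract J k q = 2 * Z k q"
  using euler[OF assms(1,3)] by (simp add: contract_def assms(2,3))

text \<open>Euler's theorem, applied to \<open>Z\<close> and to its divergence, reduces every term of the contracted bracket that
  contains \<open>J\<close> to \<open>Z\<close> and its divergence.\<close>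

lemma bracket_vertical_contracted:
  assumes Z: "\<And>k. smooth_hom 2 (Z k)" and J: "\<And>i k q. q \<in> S \<Longrightarrow> J i k q = pdy i (Z k) q" and p: "p \<in> S"
  shows "(\<Sum>b\<in>UNIV. bracket f J b p * snd p $ b) = 2 * (\<Sum>b\<in>UNIV. mean_Landsberg f b p * snd p $ b) +
    2 * (real CARD('n) + 2) * (\<Sum>a\<in>UNIV. ylow f a p / f p * Z a p) -
    4 * (\<Sum>a\<in>UNIV. mean_Cartan f a p * Z a p) - 2 * (\<Sum>a\<in>UNIV. pdy a (Z a) p)"
proof -
  note sm = smooth_homD[OF Z]
  have J1: "smooth_hom 1 (J i j)" for i j by (rule smooth_hom_vertical[of Z J, OF Z]) (rule J)
  have W: "contract J k q = 2 * Z k q" if "q \<in> S" for k q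
    by (rule contract_vertical[of Z J, OF Z _ that]) (rule J)
  have c: "(\<Sum>b\<in>UNIV. (\<Sum>a\<in>UNIV. w a * J b a p) * snd p $ b) = 2 * (\<Sum>a\<in>UNIV. w a * Z a p)" for w
  proof -
    have "(\<Sum>b\<in>UNIV. (\<Sum>a\<in>UNIV. w a * J b a p) * snd p $ b) = (\<Sum>a\<in>UNIV. w a * (\<Sum>b\<in>UNIV. J b a p * snd p $ b))"
      unfolding sum_distrib_right sum_distrib_left by (subst sum.swap) (simp add: mult_ac)
    also have "\<dots> = (\<Sum>a\<in>UNIV. w a * (2 * Z a p))"
      using W[OF p] by (simp add: contract_def)
    finally show ?thesis by (simp add: sum_distrib_left mult_ac)
  qed
  have d1: "pdy a (J b a) p = pdy b (pdy a (Z a)) p" for a b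
  proof -
    have "pdy a (J b a) p = pdy a (pdy b (Z a)) p"
      by (rule pd_cong(2)[OF smooth_homD[OF J1] open_S p]) (simp add: J)
    then show ?thesis using pd_commute(1)[OF sm open_S p] by metis
  qed
  have d2: "pdy b (J a a) p = pdy b (pdy a (Z a)) p" for a b
    by (rule pd_cong(2)[OF smooth_homD[OF J1] open_S p]) (simp add: J)
  have d: "(\<Sum>b\<in>UNIV. (\<Sum>a\<in>UNIV. pdy a (J b a) p + pdy b (J a a) p) * snd p $ b) = 2 * (\<Sum>a\<in>UNIV. pdy a (Z a) p)"
  proof -
    have "(\<Sum>b\<in>UNIV. (\<Sum>a\<in>UNIV. pdy a (J b a) p + pdy b (J a a) p) * snd p $ b)
      = (\<Sum>a\<in>UNIV. \<Sum>b\<in>UNIV. 2 * (pdy b (pdy a (Z a)) p * snd p $ b))"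
      unfolding sum_distrib_right d1 d2 by (subst sum.swap) (simp add: algebra_simps)
    also have "\<dots> = (\<Sum>a\<in>UNIV. 2 * (1 * pdy a (Z a) p))"
    proof (intro sum.cong refl)
      fix a
      have "smooth_hom 1 (pdy a (Z a))" by (rule smooth_hom_pdy[OF Z]) simp
      from euler[OF this p] show "(\<Sum>b\<in>UNIV. 2 * (pdy b (pdy a (Z a)) p * snd p $ b)) = 2 * (1 * pdy a (Z a) p)"
        by (simp add: sum_distrib_left[symmetric])
    qed
    finally show ?thesis by (simp add: sum_distrib_left)
  qed
  define X where "X b = (\<Sum>a\<in>UNIV. ylow f a p / f p * J b a p)" for b
  define Y where "Y b = (\<Sum>a\<in>UNIV. mean_Cartan f a p * J b a p)" for b
  define V where "V b = (\<Sum>a\<in>UNIV. pdy a (J b a) p + pdy b (J a a) p)" for b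
  have "(\<Sum>b\<in>UNIV. bracket f J b p * snd p $ b) = (\<Sum>b\<in>UNIV. 2 * (mean_Landsberg f b p * snd p $ b) +
      (real CARD('n) + 2) * (X b * snd p $ b) - 2 * (Y b * snd p $ b) - V b * snd p $ b)"
  proof (intro sum.cong refl)
    fix b
    have "bracket f J b p = 2 * mean_Landsberg f b p + (real CARD('n) + 2) * X b - 2 * Y b - V b"
      unfolding bracket_def X_def Y_def V_def by (rule refl)
    then show "bracket f J b p * snd p $ b = 2 * (mean_Landsberg f b p * snd p $ b) +
      (real CARD('n) + 2) * (X b * snd p $ b) - 2 * (Y b * snd p $ b) - V b * snd p $ b"
      by (simp only: distrib_right left_diff_distrib mult.assoc)
  qed
  also have "\<dots> = 2 * (\<Sum>b\<in>UNIV. mean_Landsberg f b p * snd p $ b) + (real CARD('n) + 2) * (\<Sum>b\<in>UNIV. X b * snd p $ b)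
      - 2 * (\<Sum>b\<in>UNIV. Y b * snd p $ b) - (\<Sum>b\<in>UNIV. V b * snd p $ b)"
    by (simp only: sum.distrib sum_subtractf sum_distrib_left[symmetric])
  finally show ?thesis unfolding X_def Y_def V_def c d by (simp add: distrib_right)
qed

text \<open>A solution that is a vertical derivative has vanishing left-hand side \<open>2 * J - dW\<close>, so the trace of
  the affine equation kills the contraction of the bracket.\<close>

lemma bracket_contracted_zero:
  assumes n: "CARD('n) \<ge> 2" and Z: "\<And>k. smooth_hom 2 (Z k)" and J: "\<And>i k q. q \<in> S \<Longrightarrow> J i k q = pdy i (Z k) q"
    and aff: "affine_equation f J p" and p: "p \<in> S"
  shows "(\<Sum>b\<in>UNIV. bracket f J b p * snd p $ b) = 0"
proof -
  have J1: "smooth_hom 1 (J i j)" for i j by (rule smooth_hom_vertical[of Z J, OF Z]) (rule J)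
  have z: "2 * J i j p - pdy i (contract J j) p = 0" for i j
  proof -
    have "pdy i (contract J j) p = pdy i (\<lambda>q. 2 * Z j q) p"
    proof (rule pd_cong(2)[OF smooth_homD[OF smooth_hom_contract[OF J1]] open_S p])
      fix q assume "q \<in> S"
      then show "contract J j q = 2 * Z j q" by (intro contract_vertical[of Z J, OF Z] J)
    qed
    also have "\<dots> = 2 * pdy i (Z j) p" by (rule pd_cmult(2)[OF smooth_homD[OF Z] p])
    finally show ?thesis using J[OF p] by simp
  qed
  have "radial_part J p = (\<Sum>b\<in>UNIV. bracket f J b p * snd p $ b)"
    using aff unfolding affine_equation_iff[OF J1 p] by (intro radial_part_eq[OF n _ refl]) blast
  then show ?thesis unfolding radial_part_def z by simp
qed

text \<open>If the vertical derivative of \<open>B \<otimes> y\<close> is symmetric, its trace gives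
  \<open>B\<^sub>k\<^sub>\<cdot>\<^sub>i y\<^sup>k = (n - 1) B\<^sub>i\<close>; contracting with \<open>y\<^sup>i\<close> shows that \<open>s = B\<^sub>k y\<^sup>k\<close> vanishes, and
  the derivative of \<open>s = 0\<close> turns the trace into \<open>n B\<^sub>i = 0\<close>.\<close>

lemma symmetric_radial_imp_zero:
  assumes n: "CARD('n) \<ge> 2" and B: "\<And>i. smooth_hom 0 (B i)" and p: "p \<in> S"
    and sym: "\<And>i j k q. q \<in> S \<Longrightarrow> pdy j (\<lambda>p. B i p * snd p $ k) q = pdy i (\<lambda>p. B j p * snd p $ k) q"
  shows "B i p = 0"
proof -
  note sm = smooth_homD[OF B] smooth_on_snd_nth[OF open_S]
  have eq: "B i q * (if k = j then 1 else 0) + pdy j (B i) q * snd q $ k =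
      B j q * (if k = i then 1 else 0) + pdy i (B j) q * snd q $ k" if "q \<in> S" for i j k q
    using sym[OF that, of j i k] unfolding pd_mult(2)[OF sm(1) sm(2) that] pd_snd_nth .
  have e0: "(\<Sum>k\<in>UNIV. pdy k (B i) q * snd q $ k) = 0" if "q \<in> S" for i q using euler[OF B that, of i] by simp
  have tr: "real CARD('n) * B i q = B i q + (\<Sum>k\<in>UNIV. pdy i (B k) q * snd q $ k)" if "q \<in> S" for i q
  proof -
    have "(\<Sum>k\<in>UNIV. B i q * (if k = k then 1 else 0) + pdy k (B i) q * snd q $ k) =
      (\<Sum>k\<in>UNIV. B k q * (if k = i then 1 else 0) + pdy i (B k) q * snd q $ k)"
      by (intro sum.cong refl) (rule eq[OF that])
    then show ?thesis unfolding sum.distrib sum_kronecker e0[OF that] by simp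
  qed
  have s0: "contract (\<lambda>a _. B a) j q = 0" if "q \<in> S" for q j
  proof -
    have "(\<Sum>i\<in>UNIV. (\<Sum>k\<in>UNIV. pdy i (B k) q * snd q $ k) * snd q $ i) =
        (\<Sum>k\<in>UNIV. (\<Sum>i\<in>UNIV. pdy i (B k) q * snd q $ i) * snd q $ k)"
      unfolding sum_distrib_right by (subst sum.swap) (simp add: mult_ac)
    then have z: "(\<Sum>i\<in>UNIV. (\<Sum>k\<in>UNIV. pdy i (B k) q * snd q $ k) * snd q $ i) = 0"
      by (simp add: e0[OF that])
    have "(\<Sum>i\<in>UNIV. real CARD('n) * (B i q * snd q $ i)) =
      (\<Sum>i\<in>UNIV. B i q * snd q $ i + (\<Sum>k\<in>UNIV. pdy i (B k) q * snd q $ k) * snd q $ i)"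
      by (intro sum.cong refl) (use tr[OF that] in \<open>simp only: mult.assoc[symmetric] distrib_right[symmetric]\<close>)
    then have "real CARD('n) * contract (\<lambda>a _. B a) j q = contract (\<lambda>a _. B a) j q"
      unfolding sum.distrib z sum_distrib_left[symmetric] contract_def by simp
    then show ?thesis using n by simp
  qed
  have sc: "smooth_on (contract (\<lambda>a _. B a) i) S"
    unfolding contract_def by (intro smooth_intros sm)
  have "pdy i (contract (\<lambda>a _. B a) i) p = pdy i (\<lambda>_. 0) p"
    by (rule pd_cong(2)[OF sc open_S p s0])
  then have "B i p + (\<Sum>a\<in>UNIV. pdy i (B a) p * snd p $ a) = 0"
    using pdy_contract[of "\<lambda>a _. B a" i p i] sm p by (simp add: pd_const)
  then have "real CARD('n) * B i p = 0" using tr[OF p, of i] by simp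
  then show ?thesis using n by simp
qed

text \<open>Adding \<open>B \<otimes> y\<close> to \<open>J\<close> changes the bracket by \<open>B\<^sub>i - B\<^sub>a\<^sub>\<cdot>\<^sub>i y\<^sup>a\<close>, and the torsion term
  by \<open>(B\<^sub>i - B\<^sub>a\<^sub>\<cdot>\<^sub>i y\<^sup>a) y\<^sup>j - B(y) \<delta>\<^sub>i\<^sup>j\<close>.  The two changes cancel in the affine equation.\<close>

lemma affine_equation_add_radial:
  assumes J: "\<And>i j. smooth_hom 1 (J i j)" and B: "\<And>i. smooth_hom 0 (B i)" and p: "p \<in> S"
    and u: "(\<Sum>a\<in>UNIV. ylow f a p / f p * snd p $ a) = 1" and w: "(\<Sum>a\<in>UNIV. mean_Cartan f a p * snd p $ a) = 0"
    and J': "\<And>i j q. q \<in> S \<Longrightarrow> J' i j q = J i j q + B i q * snd q $ j"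
    and aff: "affine_equation f J p"
  shows "affine_equation f J' p"
proof -
  note sm = smooth_homD[OF J] smooth_homD[OF B] smooth_on_snd_nth[OF open_S]
  have By: "smooth_hom 1 (\<lambda>q. B i q * snd q $ j)" for i j
    by (rule smooth_hom_mult[OF B smooth_hom_snd_nth]) simp
  have J1: "smooth_hom 1 (J' i j)" for i j
    by (rule smooth_hom_cong[OF smooth_hom_add[OF J[of i j] By[of i j]]]) (simp add: J')
  define E where "E i = (\<Sum>a\<in>UNIV. pdy i (B a) p * snd p $ a)" for i
  define s where "s = (\<Sum>a\<in>UNIV. B a p * snd p $ a)"
  have e0: "(\<Sum>k\<in>UNIV. pdy k (B i) p * snd p $ k) = 0" for i using euler[OF B p, of i] by simp
  have pd: "pdy c (J' i j) p = pdy c (J i j) p + (B i p * (if j = c then 1 else 0) + pdy c (B i) p * snd p $ j)" for c i j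
  proof -
    have "pdy c (\<lambda>q. J i j q + B i q * snd q $ j) p = pdy c (J' i j) p"
      by (rule pd_cong(2)[OF _ open_S p]) (intro smooth_intros sm, simp add: J')
    then show ?thesis
      unfolding pd_add(2)[OF sm(1) smooth_homD[OF By] p] pd_mult(2)[OF sm(2) sm(3) p] pd_snd_nth by simp
  qed
  have b: "bracket f J' i p = bracket f J i p + (B i p - E i)" for i
  proof -
    have 1: "(\<Sum>a\<in>UNIV. v a * J' i a p) = (\<Sum>a\<in>UNIV. v a * J i a p) + B i p * (\<Sum>a\<in>UNIV. v a * snd p $ a)" for v
      by (simp add: J'[OF p] sum.distrib[symmetric] sum_distrib_left algebra_simps)
    have 2: "(\<Sum>a\<in>UNIV. pdy a (J' i a) p + pdy i (J' a a) p) =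
       (\<Sum>a\<in>UNIV. pdy a (J i a) p + pdy i (J a a) p) + (real CARD('n) * B i p + (E i + B i p))"
    proof -
      have "(\<Sum>a\<in>UNIV. pdy a (J' i a) p + pdy i (J' a a) p) =
        (\<Sum>a\<in>UNIV. (pdy a (J i a) p + pdy i (J a a) p) + (B i p + pdy a (B i) p * snd p $ a +
            (B a p * (if a = i then 1 else 0) + pdy i (B a) p * snd p $ a)))"
        by (intro sum.cong refl) (simp add: pd)
      then show ?thesis by (simp only: sum.distrib sum_kronecker e0 E_def[symmetric]) simp
    qed
    show ?thesis unfolding bracket_def 1 2 u w by (simp add: algebra_simps)
  qed
  have E0: "(\<Sum>i\<in>UNIV. E i * snd p $ i) = 0"
  proof -
    have "(\<Sum>i\<in>UNIV. E i * snd p $ i) = (\<Sum>k\<in>UNIV. (\<Sum>i\<in>UNIV. pdy i (B k) p * snd p $ i) * snd p $ k)"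
      unfolding E_def sum_distrib_right by (subst sum.swap) (simp add: mult_ac)
    then show ?thesis by (simp add: e0)
  qed
  have \<beta>: "(\<Sum>b\<in>UNIV. bracket f J' b p * snd p $ b) = (\<Sum>b\<in>UNIV. bracket f J b p * snd p $ b) + s"
  proof -
    have "(\<Sum>b\<in>UNIV. bracket f J' b p * snd p $ b) =
        (\<Sum>b\<in>UNIV. bracket f J b p * snd p $ b + (B b p * snd p $ b - E b * snd p $ b))"
      by (intro sum.cong refl) (simp add: b algebra_simps)
    then show ?thesis by (simp add: sum.distrib sum_subtractf E0 s_def)
  qed
  have c: "pdy i (contract J' j) p = pdy i (contract J j) p + (E i + B i p) * snd p $ j + s * (if i = j then 1 else 0)" for i j
  proof -
    have "pdy i (contract J' j) p = J' i j p + (\<Sum>a\<in>UNIV. pdy i (J' a j) p * snd p $ a)"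
      by (rule pdy_contract[OF smooth_homD[OF J1] p])
    also have "(\<Sum>a\<in>UNIV. pdy i (J' a j) p * snd p $ a) = (\<Sum>a\<in>UNIV. pdy i (J a j) p * snd p $ a
        + (B a p * snd p $ a * (if i = j then 1 else 0) + pdy i (B a) p * snd p $ a * snd p $ j))"
      by (intro sum.cong refl) (auto simp: pd algebra_simps)
    also have "\<dots> = (\<Sum>a\<in>UNIV. pdy i (J a j) p * snd p $ a) + (s * (if i = j then 1 else 0) + E i * snd p $ j)"
      by (simp only: sum.distrib sum_distrib_right[symmetric] s_def E_def)
    finally show ?thesis using pdy_contract[of J j p i, OF sm(1) p] by (simp add: J'[OF p] algebra_simps)
  qed
  show ?thesis
    unfolding affine_equation_iff[OF J1 p] \<beta> unfolding b c
    using aff[unfolded affine_equation_iff[OF J p]] by (simp add: J'[OF p] algebra_simps)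
qed

text \<open>Adding \<open>B \<otimes> y\<close> to a connection adds \<open>(\<delta>\<^sub>j B\<^sub>i - \<delta>\<^sub>i B\<^sub>j) y\<^sup>k\<close> to its curvature, and
  the Ricci scalar contracts both lower indices of this antisymmetric expression with \<open>y\<close>.\<close>

lemma Ricci_scalar_add_radial:
  assumes N: "\<And>i k. smooth_hom 1 (N i k)" and B: "\<And>i. smooth_hom 0 (B i)" and p: "p \<in> S"
    and N': "\<And>i k q. q \<in> S \<Longrightarrow> N' i k q = N i k q + B i q * snd q $ k"
  shows "Ricci_scalar N' p = Ricci_scalar N p"
proof -
  note sm = smooth_homD[OF N] smooth_homD[OF B] smooth_on_snd_nth[OF open_S]
  have By: "smooth_hom 1 (\<lambda>q. B i q * snd q $ j)" for i j
    by (rule smooth_hom_mult[OF B smooth_hom_snd_nth]) simp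
  have N1: "smooth_hom 1 (N' i j)" for i j
    by (rule smooth_hom_cong[OF smooth_hom_add[OF N[of i j] By[of i j]]]) (simp add: N')
  have h': "hderiv N' j g p = hderiv N j g p - B j p * g p" if g: "smooth_hom 1 g" for g j
  proof -
    have "(\<Sum>a\<in>UNIV. N' j a p * pdy a g p) = (\<Sum>a\<in>UNIV. N j a p * pdy a g p) + B j p * (\<Sum>a\<in>UNIV. pdy a g p * snd p $ a)"
      by (simp add: N'[OF p] sum.distrib[symmetric] sum_distrib_left algebra_simps)
    then show ?thesis using euler[OF g p] by (simp add: hderiv_def)
  qed
  have h: "hderiv N j (N' i k) p = hderiv N j (N i k) p + hderiv N j (B i) p * snd p $ k - B i p * N j k p" for i j k
  proof -
    have x: "pdx j (N' i k) p = pdx j (N i k) p + pdx j (B i) p * snd p $ k"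
    proof -
      have "pdx j (\<lambda>q. N i k q + B i q * snd q $ k) p = pdx j (N' i k) p"
        by (rule pd_cong(1)[OF _ open_S p]) (intro smooth_intros sm, simp add: N')
      then show ?thesis
        unfolding pd_add(1)[OF sm(1) smooth_homD[OF By] p] pd_mult(1)[OF sm(2) sm(3) p] pd_snd_nth by simp
    qed
    have y: "pdy c (N' i k) p = pdy c (N i k) p + (B i p * (if k = c then 1 else 0) + pdy c (B i) p * snd p $ k)" for c
    proof -
      have "pdy c (\<lambda>q. N i k q + B i q * snd q $ k) p = pdy c (N' i k) p"
        by (rule pd_cong(2)[OF _ open_S p]) (intro smooth_intros sm, simp add: N')
      then show ?thesis
        unfolding pd_add(2)[OF sm(1) smooth_homD[OF By] p] pd_mult(2)[OF sm(2) sm(3) p] pd_snd_nth by simp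
    qed
    have "(\<Sum>a\<in>UNIV. N j a p * pdy a (N' i k) p) = (\<Sum>a\<in>UNIV. N j a p * pdy a (N i k) p +
        (B i p * (N j a p * (if k = a then 1 else 0)) + N j a p * pdy a (B i) p * snd p $ k))"
      by (intro sum.cong refl) (simp only: y algebra_simps)
    also have "\<dots> = (\<Sum>a\<in>UNIV. N j a p * pdy a (N i k) p) +
        (B i p * N j k p + (\<Sum>a\<in>UNIV. N j a p * pdy a (B i) p) * snd p $ k)"
      by (simp only: sum.distrib sum_distrib_left[symmetric] sum_distrib_right[symmetric] sum_kronecker)
    finally show ?thesis unfolding hderiv_def x by (simp add: algebra_simps)
  qed
  let ?F = "\<lambda>i j. hderiv N j (B i) p - hderiv N i (B j) p"
  have c: "curv N' i j k p = curv N i j k p + ?F i j * snd p $ k" for i j k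
    unfolding curv_def h'[OF N1] h by (simp add: N'[OF p] algebra_simps)
  have "(\<Sum>b\<in>UNIV. \<Sum>a\<in>UNIV. snd p $ b * snd p $ a * ?F b a) = 0"
  proof -
    have "(\<Sum>b\<in>UNIV. \<Sum>a\<in>UNIV. snd p $ b * snd p $ a * hderiv N a (B b) p) =
      (\<Sum>b\<in>UNIV. \<Sum>a\<in>UNIV. snd p $ b * snd p $ a * hderiv N b (B a) p)"
      by (subst sum.swap) (simp add: mult_ac)
    then show ?thesis by (simp add: right_diff_distrib sum_subtractf)
  qed
  then have "(\<Sum>b\<in>UNIV. \<Sum>a\<in>UNIV. snd p $ b * curv N b a a p + snd p $ b * snd p $ a * ?F b a) = Ricci_scalar N p"
    by (simp only: sum.distrib Ricci_scalar_def)
  then show ?thesis unfolding Ricci_scalar_def[of N'] c by (simp add: algebra_simps)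
qed

end

section \<open>The metric connection in a chart\<close>

locale finsler_region = conic_region S for S :: "'n::finite pt set" +
  fixes f :: "'n pt \<Rightarrow> real"
  assumes f2: "smooth_hom 2 f" and nondegenerate: "\<And>p. p \<in> S \<Longrightarrow> invertible (metric_matrix f p)"
begin

lemma smooth_hom_metric: "smooth_hom 0 (metric f i j)"
proof -
  have "smooth_hom 0 (\<lambda>p. (1/2) * pdy j (pdy i f) p)"
    by (intro smooth_hom_cmult smooth_hom_pdy[OF smooth_hom_pdy[OF f2 refl]]) simp
  then show ?thesis by (rule smooth_hom_cong) (simp add: metric_def)
qed

lemma metric_sym: "p \<in> S \<Longrightarrow> metric f i j p = metric f j i p"
  unfolding metric_def using pd_commute(1)[OF smooth_homD[OF f2] open_S] by simp

lemma pdy_metric: "p \<in> S \<Longrightarrow> pdy k (metric f i j) p = (1/2) * pdy k (pdy j (pdy i f)) p"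
  unfolding metric_def divide_inverse mult.commute[of _ "inverse _"]
  by (subst pd_cmult(2)[OF smooth_on_pdy[OF smooth_on_pdy[OF smooth_homD[OF f2]]]]) auto

lemma pdx_metric: "p \<in> S \<Longrightarrow> pdx k (metric f i j) p = (1/2) * pdx k (pdy j (pdy i f)) p"
  unfolding metric_def divide_inverse mult.commute[of _ "inverse _"]
  by (subst pd_cmult(1)[OF smooth_on_pdy[OF smooth_on_pdy[OF smooth_homD[OF f2]]]]) auto

lemma pdy_metric_sym:
  assumes "p \<in> S" shows "pdy k (metric f i j) p = pdy j (metric f i k) p"
  unfolding pdy_metric[OF assms] by (simp add: pd_commute(1)[OF smooth_on_pdy[OF smooth_homD[OF f2]] open_S assms, of k j])

lemma metric_cong_sym: "p \<in> S \<Longrightarrow> pdy k (metric f i j) p = pdy k (metric f j i) p"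
  by (rule pd_cong(2)[OF smooth_homD[OF smooth_hom_metric] open_S]) (auto simp: metric_sym)

lemma metric_contract:
  assumes "p \<in> S" shows "(\<Sum>b\<in>UNIV. metric f a b p * snd p $ b) = (1/2) * pdy a f p"
proof -
  have "smooth_hom 1 (pdy a f)" by (rule smooth_hom_pdy[OF f2]) simp
  from euler[OF this assms] show ?thesis by (simp add: metric_def sum_divide_distrib[symmetric])
qed

lemma ylow_eq: "p \<in> S \<Longrightarrow> ylow f a p = (1/2) * pdy a f p"
  unfolding ylow_def by (rule metric_contract)

lemma ylow_contract: "p \<in> S \<Longrightarrow> (\<Sum>a\<in>UNIV. ylow f a p * snd p $ a) = f p"
  using euler[OF f2] by (simp add: ylow_eq sum_divide_distrib[symmetric])

lemma ylow_unit:
  assumes "p \<in> S" "f p \<noteq> 0" shows "(\<Sum>a\<in>UNIV. ylow f a p / f p * snd p $ a) = 1"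
  using ylow_contract[OF assms(1)] assms(2) by (simp add: sum_divide_distrib[symmetric])

lemma mean_Cartan_contract:
  assumes "p \<in> S" shows "(\<Sum>i\<in>UNIV. mean_Cartan f i p * snd p $ i) = 0"
proof -
  have "(\<Sum>i\<in>UNIV. mean_Cartan f i p * snd p $ i) =
     (\<Sum>i\<in>UNIV. \<Sum>a\<in>UNIV. \<Sum>b\<in>UNIV. (1/2) * metric_up f a b p * (pdy i (metric f a b) p * snd p $ i))"
    unfolding mean_Cartan_def Cartan_def sum_distrib_right by (intro sum.cong refl) simp
  also have "\<dots> = (\<Sum>a\<in>UNIV. \<Sum>i\<in>UNIV. \<Sum>b\<in>UNIV. (1/2) * metric_up f a b p * (pdy i (metric f a b) p * snd p $ i))"
    by (rule sum.swap)
  also have "\<dots> = (\<Sum>a\<in>UNIV. \<Sum>b\<in>UNIV. \<Sum>i\<in>UNIV. (1/2) * metric_up f a b p * (pdy i (metric f a b) p * snd p $ i))"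
    by (intro sum.cong refl sum.swap)
  also have "\<dots> = 0"
    using euler[OF smooth_hom_metric assms] by (simp only: sum_distrib_left[symmetric]) simp
  finally show ?thesis .
qed

lemma smooth_hom_metric_up: "smooth_hom 0 (metric_up f i j)"
  unfolding smooth_hom_def
proof
  show "smooth_on (metric_up f i j) S" unfolding metric_up_def
    by (rule smooth_on_matrix_inv[OF _ open_S nondegenerate])
       (use smooth_homD[OF smooth_hom_metric] in \<open>simp_all add: metric_matrix_def\<close>)
  have "metric_matrix f (x, l *\<^sub>R y) = metric_matrix f (x, y)" if "(x, y) \<in> S" "l > 0" for x y l
    using smooth_hom_metric that unfolding smooth_hom_def pos_homogeneous_iff metric_matrix_def
    by (simp add: vec_eq_iff)
  then show "pos_homogeneous 0 (metric_up f i j) S"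
    unfolding pos_homogeneous_iff metric_up_def by simp
qed

lemma metric_metric_up:
  assumes "p \<in> S" shows "(\<Sum>i\<in>UNIV. metric f j i p * metric_up f i a p) = (if j = a then 1 else 0)"
proof -
  have "(metric_matrix f p ** matrix_inv (metric_matrix f p)) $ j $ a = (mat 1 :: real^'n^'n) $ j $ a"
    using matrix_inv_mult(1)[OF nondegenerate[OF assms]] by simp
  then show ?thesis by (simp add: matrix_matrix_mult_def metric_matrix_def metric_up_def mat_def)
qed

lemma smooth_hom_spray: "smooth_hom 2 (spray f i)"
proof -
  have "smooth_hom 2 (\<lambda>p. (1/4) * (\<Sum>a\<in>UNIV. \<Sum>b\<in>UNIV. \<Sum>c\<in>UNIV.
     metric_up f i a p * (2 * pdx c (metric f a b) p - pdx a (metric f b c) p) *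
     snd p $ b * snd p $ c))"
    by (intro smooth_hom_cmult smooth_hom_sum smooth_hom_mult[OF _ smooth_hom_snd_nth, of 1]
      smooth_hom_mult[OF _ smooth_hom_snd_nth, of 0] smooth_hom_mult[OF smooth_hom_metric_up, of 0]
      smooth_hom_diff smooth_hom_pdx smooth_hom_metric) auto
  then show ?thesis by (rule smooth_hom_cong) (simp add: spray_def)
qed

lemma smooth_hom_NL_loc: "smooth_hom 1 (NL_loc f i k)"
  unfolding NL_loc_def by (rule smooth_hom_pdy[OF smooth_hom_spray]) simp

lemma NL_loc_sym: "p \<in> S \<Longrightarrow> pdy j (NL_loc f i k) p = pdy i (NL_loc f j k) p"
  unfolding NL_loc_def by (rule pd_commute(1)[OF smooth_homD[OF smooth_hom_spray] open_S])

lemma NL_loc_contract: "p \<in> S \<Longrightarrow> (\<Sum>i\<in>UNIV. NL_loc f i k p * snd p $ i) = 2 * spray f k p"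
  unfolding NL_loc_def by (rule euler[OF smooth_hom_spray])

lemma pdy_NL_loc_contract:
  assumes "p \<in> S" shows "(\<Sum>i\<in>UNIV. pdy j (NL_loc f i k) p * snd p $ i) = NL_loc f j k p"
  using euler[OF smooth_hom_NL_loc assms] by (simp add: NL_loc_sym[OF assms, of j])

text \<open>Contracting with \<open>y\<close> turns the derivatives of the metric in the definition of the spray into derivatives of
  \<open>f\<close>; this form is the Euler-Lagrange expression of \<open>f\<close>.\<close>

lemma spray_lowered:
  assumes "p \<in> S"
  shows "4 * (\<Sum>i\<in>UNIV. metric f j i p * spray f i p) = (\<Sum>c\<in>UNIV. pdx c (pdy j f) p * snd p $ c) - pdx j f p"
proof -
  note sm = smooth_homD[OF f2] smooth_homD[OF smooth_hom_metric] smooth_on_snd_nth[OF open_S]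
  have A: "(\<Sum>b\<in>UNIV. pdx c (metric f a b) p * snd p $ b) = (1/2) * pdx c (pdy a f) p" for a c
  proof -
    have "pdx c (\<lambda>p. \<Sum>b\<in>UNIV. metric f a b p * snd p $ b) p = pdx c (\<lambda>p. (1/2) * pdy a f p) p"
      by (rule pd_cong(1)[OF _ open_S assms metric_contract]) (intro smooth_intros sm)
    also have "\<dots> = (1/2) * pdx c (pdy a f) p" by (rule pd_cmult(1)[OF smooth_on_pdy[OF sm(1)] assms])
    also have "pdx c (\<lambda>p. \<Sum>b\<in>UNIV. metric f a b p * snd p $ b) p = (\<Sum>b\<in>UNIV. pdx c (\<lambda>p. metric f a b p * snd p $ b) p)"
      by (rule pd_sum(1)[OF _ assms]) (intro smooth_intros sm)
    finally show ?thesis by (simp add: pd_mult(1)[OF sm(2) sm(3) assms] pd_snd_nth)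
  qed
  have F: "(\<Sum>b\<in>UNIV. pdx a (pdy b f) p * snd p $ b) = 2 * pdx a f p" for a
    using euler[OF smooth_hom_pdx[OF f2] assms, of a] by (simp add: pd_commute(2)[OF sm(1) open_S assms])
  define T where "T a = (\<Sum>b\<in>UNIV. \<Sum>c\<in>UNIV. (2 * pdx c (metric f a b) p - pdx a (metric f b c) p) * snd p $ b * snd p $ c)" for a
  have T: "T a = (\<Sum>c\<in>UNIV. pdx c (pdy a f) p * snd p $ c) - pdx a f p" for a
  proof -
    have "T a = (\<Sum>b\<in>UNIV. \<Sum>c\<in>UNIV. 2 * (pdx c (metric f a b) p * snd p $ b * snd p $ c)) -
       (\<Sum>b\<in>UNIV. \<Sum>c\<in>UNIV. (pdx a (metric f b c) p * snd p $ c) * snd p $ b)"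
      unfolding T_def sum_subtractf[symmetric] by (intro sum.cong refl) (simp add: algebra_simps)
    also have "(\<Sum>b\<in>UNIV. \<Sum>c\<in>UNIV. 2 * (pdx c (metric f a b) p * snd p $ b * snd p $ c)) =
       (\<Sum>c\<in>UNIV. \<Sum>b\<in>UNIV. 2 * (pdx c (metric f a b) p * snd p $ b * snd p $ c))" by (rule sum.swap)
    also have "\<dots> = (\<Sum>c\<in>UNIV. 2 * ((\<Sum>b\<in>UNIV. pdx c (metric f a b) p * snd p $ b) * snd p $ c))"
      by (simp only: sum_distrib_left sum_distrib_right)
    also have "\<dots> = (\<Sum>c\<in>UNIV. pdx c (pdy a f) p * snd p $ c)" by (simp add: A)
    also have "(\<Sum>b\<in>UNIV. \<Sum>c\<in>UNIV. (pdx a (metric f b c) p * snd p $ c) * snd p $ b) = pdx a f p"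
      using F[of a] by (simp add: sum_distrib_right[symmetric] A sum_divide_distrib[symmetric])
    finally show ?thesis .
  qed
  have sp: "4 * spray f i p = (\<Sum>a\<in>UNIV. metric_up f i a p * T a)" for i
    unfolding spray_def T_def by (simp add: sum_distrib_left mult_ac)
  have "4 * (\<Sum>i\<in>UNIV. metric f j i p * spray f i p) = (\<Sum>i\<in>UNIV. metric f j i p * (4 * spray f i p))"
    by (simp add: sum_distrib_left mult_ac)
  also have "\<dots> = (\<Sum>i\<in>UNIV. \<Sum>a\<in>UNIV. metric f j i p * metric_up f i a p * T a)"
    unfolding sp by (simp add: sum_distrib_left mult_ac)
  also have "\<dots> = (\<Sum>a\<in>UNIV. (\<Sum>i\<in>UNIV. metric f j i p * metric_up f i a p) * T a)"
    by (subst sum.swap) (simp add: sum_distrib_right)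
  also have "\<dots> = T j" by (simp only: metric_metric_up[OF assms] sum_kronecker)
  finally show ?thesis by (simp only: T)
qed

text \<open>This is the symmetric part of the vertical derivative of \<open>spray_lowered\<close>; the terms
  \<open>pdx k (pdy j f)\<close> and \<open>pdx j (pdy k f)\<close> cancel in it.  It expresses that the metric is parallel along the spray.\<close>

lemma metric_transport:
  assumes "p \<in> S"
  shows "(\<Sum>c\<in>UNIV. pdx c (metric f j k) p * snd p $ c) = 2 * (\<Sum>i\<in>UNIV. spray f i p * pdy i (metric f j k) p)
    + (\<Sum>i\<in>UNIV. NL_loc f k i p * metric f j i p) + (\<Sum>i\<in>UNIV. NL_loc f j i p * metric f i k p)"
proof -
  note sm = smooth_homD[OF f2] smooth_homD[OF smooth_hom_metric] smooth_homD[OF smooth_hom_spray] smooth_on_snd_nth[OF open_S]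
  have d: "4 * ((\<Sum>i\<in>UNIV. NL_loc f k i p * metric f j i p) + (\<Sum>i\<in>UNIV. spray f i p * pdy i (metric f j k) p)) =
      2 * (\<Sum>c\<in>UNIV. pdx c (metric f j k) p * snd p $ c) + (pdx k (pdy j f) p - pdx j (pdy k f) p)" for j k
  proof -
    have "pdy k (\<lambda>p. 4 * (\<Sum>i\<in>UNIV. metric f j i p * spray f i p)) p =
        pdy k (\<lambda>p. (\<Sum>c\<in>UNIV. pdx c (pdy j f) p * snd p $ c) - pdx j f p) p"
      by (rule pd_cong(2)[OF _ open_S assms spray_lowered]) (intro smooth_intros sm)
    also have "\<dots> = pdy k (\<lambda>p. \<Sum>c\<in>UNIV. pdx c (pdy j f) p * snd p $ c) p - pdy k (pdx j f) p"
      by (rule pd_diff(2)[OF _ _ assms]) (intro smooth_intros sm)+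
    also have "pdy k (\<lambda>p. \<Sum>c\<in>UNIV. pdx c (pdy j f) p * snd p $ c) p =
        (\<Sum>c\<in>UNIV. pdy k (\<lambda>p. pdx c (pdy j f) p * snd p $ c) p)"
      by (rule pd_sum(2)[OF _ assms]) (intro smooth_intros sm)
    also have "\<dots> = (\<Sum>c\<in>UNIV. pdx c (pdy j f) p * (if c = k then 1 else 0) + 2 * (pdx c (metric f j k) p * snd p $ c))"
      by (intro sum.cong refl) (simp add: pd_mult(2)[OF smooth_on_pdx[OF smooth_on_pdy[OF sm(1)]] sm(4) assms]
          pd_snd_nth pdx_metric[OF assms] pd_commute(2)[OF smooth_on_pdy[OF sm(1)] open_S assms])
    also have "\<dots> = pdx k (pdy j f) p + 2 * (\<Sum>c\<in>UNIV. pdx c (metric f j k) p * snd p $ c)"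
      by (simp only: sum.distrib sum_kronecker sum_distrib_left)
    also have "pdy k (pdx j f) p = pdx j (pdy k f) p" by (rule pd_commute(2)[OF sm(1) open_S assms])
    also have "pdy k (\<lambda>p. 4 * (\<Sum>i\<in>UNIV. metric f j i p * spray f i p)) p =
        4 * pdy k (\<lambda>p. \<Sum>i\<in>UNIV. metric f j i p * spray f i p) p"
      by (rule pd_cmult(2)[OF _ assms]) (intro smooth_intros sm)
    also have "pdy k (\<lambda>p. \<Sum>i\<in>UNIV. metric f j i p * spray f i p) p = (\<Sum>i\<in>UNIV. pdy k (\<lambda>p. metric f j i p * spray f i p) p)"
      by (rule pd_sum(2)[OF _ assms]) (intro smooth_intros sm)
    also have "\<dots> = (\<Sum>i\<in>UNIV. NL_loc f k i p * metric f j i p + spray f i p * pdy i (metric f j k) p)"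
      by (intro sum.cong refl, subst pd_mult(2)[OF sm(2) sm(3) assms])
        (simp add: NL_loc_def pdy_metric_sym[OF assms, of k] mult.commute)
    finally show ?thesis by (simp add: sum.distrib)
  qed
  have "pdx c (metric f k j) p = pdx c (metric f j k) p" for c
    by (rule pd_cong(1)[OF sm(2) open_S assms]) (rule metric_sym)
  moreover have "(\<Sum>i\<in>UNIV. NL_loc f j i p * metric f k i p) = (\<Sum>i\<in>UNIV. NL_loc f j i p * metric f i k p)"
    by (simp add: metric_sym[OF assms, of k])
  ultimately show ?thesis using d[of k j] d[of j k] by (simp add: metric_cong_sym[OF assms, of _ k j])
qed

lemma nabla_metric_contract:
  assumes "p \<in> S" shows "(\<Sum>k\<in>UNIV. nabla_metric f k i j p * snd p $ k) = 0"
proof -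
  have 1: "(\<Sum>k\<in>UNIV. (\<Sum>a\<in>UNIV. X k a * Y a) * snd p $ k) = (\<Sum>a\<in>UNIV. (\<Sum>k\<in>UNIV. X k a * snd p $ k) * Y a)" for X :: "'n \<Rightarrow> 'n \<Rightarrow> real" and Y
    unfolding sum_distrib_right by (subst sum.swap) (simp add: mult_ac)
  have 2: "(\<Sum>k\<in>UNIV. (\<Sum>a\<in>UNIV. Y a * X k a) * snd p $ k) = (\<Sum>a\<in>UNIV. (\<Sum>k\<in>UNIV. X k a * snd p $ k) * Y a)" for X :: "'n \<Rightarrow> 'n \<Rightarrow> real" and Y
    using 1[of X Y] by (simp add: mult.commute)
  have "(\<Sum>k\<in>UNIV. nabla_metric f k i j p * snd p $ k) =
      (\<Sum>k\<in>UNIV. pdx k (metric f i j) p * snd p $ k) - (\<Sum>k\<in>UNIV. (\<Sum>a\<in>UNIV. NL_loc f k a p * pdy a (metric f i j) p) * snd p $ k)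
      - (\<Sum>k\<in>UNIV. (\<Sum>a\<in>UNIV. pdy i (NL_loc f k a) p * metric f a j p) * snd p $ k)
      - (\<Sum>k\<in>UNIV. (\<Sum>a\<in>UNIV. pdy j (NL_loc f k a) p * metric f i a p) * snd p $ k)"
    by (simp only: nabla_metric_def hderiv_def left_diff_distrib sum_subtractf)
  also have "\<dots> = (\<Sum>k\<in>UNIV. pdx k (metric f i j) p * snd p $ k) - (\<Sum>a\<in>UNIV. 2 * spray f a p * pdy a (metric f i j) p)
      - (\<Sum>a\<in>UNIV. NL_loc f i a p * metric f a j p) - (\<Sum>a\<in>UNIV. NL_loc f j a p * metric f i a p)"
    unfolding 1 NL_loc_contract[OF assms] pdy_NL_loc_contract[OF assms] ..
  also have "\<dots> = 0" using metric_transport[OF assms, of i j] by (simp add: sum_distrib_left mult.assoc)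
  finally show ?thesis .
qed

lemma mean_Landsberg_contract:
  assumes "p \<in> S" shows "(\<Sum>i\<in>UNIV. mean_Landsberg f i p * snd p $ i) = 0"
proof -
  have "(\<Sum>i\<in>UNIV. mean_Landsberg f i p * snd p $ i) =
     (\<Sum>i\<in>UNIV. \<Sum>a\<in>UNIV. \<Sum>b\<in>UNIV. (1/2) * metric_up f a b p * (nabla_metric f i a b p * snd p $ i))"
    unfolding mean_Landsberg_def Landsberg_def sum_distrib_right by (intro sum.cong refl) simp
  also have "\<dots> = (\<Sum>a\<in>UNIV. \<Sum>i\<in>UNIV. \<Sum>b\<in>UNIV. (1/2) * metric_up f a b p * (nabla_metric f i a b p * snd p $ i))"
    by (rule sum.swap)
  also have "\<dots> = (\<Sum>a\<in>UNIV. \<Sum>b\<in>UNIV. \<Sum>i\<in>UNIV. (1/2) * metric_up f a b p * (nabla_metric f i a b p * snd p $ i))"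
    by (intro sum.cong refl sum.swap)
  also have "\<dots> = 0"
    using nabla_metric_contract[OF assms] by (simp only: sum_distrib_left[symmetric]) simp
  finally show ?thesis .
qed

end

section \<open>Anisotropic tensors on the manifold\<close>

locale conic_manifold =
  fixes C :: "('m::{second_countable_topology, t2_space}, 'n::finite) chart set" and A :: "('m, 'n) tvec set"
  assumes structure_C: "smooth_structure C" and domain_A: "conic_domain C A"
begin

lemma chartD:
  assumes "c \<in> C"
  shows "open (cdom c)" "open (cmap c ` cdom c)" "homeomorphism (cdom c) (cmap c ` cdom c) (cmap c) (cinv c)"
  using structure_C assms unfolding smooth_structure_def is_chart_def by blast+

lemma cinv_cmap: "c \<in> C \<Longrightarrow> m \<in> cdom c \<Longrightarrow> cinv c (cmap c m) = m"
  using chartD(3) homeomorphism_apply1 by blast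

lemma cmap_inj: "c \<in> C \<Longrightarrow> m \<in> cdom c \<Longrightarrow> m' \<in> cdom c \<Longrightarrow> cmap c m = cmap c m' \<Longrightarrow> m = m'"
  by (metis cinv_cmap)

lemma charts_cover: obtains c where "c \<in> C" "m \<in> cdom c"
  using structure_C unfolding smooth_structure_def by blast

definition overlap where "overlap c c' = cmap c ` (cdom c \<inter> cdom c')"

lemma open_overlap:
  assumes "c \<in> C" "c' \<in> C" shows "open (overlap c c')"
proof -
  have "openin (top_of_set (cdom c)) (cdom c \<inter> cdom c')"
    using chartD(1)[OF assms(2)] by (simp add: openin_open_Int)
  then have "openin (top_of_set (cmap c ` cdom c)) (cmap c ` (cdom c \<inter> cdom c'))"
    using homeomorphism_imp_open_map[OF chartD(3)[OF assms(1)]] by blast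
  then show ?thesis using chartD(2)[OF assms(1)] openin_open_trans unfolding overlap_def by blast
qed

lemma smooth_transition: "c \<in> C \<Longrightarrow> c' \<in> C \<Longrightarrow> smooth_on (transition c c') (overlap c c')"
  using structure_C unfolding smooth_structure_def compatible_def overlap_def by blast

lemma transition_cmap: "c \<in> C \<Longrightarrow> m \<in> cdom c \<Longrightarrow> transition c c' (cmap c m) = cmap c' m"
  by (simp add: transition_def cinv_cmap)

lemma frechet_transition:
  assumes "c \<in> C" "c' \<in> C" "x \<in> overlap c c'"
  shows "frechet_derivative (transition c c') (at x) w $ k = (\<Sum>a\<in>UNIV. jac c c' x k a * w $ a)"
proof -
  let ?D = "frechet_derivative (transition c c') (at x)"
  have l: "linear ?D"
    by (rule has_derivative_linear[OF smooth_on_has_derivative[OF smooth_transition[OF assms(1,2)] assms(3)]])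
  have w: "w = (\<Sum>a\<in>UNIV. w $ a *\<^sub>R axis a 1)"
    by (simp only: basis_expansion scalar_mult_eq_scaleR[symmetric])
  have "?D w = (\<Sum>a\<in>UNIV. w $ a *\<^sub>R ?D (axis a 1))"
    by (subst w) (simp only: linear_sum[OF l] linear_scale[OF l])
  then show ?thesis by (simp add: jac_def mult.commute)
qed

lemma smooth_jac:
  assumes "c \<in> C" "c' \<in> C" shows "smooth_on (\<lambda>x. jac c c' x k a) (overlap c c')"
  unfolding jac_def
  by (intro smooth_on_vec_nth smooth_on_frechet smooth_transition open_overlap assms)

lemma jac_inverse:
  assumes "c \<in> C" "c' \<in> C" "m \<in> cdom c" "m \<in> cdom c'"
  shows "(\<Sum>a\<in>UNIV. jac c c' (cmap c m) k a * jac c' c (cmap c' m) a i) = (if k = i then 1 else 0)"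
proof -
  let ?D = "frechet_derivative (transition c c') (at (cmap c m))"
    and ?E = "frechet_derivative (transition c' c) (at (cmap c' m))"
  have m: "cmap c m \<in> overlap c c'" "cmap c' m \<in> overlap c' c" using assms unfolding overlap_def by blast+
  have "(transition c c' \<circ> transition c' c has_derivative ?D \<circ> ?E) (at (cmap c' m))"
    using smooth_on_has_derivative[OF smooth_transition] assms m
    by (intro diff_chain_at) (auto simp: transition_cmap)
  then have "((\<lambda>x. x) has_derivative ?D \<circ> ?E) (at (cmap c' m))"
    by (rule has_derivative_transform_within_open[OF _ open_overlap[OF assms(2,1)] m(2)])
       (use assms in \<open>auto simp: overlap_def transition_cmap\<close>)
  then have "?D \<circ> ?E = (\<lambda>x. x)" using has_derivative_ident has_derivative_unique by blast
  then have "?D (?E (axis i 1)) = axis i 1" by (metis comp_apply)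
  moreover have "?D (?E (axis i 1)) $ k = (\<Sum>a\<in>UNIV. jac c c' (cmap c m) k a * jac c' c (cmap c' m) a i)"
    by (subst frechet_transition[OF assms(1,2) m(1)]) (simp add: jac_def)
  ultimately show ?thesis by (simp add: axis_def)
qed

lemma A_TM: "v \<in> A \<Longrightarrow> v \<in> TM C"
  using domain_A unfolding conic_domain_def by blast

lemma TM_law:
  assumes "v \<in> TM C" "c \<in> C" "c' \<in> C" "fst v \<in> cdom c" "fst v \<in> cdom c'"
  shows "snd v c' $ k = (\<Sum>a\<in>UNIV. jac c c' (cmap c (fst v)) k a * snd v c $ a)"
  using assms unfolding TM_def by auto

lemma TM_off: "v \<in> TM C \<Longrightarrow> \<not> (c \<in> C \<and> fst v \<in> cdom c) \<Longrightarrow> snd v c = 0"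
  unfolding TM_def by (auto simp only: case_prod_beta mem_Collect_eq)

lemma TM_eqI:
  assumes "v \<in> TM C" "u \<in> TM C" "c \<in> C" "fst v \<in> cdom c" "fst u = fst v" "snd u c = snd v c"
  shows "u = v"
proof -
  have "snd u c' = snd v c'" for c'
  proof (cases "c' \<in> C \<and> fst v \<in> cdom c'")
    case True
    then show ?thesis
      using TM_law[OF assms(1,3)] TM_law[OF assms(2,3)] assms by (simp add: vec_eq_iff)
  next
    case False
    then show ?thesis using TM_off[OF assms(1)] TM_off[OF assms(2)] assms(5) by simp
  qed
  then show ?thesis using assms(5) by (simp add: prod_eq_iff fun_eq_iff)
qed

lemma A_nonzero:
  assumes "v \<in> A" "c \<in> C" "fst v \<in> cdom c" shows "snd v c \<noteq> 0"
proof
  assume 0: "snd v c = 0"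
  have "snd v = (\<lambda>c. 0)"
  proof
    fix c' show "snd v c' = 0"
    proof (cases "c' \<in> C \<and> fst v \<in> cdom c'")
      case True
      then show ?thesis using TM_law[OF A_TM[OF assms(1)] assms(2)] assms(3) 0 by (simp add: vec_eq_iff)
    next
      case False
      then show ?thesis using TM_off[OF A_TM[OF assms(1)]] by simp
    qed
  qed
  then have "v \<in> zero_section" unfolding zero_section_def by (metis prod.collapse rangeI)
  then show False using assms(1) domain_A unfolding conic_domain_def by blast
qed

lemma adomI: "v \<in> A \<Longrightarrow> fst v \<in> cdom c \<Longrightarrow> tcoord c v \<in> adom A c"
  unfolding adom_def by blast

lemma adomE:
  assumes "p \<in> adom A c" obtains v where "v \<in> A" "fst v \<in> cdom c" "p = tcoord c v"
  using assms unfolding adom_def by blast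

lemma conic_region_adom: assumes "c \<in> C" shows "conic_region (adom A c)"
proof
  show "open (adom A c)" using domain_A assms unfolding conic_domain_def by blast
next
  fix x y :: "real^'n" and l :: real assume "(x, y) \<in> adom A c" "l > 0"
  then obtain v where v: "v \<in> A" "fst v \<in> cdom c" "(x, y) = tcoord c v" using adomE by blast
  then have "tscale l v \<in> A" using domain_A \<open>l > 0\<close> unfolding conic_domain_def by blast
  then show "(x, l *\<^sub>R y) \<in> adom A c"
    using adomI[of "tscale l v" c] v by (simp add: tscale_def tcoord_def)
next
  fix x y :: "real^'n" assume "(x, y) \<in> adom A c"
  then show "y \<noteq> 0" using A_nonzero[OF _ assms] by (auto simp: tcoord_def elim: adomE)
qed

lemma adom_shift:
  assumes "v \<in> A" "c \<in> C" "fst v \<in> cdom c" "(cmap c (fst v), y) \<in> adom A c"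
  obtains u where "u \<in> A" "fst u = fst v" "snd u c = y"
proof -
  obtain u where u: "u \<in> A" "fst u \<in> cdom c" "(cmap c (fst v), y) = tcoord c u" using adomE[OF assms(4)] by blast
  show thesis
    by (rule that[of u]) (use u cmap_inj[OF assms(2) u(2) assms(3)] in \<open>auto simp: tcoord_def\<close>)
qed

abbreviation sh :: "('m, 'n) chart \<Rightarrow> real \<Rightarrow> ('n pt \<Rightarrow> real) \<Rightarrow> bool" where
  "sh c \<equiv> conic_region.smooth_hom (adom A c)"

lemma component_iff:
  "component C A \<alpha> f \<longleftrightarrow> (\<forall>c\<in>C. sh c \<alpha> (f c)) \<and> (\<forall>c p. \<not> (c \<in> C \<and> p \<in> adom A c) \<longrightarrow> f c p = 0)"
  unfolding component_def using conic_region.smooth_hom_def[OF conic_region_adom] by blast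

lemma pdy_along_line:
  assumes "f differentiable (at (x, y))"
  shows "((\<lambda>t. f (x, y + t *\<^sub>R w)) has_real_derivative (\<Sum>a\<in>UNIV. w $ a * pdy a f (x, y))) (at 0)"
proof -
  have "((\<lambda>t. (x, y + t *\<^sub>R w)) has_derivative (\<lambda>r. (0, r *\<^sub>R w))) (at 0)"
    by (auto intro!: derivative_eq_intros)
  moreover have "(f has_derivative frechet_derivative f (at (x, y))) (at (x, y + 0 *\<^sub>R w))"
    using assms frechet_derivative_works by auto
  ultimately have "((\<lambda>t. f (x, y + t *\<^sub>R w)) has_derivative (\<lambda>r. frechet_derivative f (at (x, y)) (0, r *\<^sub>R w))) (at 0)"
    using diff_chain_at unfolding o_def by fast
  moreover have "frechet_derivative f (at (x, y)) (0, r *\<^sub>R w) = (\<Sum>a\<in>UNIV. w $ a * pdy a f (x, y)) * r" for r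
    using frechet_derivative_pt[OF assms, of 0 "r *\<^sub>R w"] by (simp add: sum_distrib_right sum_distrib_left mult_ac)
  ultimately show ?thesis unfolding has_field_derivative_def by (simp add: mult_commute_abs)
qed

text \<open>A fibre has coordinates in the two charts that are related by a linear map, so a transformation law with
  coefficients constant along the fibre may be differentiated along it.\<close>

lemma pdy_transform:
  assumes c: "c \<in> C" "c' \<in> C" and v: "v \<in> A" "fst v \<in> cdom c" "fst v \<in> cdom c'"
    and F: "smooth_on F (adom A c')" and G: "\<And>b. smooth_on (G b) (adom A c)"
    and law: "\<And>u. u \<in> A \<Longrightarrow> fst u = fst v \<Longrightarrow> F (tcoord c' u) = (\<Sum>b\<in>UNIV. m b * G b (tcoord c u))"
  shows "pdy i F (tcoord c' v) =
    (\<Sum>b\<in>UNIV. \<Sum>a\<in>UNIV. m b * jac c' c (cmap c' (fst v)) a i * pdy a (G b) (tcoord c v))"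
proof -
  let ?x = "cmap c (fst v)" and ?x' = "cmap c' (fst v)" and ?y = "snd v c" and ?y' = "snd v c'"
  let ?w = "\<chi> a. jac c' c ?x' a i"
  have p: "tcoord c v = (?x, ?y)" "tcoord c' v = (?x', ?y')" by (simp_all add: tcoord_def)
  have dF: "((\<lambda>t. F (?x', ?y' + t *\<^sub>R axis i 1)) has_real_derivative pdy i F (?x', ?y')) (at 0)"
    using pdy_along_line[OF smooth_on_differentiable[OF F adomI[OF v(1,3), unfolded p]], of "axis i 1"]
    by (simp add: axis_def sum_kronecker)
  have dG: "((\<lambda>t. \<Sum>b\<in>UNIV. m b * G b (?x, ?y + t *\<^sub>R ?w)) has_real_derivative
      (\<Sum>b\<in>UNIV. m b * (\<Sum>a\<in>UNIV. ?w $ a * pdy a (G b) (?x, ?y)))) (at 0)"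
    by (intro DERIV_sum DERIV_cmult pdy_along_line smooth_on_differentiable[OF G adomI[OF v(1,2), unfolded p]])
  let ?T = "{t. (?x', ?y' + t *\<^sub>R axis i 1) \<in> adom A c'}"
  have "open ?T"
    using open_vimage[OF conic_region.open_S[OF conic_region_adom[OF c(2)]], of "\<lambda>t. (?x', ?y' + t *\<^sub>R axis i 1)"]
    by (simp add: vimage_def continuous_intros)
  moreover have "0 \<in> ?T" using adomI[OF v(1,3), unfolded p] by simp
  moreover have "(\<Sum>b\<in>UNIV. m b * G b (?x, ?y + t *\<^sub>R ?w)) = F (?x', ?y' + t *\<^sub>R axis i 1)" if "t \<in> ?T" for t
  proof -
    obtain u where u: "u \<in> A" "fst u = fst v" "snd u c' = ?y' + t *\<^sub>R axis i 1"
      using adom_shift[OF v(1) c(2) v(3), of "?y' + t *\<^sub>R axis i 1"] \<open>t \<in> ?T\<close> by blast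
    have "snd u c $ k = (?y + t *\<^sub>R ?w) $ k" for k
    proof -
      have "snd u c $ k = (\<Sum>a\<in>UNIV. jac c' c ?x' k a * ?y' $ a) + (\<Sum>a\<in>UNIV. jac c' c ?x' k a * t * (if a = i then 1 else 0))"
        unfolding TM_law[OF A_TM[OF u(1)] c(2,1), unfolded u(2), OF v(3,2)] u(3) sum.distrib[symmetric]
        by (intro sum.cong refl) (auto simp: axis_def algebra_simps)
      then show ?thesis
        unfolding TM_law[OF A_TM[OF v(1)] c(2,1) v(3,2), symmetric] sum_kronecker by simp
    qed
    then have "snd u c = ?y + t *\<^sub>R ?w" unfolding vec_eq_iff by (rule allI)
    then show ?thesis using law[OF u(1,2)] by (simp only: tcoord_def u)
  qed
  ultimately have "((\<lambda>t. F (?x', ?y' + t *\<^sub>R axis i 1)) has_real_derivative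
      (\<Sum>b\<in>UNIV. m b * (\<Sum>a\<in>UNIV. ?w $ a * pdy a (G b) (?x, ?y)))) (at 0)"
    by (rule has_field_derivative_transform_within_open[OF dG])
  from DERIV_unique[OF dF this] show ?thesis
    unfolding p by (simp add: sum_distrib_left mult.assoc)
qed

lemma hT10_law:
  assumes "Z \<in> hT10 C A \<alpha>" "c \<in> C" "c' \<in> C" "v \<in> A" "fst v \<in> cdom c" "fst v \<in> cdom c'"
  shows "Z c' k (tcoord c' v) = (\<Sum>a\<in>UNIV. jac c c' (cmap c (fst v)) k a * Z c a (tcoord c v))"
  using assms unfolding hT10_def by blast

lemma hT01_law:
  assumes "B \<in> hT01 C A \<alpha>" "c \<in> C" "c' \<in> C" "v \<in> A" "fst v \<in> cdom c" "fst v \<in> cdom c'"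
  shows "B c' i (tcoord c' v) = (\<Sum>a\<in>UNIV. jac c' c (cmap c' (fst v)) a i * B c a (tcoord c v))"
  using assms unfolding hT01_def by blast

lemma hT11_law:
  assumes "J \<in> hT11 C A \<alpha>" "c \<in> C" "c' \<in> C" "v \<in> A" "fst v \<in> cdom c" "fst v \<in> cdom c'"
  shows "J c' i k (tcoord c' v) = (\<Sum>b\<in>UNIV. \<Sum>a\<in>UNIV.
    jac c c' (cmap c (fst v)) k b * jac c' c (cmap c' (fst v)) a i * J c a b (tcoord c v))"
  using assms unfolding hT11_def by blast

lemma hT_sh:
  "Z \<in> hT10 C A \<alpha> \<Longrightarrow> c \<in> C \<Longrightarrow> sh c \<alpha> (Z c k)"
  "B \<in> hT01 C A \<alpha> \<Longrightarrow> c \<in> C \<Longrightarrow> sh c \<alpha> (B c k)"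
  "J \<in> hT11 C A \<alpha> \<Longrightarrow> c \<in> C \<Longrightarrow> sh c \<alpha> (J c i k)"
  unfolding hT10_def hT01_def hT11_def component_iff by blast+

lemma hT_off:
  "Z \<in> hT10 C A \<alpha> \<Longrightarrow> \<not> (c \<in> C \<and> p \<in> adom A c) \<Longrightarrow> Z c k p = 0"
  "B \<in> hT01 C A \<alpha> \<Longrightarrow> \<not> (c \<in> C \<and> p \<in> adom A c) \<Longrightarrow> B c k p = 0"
  "J \<in> hT11 C A \<alpha> \<Longrightarrow> \<not> (c \<in> C \<and> p \<in> adom A c) \<Longrightarrow> J c i k p = 0"
  unfolding hT10_def hT01_def hT11_def component_iff by blast+

lemma hT10I:
  assumes "\<And>c k. c \<in> C \<Longrightarrow> sh c \<alpha> (Z c k)" "\<And>c k p. \<not> (c \<in> C \<and> p \<in> adom A c) \<Longrightarrow> Z c k p = 0"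
    "\<And>c c' v k. c \<in> C \<Longrightarrow> c' \<in> C \<Longrightarrow> v \<in> A \<Longrightarrow> fst v \<in> cdom c \<Longrightarrow> fst v \<in> cdom c' \<Longrightarrow>
      Z c' k (tcoord c' v) = (\<Sum>a\<in>UNIV. jac c c' (cmap c (fst v)) k a * Z c a (tcoord c v))"
  shows "Z \<in> hT10 C A \<alpha>"
  unfolding hT10_def component_iff using assms by blast

lemma hT01I:
  assumes "\<And>c k. c \<in> C \<Longrightarrow> sh c \<alpha> (B c k)" "\<And>c k p. \<not> (c \<in> C \<and> p \<in> adom A c) \<Longrightarrow> B c k p = 0"
    "\<And>c c' v i. c \<in> C \<Longrightarrow> c' \<in> C \<Longrightarrow> v \<in> A \<Longrightarrow> fst v \<in> cdom c \<Longrightarrow> fst v \<in> cdom c' \<Longrightarrow>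
      B c' i (tcoord c' v) = (\<Sum>a\<in>UNIV. jac c' c (cmap c' (fst v)) a i * B c a (tcoord c v))"
  shows "B \<in> hT01 C A \<alpha>"
  unfolding hT01_def component_iff using assms by blast

lemma hT11I:
  assumes "\<And>c i k. c \<in> C \<Longrightarrow> sh c \<alpha> (J c i k)" "\<And>c i k p. \<not> (c \<in> C \<and> p \<in> adom A c) \<Longrightarrow> J c i k p = 0"
    "\<And>c c' v i k. c \<in> C \<Longrightarrow> c' \<in> C \<Longrightarrow> v \<in> A \<Longrightarrow> fst v \<in> cdom c \<Longrightarrow> fst v \<in> cdom c' \<Longrightarrow>
      J c' i k (tcoord c' v) = (\<Sum>b\<in>UNIV. \<Sum>a\<in>UNIV.
        jac c c' (cmap c (fst v)) k b * jac c' c (cmap c' (fst v)) a i * J c a b (tcoord c v))"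
  shows "J \<in> hT11 C A \<alpha>"
  unfolding hT11_def component_iff using assms by blast

lemma connectionD:
  assumes "nonlinear_connection C A N"
  shows "c \<in> C \<Longrightarrow> sh c 1 (N c i k)" "\<not> (c \<in> C \<and> p \<in> adom A c) \<Longrightarrow> N c i k p = 0"
    "c \<in> C \<Longrightarrow> c' \<in> C \<Longrightarrow> v \<in> A \<Longrightarrow> fst v \<in> cdom c \<Longrightarrow> fst v \<in> cdom c' \<Longrightarrow>
      N c' i k (tcoord c' v) =
          (\<Sum>d\<in>UNIV. \<Sum>b\<in>UNIV. jac c c' (cmap c (fst v)) k d *
             hess c' c (cmap c' (fst v)) d i b * snd v c' $ b) +
          (\<Sum>d\<in>UNIV. \<Sum>a\<in>UNIV. jac c c' (cmap c (fst v)) k d * jac c' c (cmap c' (fst v)) a i *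
             N c a d (tcoord c v))"
  using assms unfolding nonlinear_connection_def component_iff by blast+

lemma connectionI:
  assumes "\<And>c i k. c \<in> C \<Longrightarrow> sh c 1 (N c i k)" "\<And>c i k p. \<not> (c \<in> C \<and> p \<in> adom A c) \<Longrightarrow> N c i k p = 0"
    "\<And>c c' v i k. c \<in> C \<Longrightarrow> c' \<in> C \<Longrightarrow> v \<in> A \<Longrightarrow> fst v \<in> cdom c \<Longrightarrow> fst v \<in> cdom c' \<Longrightarrow>
      N c' i k (tcoord c' v) =
          (\<Sum>d\<in>UNIV. \<Sum>b\<in>UNIV. jac c c' (cmap c (fst v)) k d *
             hess c' c (cmap c' (fst v)) d i b * snd v c' $ b) +
          (\<Sum>d\<in>UNIV. \<Sum>a\<in>UNIV. jac c c' (cmap c (fst v)) k d * jac c' c (cmap c' (fst v)) a i *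
             N c a d (tcoord c v))"
  shows "nonlinear_connection C A N"
  unfolding nonlinear_connection_def component_iff using assms by blast

lemma vertical_deriv_hT11:
  assumes Z: "Z \<in> hT10 C A 2" shows "vertical_deriv C A Z \<in> hT11 C A 1"
proof -
  have "sh c 1 (vertical_deriv C A Z c i k)" if c: "c \<in> C" for c i k
  proof -
    interpret conic_region "adom A c" by (rule conic_region_adom[OF c])
    have "sh c 1 (pdy i (Z c k))" by (rule smooth_hom_pdy[OF hT_sh(1)[OF Z c]]) simp
    then show ?thesis by (rule smooth_hom_cong) (simp add: vertical_deriv_def c)
  qed
  moreover have "vertical_deriv C A Z c' i k (tcoord c' v) = (\<Sum>b\<in>UNIV. \<Sum>a\<in>UNIV.
      jac c c' (cmap c (fst v)) k b * jac c' c (cmap c' (fst v)) a i * vertical_deriv C A Z c a b (tcoord c v))"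
    if "c \<in> C" "c' \<in> C" "v \<in> A" "fst v \<in> cdom c" "fst v \<in> cdom c'" for c c' v i k
  proof -
    have s: "smooth_on (Z c k) (adom A c)" if "c \<in> C" for c k
      using conic_region.smooth_homD[OF conic_region_adom[OF that] hT_sh(1)[OF Z that]] .
    have "pdy i (Z c' k) (tcoord c' v) = (\<Sum>b\<in>UNIV. \<Sum>a\<in>UNIV.
      jac c c' (cmap c (fst v)) k b * jac c' c (cmap c' (fst v)) a i * pdy a (Z c b) (tcoord c v))"
      by (rule pdy_transform) (use that s hT10_law[OF Z that(1,2)] in auto)
    then show ?thesis using that adomI by (simp add: vertical_deriv_def)
  qed
  ultimately show ?thesis by (intro hT11I) (auto simp: vertical_deriv_def)
qed

lemma tensor_liouville_hT11:
  assumes B: "B \<in> hT01 C A 0" shows "tensor_liouville B \<in> hT11 C A 1"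
proof -
  have "sh c 1 (tensor_liouville B c i k)" if c: "c \<in> C" for c i k
  proof -
    interpret conic_region "adom A c" by (rule conic_region_adom[OF c])
    show ?thesis unfolding tensor_liouville_def
      by (rule smooth_hom_mult[OF hT_sh(2)[OF B c] smooth_hom_snd_nth]) simp
  qed
  moreover have "tensor_liouville B c' i k (tcoord c' v) = (\<Sum>b\<in>UNIV. \<Sum>a\<in>UNIV.
      jac c c' (cmap c (fst v)) k b * jac c' c (cmap c' (fst v)) a i * tensor_liouville B c a b (tcoord c v))"
    if "c \<in> C" "c' \<in> C" "v \<in> A" "fst v \<in> cdom c" "fst v \<in> cdom c'" for c c' v i k
  proof -
    have "tensor_liouville B c' i k (tcoord c' v) =
        (\<Sum>b\<in>UNIV. jac c c' (cmap c (fst v)) k b * snd v c $ b) *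
        (\<Sum>a\<in>UNIV. jac c' c (cmap c' (fst v)) a i * B c a (tcoord c v))"
      using hT01_law[OF B that] TM_law[OF A_TM[OF that(3)] that(1,2,4,5)]
      by (simp add: tensor_liouville_def tcoord_def mult.commute)
    also have "\<dots> = (\<Sum>b\<in>UNIV. \<Sum>a\<in>UNIV.
      jac c c' (cmap c (fst v)) k b * jac c' c (cmap c' (fst v)) a i * tensor_liouville B c a b (tcoord c v))"
      unfolding sum_product tensor_liouville_def by (intro sum.cong refl) (simp add: tcoord_def mult_ac)
    finally show ?thesis .
  qed
  moreover have "tensor_liouville B c i k p = 0" if "\<not> (c \<in> C \<and> p \<in> adom A c)" for c i k p
    using hT_off(2)[OF B that] by (simp add: tensor_liouville_def)
  ultimately show ?thesis by (intro hT11I)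
qed

lemma hT11_diff:
  assumes J: "J \<in> hT11 C A \<alpha>" and K: "K \<in> hT11 C A \<alpha>"
  shows "(\<lambda>c i k p. J c i k p - K c i k p) \<in> hT11 C A \<alpha>"
proof -
  have "sh c \<alpha> (\<lambda>p. J c i k p - K c i k p)" if c: "c \<in> C" for c i k
    using conic_region.smooth_hom_diff[OF conic_region_adom[OF c]] hT_sh(3)[OF J c] hT_sh(3)[OF K c] by blast
  moreover have "J c' i k (tcoord c' v) - K c' i k (tcoord c' v) = (\<Sum>b\<in>UNIV. \<Sum>a\<in>UNIV.
      jac c c' (cmap c (fst v)) k b * jac c' c (cmap c' (fst v)) a i * (J c a b (tcoord c v) - K c a b (tcoord c v)))"
    if "c \<in> C" "c' \<in> C" "v \<in> A" "fst v \<in> cdom c" "fst v \<in> cdom c'" for c c' v i k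
    using hT11_law[OF J that] hT11_law[OF K that] by (simp add: right_diff_distrib sum_subtractf)
  moreover have "J c i k p - K c i k p = 0" if "\<not> (c \<in> C \<and> p \<in> adom A c)" for c i k p
    using hT_off(3)[OF J that] hT_off(3)[OF K that] by simp
  ultimately show ?thesis by (intro hT11I)
qed

lemma connection_diff:
  assumes N: "nonlinear_connection C A N" and K: "K \<in> hT11 C A 1"
  shows "nonlinear_connection C A (\<lambda>c i k p. N c i k p - K c i k p)"
proof (rule connectionI)
  fix c i k assume c: "c \<in> C"
  show "sh c 1 (\<lambda>p. N c i k p - K c i k p)"
    by (rule conic_region.smooth_hom_diff[OF conic_region_adom[OF c] connectionD(1)[OF N c] hT_sh(3)[OF K c]])
next
  fix c i k p assume "\<not> (c \<in> C \<and> p \<in> adom A c)"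
  from connectionD(2)[OF N this] hT_off(3)[OF K this] show "N c i k p - K c i k p = 0" by simp
next
  fix c c' v i k assume that: "c \<in> C" "c' \<in> C" "v \<in> A" "fst v \<in> cdom c" "fst v \<in> cdom c'"
  show "N c' i k (tcoord c' v) - K c' i k (tcoord c' v) =
          (\<Sum>d\<in>UNIV. \<Sum>b\<in>UNIV. jac c c' (cmap c (fst v)) k d *
             hess c' c (cmap c' (fst v)) d i b * snd v c' $ b) +
          (\<Sum>d\<in>UNIV. \<Sum>a\<in>UNIV. jac c c' (cmap c (fst v)) k d * jac c' c (cmap c' (fst v)) a i *
             (N c a d (tcoord c v) - K c a d (tcoord c v)))"
    unfolding connectionD(3)[OF N that] hT11_law[OF K that] by (simp add: right_diff_distrib sum_subtractf)
qed

lemma contract_law: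
  assumes J: "J \<in> hT11 C A 1" and c: "c \<in> C" "c' \<in> C" and v: "v \<in> A" "fst v \<in> cdom c" "fst v \<in> cdom c'"
  shows "(\<Sum>i\<in>UNIV. J c' i k (tcoord c' v) * snd v c' $ i) =
    (\<Sum>b\<in>UNIV. jac c c' (cmap c (fst v)) k b * (\<Sum>a\<in>UNIV. J c a b (tcoord c v) * snd v c $ a))"
proof -
  let ?j = "jac c c' (cmap c (fst v))" and ?j' = "jac c' c (cmap c' (fst v))"
  have "(\<Sum>i\<in>UNIV. J c' i k (tcoord c' v) * snd v c' $ i) =
     (\<Sum>i\<in>UNIV. \<Sum>b\<in>UNIV. \<Sum>a\<in>UNIV. ?j k b * J c a b (tcoord c v) * (?j' a i * snd v c' $ i))"
    unfolding hT11_law[OF J c v] sum_distrib_right by (intro sum.cong refl) (simp add: mult_ac)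
  also have "\<dots> = (\<Sum>b\<in>UNIV. \<Sum>i\<in>UNIV. \<Sum>a\<in>UNIV. ?j k b * J c a b (tcoord c v) * (?j' a i * snd v c' $ i))"
    by (rule sum.swap)
  also have "\<dots> = (\<Sum>b\<in>UNIV. \<Sum>a\<in>UNIV. \<Sum>i\<in>UNIV. ?j k b * J c a b (tcoord c v) * (?j' a i * snd v c' $ i))"
    by (intro sum.cong refl sum.swap)
  also have "\<dots> = (\<Sum>b\<in>UNIV. \<Sum>a\<in>UNIV. ?j k b * J c a b (tcoord c v) * snd v c $ a)"
    by (simp only: TM_law[OF A_TM[OF v(1)] c(2,1) v(3,2)] sum_distrib_left)
  finally show ?thesis by (simp add: sum_distrib_left mult.assoc)
qed

lemma trace_law:
  assumes J: "J \<in> hT11 C A \<alpha>" and c: "c \<in> C" "c' \<in> C" and v: "v \<in> A" "fst v \<in> cdom c" "fst v \<in> cdom c'"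
  shows "(\<Sum>i\<in>UNIV. J c' i i (tcoord c' v)) = (\<Sum>a\<in>UNIV. J c a a (tcoord c v))"
proof -
  let ?j = "jac c c' (cmap c (fst v))" and ?j' = "jac c' c (cmap c' (fst v))"
  have "(\<Sum>i\<in>UNIV. J c' i i (tcoord c' v)) =
     (\<Sum>i\<in>UNIV. \<Sum>b\<in>UNIV. \<Sum>a\<in>UNIV. ?j' a i * ?j i b * J c a b (tcoord c v))"
    unfolding hT11_law[OF J c v] by (simp add: mult_ac)
  also have "\<dots> = (\<Sum>b\<in>UNIV. \<Sum>i\<in>UNIV. \<Sum>a\<in>UNIV. ?j' a i * ?j i b * J c a b (tcoord c v))"
    by (rule sum.swap)
  also have "\<dots> = (\<Sum>b\<in>UNIV. \<Sum>a\<in>UNIV. \<Sum>i\<in>UNIV. ?j' a i * ?j i b * J c a b (tcoord c v))"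
    by (intro sum.cong refl sum.swap)
  also have "\<dots> = (\<Sum>b\<in>UNIV. \<Sum>a\<in>UNIV. (if a = b then 1 else 0) * J c a b (tcoord c v))"
    by (simp only: sum_distrib_right[symmetric] jac_inverse[OF c(2,1) v(3,2)])
  finally show ?thesis by (simp only: sum_kronecker)
qed

lemma contract_hT10:
  assumes J: "J \<in> hT11 C A 1"
  shows "(\<lambda>c k p. \<Sum>a\<in>UNIV. J c a k p * snd p $ a) \<in> hT10 C A 2"
proof -
  have "sh c 2 (\<lambda>p. \<Sum>a\<in>UNIV. J c a k p * snd p $ a)" if c: "c \<in> C" for c k
  proof -
    interpret conic_region "adom A c" by (rule conic_region_adom[OF c])
    show ?thesis by (intro smooth_hom_sum smooth_hom_mult[OF hT_sh(3)[OF J c] smooth_hom_snd_nth]) simp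
  qed
  then show ?thesis
  proof (rule hT10I)
    fix c c' v k assume "c \<in> C" "c' \<in> C" "v \<in> A" "fst v \<in> cdom c" "fst v \<in> cdom c'"
    from contract_law[OF J this]
    show "(\<Sum>a\<in>UNIV. J c' a k (tcoord c' v) * snd (tcoord c' v) $ a) = (\<Sum>b\<in>UNIV. jac c c' (cmap c (fst v)) k b *
      (\<Sum>a\<in>UNIV. J c a b (tcoord c v) * snd (tcoord c v) $ a))" by (simp add: tcoord_def)
  next
    fix c k p assume "\<not> (c \<in> C \<and> p \<in> adom A c)"
    from hT_off(3)[OF J this] show "(\<Sum>a\<in>UNIV. J c a k p * snd p $ a) = 0" by simp
  qed
qed

text \<open>The covector is recovered with the help of the Euclidean norm of \<open>y\<close> in each chart.  This norm is not
  invariant, but \<open>K\<close> determines the covector, and the transformation law of \<open>K\<close> may be divided by a nonzero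
  component of \<open>y\<close>.\<close>

lemma radial_hT11:
  assumes K: "K \<in> hT11 C A 1"
    and rad: "\<And>c p. c \<in> C \<Longrightarrow> p \<in> adom A c \<Longrightarrow> \<exists>a. \<forall>i k. K c i k p = a i * snd p $ k"
  obtains B where "B \<in> hT01 C A 0" "K = tensor_liouville B"
proof
  define q where "q p = (\<Sum>k\<in>UNIV. snd p $ k * snd p $ k)" for p :: "'n pt"
  define B where "B = (\<lambda>c i p. (\<Sum>k\<in>UNIV. K c i k p * snd p $ k) / q p)"
  have q0: "q p \<noteq> 0" if "c \<in> C" "p \<in> adom A c" for c p
  proof -
    have "snd p \<noteq> 0" using conic_region.nonzero_S[OF conic_region_adom[OF that(1)], of "fst p" "snd p"] that by simp
    moreover have "q p = inner (snd p) (snd p)" by (simp add: q_def inner_vec_def)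
    ultimately show ?thesis by simp
  qed
  have KB: "K c i k p = B c i p * snd p $ k" if c: "c \<in> C" "p \<in> adom A c" for c i k p
  proof -
    obtain a where a: "\<And>i k. K c i k p = a i * snd p $ k" using rad[OF c] by blast
    have "(\<Sum>k\<in>UNIV. K c i k p * snd p $ k) = a i * q p"
      unfolding q_def a sum_distrib_left by (simp add: mult.assoc)
    then have "B c i p = a i" using q0[OF c] by (simp add: B_def)
    then show ?thesis by (simp add: a)
  qed
  have B0: "B c i p = 0" if "\<not> (c \<in> C \<and> p \<in> adom A c)" for c i p
    unfolding B_def by (simp add: hT_off(3)[OF K that])
  show "K = tensor_liouville B"
    using KB B0 hT_off(3)[OF K] by (fastforce simp: tensor_liouville_def fun_eq_iff)
  have "sh c 0 (B c i)" if c: "c \<in> C" for c i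
  proof -
    interpret conic_region "adom A c" by (rule conic_region_adom[OF c])
    have "smooth_hom 2 q" unfolding q_def
      by (intro smooth_hom_sum smooth_hom_mult[OF smooth_hom_snd_nth smooth_hom_snd_nth]) simp
    moreover have "smooth_hom 2 (\<lambda>p. \<Sum>k\<in>UNIV. K c i k p * snd p $ k)"
      by (intro smooth_hom_sum smooth_hom_mult[OF hT_sh(3)[OF K c] smooth_hom_snd_nth]) simp
    ultimately show ?thesis unfolding B_def by (intro smooth_hom_divide) (auto simp: q0[OF c])
  qed
  moreover have "B c' i (tcoord c' v) = (\<Sum>a\<in>UNIV. jac c' c (cmap c' (fst v)) a i * B c a (tcoord c v))"
    if c: "c \<in> C" "c' \<in> C" "v \<in> A" "fst v \<in> cdom c" "fst v \<in> cdom c'" for c c' v i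
  proof -
    let ?j = "jac c c' (cmap c (fst v))" and ?j' = "jac c' c (cmap c' (fst v))"
    note v = c(4,5)
    obtain k where k: "snd v c' $ k \<noteq> 0" using A_nonzero[OF c(3,2) v(2)] by (auto simp: vec_eq_iff)
    have "B c' i (tcoord c' v) * snd v c' $ k = (\<Sum>b\<in>UNIV. \<Sum>a\<in>UNIV. ?j k b * ?j' a i * (B c a (tcoord c v) * snd v c $ b))"
      using hT11_law[OF K c(1-3) v, of i k] KB[OF c(1) adomI[OF c(3) v(1)]] KB[OF c(2) adomI[OF c(3) v(2)]]
      by (simp add: tcoord_def)
    also have "\<dots> = (\<Sum>b\<in>UNIV. ?j k b * snd v c $ b) * (\<Sum>a\<in>UNIV. ?j' a i * B c a (tcoord c v))"
      unfolding sum_product by (simp add: mult_ac)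
    also have "\<dots> = snd v c' $ k * (\<Sum>a\<in>UNIV. ?j' a i * B c a (tcoord c v))"
      using TM_law[OF A_TM[OF c(3)] c(1,2) v] by simp
    finally show ?thesis using k by simp
  qed
  ultimately show "B \<in> hT01 C A 0" using B0 by (intro hT01I)
qed

text \<open>The field \<open>zpart J\<close> is a vector because \<open>radial_part J\<close> is, up to a constant, the trace of the tensor
  \<open>2 J - \<partial>W\<close>.\<close>

lemma affine_solution_decomposition:
  assumes n: "CARD('n) \<ge> 2" and J: "J \<in> hT11 C A 1"
    and aff: "\<And>c p. c \<in> C \<Longrightarrow> p \<in> adom A c \<Longrightarrow> affine_equation (f c) (J c) p"
  obtains Z B where "Z \<in> hT10 C A 2" "B \<in> hT01 C A 0"
    "J = (\<lambda>c i k p. vertical_deriv C A Z c i k p + tensor_liouville B c i k p)"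
proof -
  define W where "W = (\<lambda>c k p. \<Sum>a\<in>UNIV. J c a k p * snd p $ a)"
  have W: "W \<in> hT10 C A 2" unfolding W_def by (rule contract_hT10[OF J])
  have cW: "conic_region.contract (J c) k = W c k" if "c \<in> C" for c k
    unfolding conic_region.contract_def[OF conic_region_adom[OF that]] W_def ..
  define Z where "Z = (\<lambda>c k p. if c \<in> C \<and> p \<in> adom A c then conic_region.zpart (J c) k p else 0)"
  have T: "(\<lambda>c i k p. (J c i k p - (vertical_deriv C A W c i k p - J c i k p))) \<in> hT11 C A 1"
    by (intro hT11_diff vertical_deriv_hT11 J W)
  have rp: "conic_region.radial_part (J c) (tcoord c v) =
      (\<Sum>i\<in>UNIV. J c i i (tcoord c v) - (vertical_deriv C A W c i i (tcoord c v) - J c i i (tcoord c v))) / (1 - real CARD('n))"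
    if "c \<in> C" "v \<in> A" "fst v \<in> cdom c" for c v
    using that adomI[OF that(2,3)]
    by (simp add: conic_region.radial_part_def[OF conic_region_adom[OF that(1)]] cW vertical_deriv_def)
  have Z: "Z \<in> hT10 C A 2"
  proof -
    have "sh c 2 (Z c k)" if c: "c \<in> C" for c k
    proof -
      interpret conic_region "adom A c" by (rule conic_region_adom[OF c])
      have "sh c 2 (zpart (J c) k)" by (rule smooth_hom_zpart[OF hT_sh(3)[OF J c]])
      then show ?thesis by (rule smooth_hom_cong) (simp add: Z_def c)
    qed
    moreover have "Z c' k (tcoord c' v) = (\<Sum>a\<in>UNIV. jac c c' (cmap c (fst v)) k a * Z c a (tcoord c v))"
      if c: "c \<in> C" "c' \<in> C" "v \<in> A" "fst v \<in> cdom c" "fst v \<in> cdom c'" for c c' v k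
    proof -
      note v = c(4,5)
      have z: "Z c k (tcoord c v) = (1/2) * (W c k (tcoord c v) - conic_region.radial_part (J c) (tcoord c v) * snd v c $ k)"
        if "c \<in> C" "fst v \<in> cdom c" for c k
        using that adomI[OF c(3) that(2)] cW[OF that(1)]
        by (simp add: Z_def conic_region.zpart_def[OF conic_region_adom[OF that(1)]]) (simp add: tcoord_def)
      have r: "conic_region.radial_part (J c') (tcoord c' v) = conic_region.radial_part (J c) (tcoord c v)"
        unfolding rp[OF c(1,3) v(1)] rp[OF c(2,3) v(2)] using trace_law[OF T c(1-3) v] by simp
      show ?thesis
        unfolding z[OF c(1) v(1)] z[OF c(2) v(2)] r hT10_law[OF W c(1-3) v] TM_law[OF A_TM[OF c(3)] c(1,2) v]
        by (simp add: sum_distrib_left sum_subtractf[symmetric] algebra_simps)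
    qed
    moreover have "Z c k p = 0" if "\<not> (c \<in> C \<and> p \<in> adom A c)" for c k p
      unfolding Z_def using that by (rule if_not_P)
    ultimately show ?thesis by (intro hT10I)
  qed
  let ?K = "\<lambda>c i k p. J c i k p - vertical_deriv C A Z c i k p"
  have K: "?K \<in> hT11 C A 1" by (intro hT11_diff vertical_deriv_hT11 J Z)
  have "\<exists>a. \<forall>i k. ?K c i k p = a i * snd p $ k" if c: "c \<in> C" and p: "p \<in> adom A c" for c p
  proof -
    interpret conic_region "adom A c" by (rule conic_region_adom[OF c])
    have "pdy i (zpart (J c) k) p = pdy i (Z c k) p" for i k
      by (rule pd_cong(2)[OF smooth_homD[OF smooth_hom_zpart[OF hT_sh(3)[OF J c]]] open_S p]) (simp add: Z_def c)
    then show ?thesis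
      using affine_equation_decomposition[OF n hT_sh(3)[OF J c] aff[OF c] p] c p by (simp add: vertical_deriv_def)
  qed
  from radial_hT11[OF K this] obtain B where B: "B \<in> hT01 C A 0" "?K = tensor_liouville B" by blast
  have "J = (\<lambda>c i k p. vertical_deriv C A Z c i k p + tensor_liouville B c i k p)"
    unfolding B(2)[symmetric] by simp
  with Z B(1) show thesis by (rule that)
qed

end

section \<open>Ordinary differential equations\<close>

lemma smooth_on_Lipschitz_cball:
  fixes F :: "'a::euclidean_space \<Rightarrow> 'b::euclidean_space"
  assumes F: "smooth_on F U" and "cball u0 r \<subseteq> U"
  obtains K where "K \<ge> 0" "\<And>x y. x \<in> cball u0 r \<Longrightarrow> y \<in> cball u0 r \<Longrightarrow> norm (F x - F y) \<le> K * norm (x - y)"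
proof -
  let ?D = "\<lambda>x. frechet_derivative F (at x)"
  let ?s = "\<lambda>x. \<Sum>b\<in>Basis. norm (?D x b)"
  have "continuous_on (cball u0 r) ?s"
    using smooth_on_continuous[OF smooth_on_frechet[OF F]] assms(2)
    by (intro continuous_on_sum continuous_on_norm) (blast intro: continuous_on_subset)
  then have "bounded (?s ` cball u0 r)"
    using compact_continuous_image compact_imp_bounded compact_cball by blast
  then obtain K where K': "K > 0" "\<And>x. x \<in> cball u0 r \<Longrightarrow> norm (?s x) \<le> K"
    unfolding bounded_pos by blast
  then have K: "?s x \<le> K" "K > 0" if "x \<in> cball u0 r" for x
    using that abs_ge_self order_trans unfolding real_norm_def by blast+
  have "onorm (?D x) \<le> K" if "x \<in> cball u0 r" for x
  proof -
    have lin: "linear (?D x)"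
      using has_derivative_linear[OF smooth_on_has_derivative[OF F, of x]] that assms(2) by blast
    have "norm (?D x v) \<le> K * norm v" for v
    proof -
      have "norm (?D x (\<Sum>b\<in>Basis. (v \<bullet> b) *\<^sub>R b)) = norm (\<Sum>b\<in>Basis. (v \<bullet> b) *\<^sub>R ?D x b)"
        by (simp only: linear_sum[OF lin] linear_scale[OF lin])
      also have "\<dots> \<le> (\<Sum>b\<in>Basis. norm v * norm (?D x b))"
        by (intro sum_norm_le) (simp add: Basis_le_norm mult_right_mono)
      also have "\<dots> \<le> K * norm v"
        using mult_right_mono[OF K(1)[OF that], of "norm v"] by (simp add: sum_distrib_left[symmetric] mult.commute)
      finally show ?thesis by (simp only: euclidean_representation)
    qed
    then show ?thesis by (rule onorm_le)
  qed
  moreover have "(F has_derivative ?D x) (at x within cball u0 r)" if "x \<in> cball u0 r" for x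
    by (rule has_derivative_at_withinI[OF smooth_on_has_derivative[OF F]]) (use that assms(2) in blast)
  ultimately have "norm (F x - F y) \<le> K * norm (x - y)" if "x \<in> cball u0 r" "y \<in> cball u0 r" for x y
    using differentiable_bound[OF convex_cball, of u0 r F ?D K] that by blast
  then show thesis using that[of K] K'(1) by simp
qed

text \<open>The integral operator, with the time clamped to a compact interval, is a contraction of the space of
  bounded continuous curves.\<close>

lemma Picard_Lindelof_Lipschitz:
  fixes H :: "'a::euclidean_space \<Rightarrow> 'a"
  assumes lip: "\<And>x y. norm (H x - H y) \<le> K * norm (x - y)" and bd: "\<And>x. norm (H x) \<le> M"
    and e: "e > 0" "3 * e * K \<le> 1/2"
  obtains u where "u 0 = u0" "\<And>t. t \<in> {-e<..<e} \<Longrightarrow> (u has_vector_derivative H (u t)) (at t)"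
    "\<And>t. norm (u t - u0) \<le> 3 * e * M"
proof -
  have M0: "M \<ge> 0" using bd[of 0] norm_ge_zero order_trans by blast
  have contH: "continuous_on UNIV H"
  proof (rule continuous_onI)
    fix x \<epsilon> :: real and z :: 'a assume "\<epsilon> > 0"
    have "dist (H y) (H z) < \<epsilon>" if "dist y z < \<epsilon> / (1 + \<bar>K\<bar>)" for y
    proof -
      have "dist (H y) (H z) \<le> K * dist y z" using lip by (simp add: dist_norm)
      also have "\<dots> \<le> (1 + \<bar>K\<bar>) * dist y z" by (intro mult_right_mono) auto
      also have "\<dots> < \<epsilon>" using that by (simp add: field_simps add_pos_nonneg)
      finally show ?thesis .
    qed
    then show "\<exists>d>0. \<forall>x'\<in>UNIV. dist x' z < d \<longrightarrow> dist (H x') (H z) \<le> \<epsilon>"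
      using \<open>\<epsilon> > 0\<close> by (intro exI[of _ "\<epsilon> / (1 + \<bar>K\<bar>)"]) (auto simp: less_imp_le add_pos_nonneg)
  qed
  define cl where "cl t = max (-e) (min e t)" for t :: real
  have cl: "-e \<le> cl t" "cl t \<le> e" for t using e by (auto simp: cl_def)
  \<comment> \<open>the difference of integrals is the integral from \<open>0\<close> to \<open>cl t\<close>, for both signs of \<open>t\<close>\<close>
  define P where "P u t = u0 + (integral {-e..cl t} (\<lambda>s. H (u s)) - integral {-e..0} (\<lambda>s. H (u s)))" for u t
  have cont: "continuous_on T (\<lambda>s. H (apply_bcontfun u s))" for u :: "real \<Rightarrow>\<^sub>C 'a" and T
    by (rule continuous_on_compose2[OF contH]) auto
  have int: "(\<lambda>s. H (apply_bcontfun u s)) integrable_on {a..b}" for u :: "real \<Rightarrow>\<^sub>C 'a" and a b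
    by (rule integrable_continuous_real[OF cont])
  have nb: "norm (integral {-e..b} f) \<le> B * (b + e)" if "-e \<le> b" "continuous_on {-e..b} f" "\<And>s. norm (f s) \<le> B"
    for b B and f :: "real \<Rightarrow> 'a"
    using integral_bound[OF that(1,2)] that(3) by simp
  have PB: "norm (P (apply_bcontfun u) t - u0) \<le> 3 * e * M" for u :: "real \<Rightarrow>\<^sub>C 'a" and t
  proof -
    have "norm (P (apply_bcontfun u) t - u0) \<le> M * (cl t + e) + M * (0 + e)"
    proof -
      have "norm (integral {-e..cl t} (\<lambda>s. H (u s)) - integral {-e..0} (\<lambda>s. H (u s)))
          \<le> norm (integral {-e..cl t} (\<lambda>s. H (u s))) + norm (integral {-e..0} (\<lambda>s. H (u s)))"
        by (rule norm_triangle_ineq4)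
      also have "\<dots> \<le> M * (cl t + e) + M * (0 + e)"
        using e cl by (intro add_mono nb cont bd) auto
      finally show ?thesis by (simp add: P_def)
    qed
    also have "\<dots> \<le> M * (e + e) + M * (0 + e)" using M0 cl(2)[of t] by (intro add_mono mult_left_mono) auto
    finally show ?thesis by (simp add: algebra_simps)
  qed
  have Pc: "P (apply_bcontfun u) \<in> bcontfun" for u :: "real \<Rightarrow>\<^sub>C 'a"
  proof (rule bcontfun_normI)
    have "continuous_on {-e..e} (\<lambda>t. integral {-e..t} (\<lambda>s. H (apply_bcontfun u s)))"
      by (rule indefinite_integral_continuous_1[OF int])
    then have "continuous_on UNIV (\<lambda>t. integral {-e..cl t} (\<lambda>s. H (apply_bcontfun u s)))"
      by (rule continuous_on_compose2) (use cl in \<open>auto simp: cl_def intro!: continuous_intros\<close>)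
    then show "continuous_on UNIV (P (apply_bcontfun u))"
      unfolding P_def by (intro continuous_intros)
    show "norm (P (apply_bcontfun u) t) \<le> norm u0 + 3 * e * M" for t
      using PB[of u t] norm_triangle_ineq2[of "P (apply_bcontfun u) t" u0] by simp
  qed
  define Q where "Q u = Bcontfun (P (apply_bcontfun u))" for u
  have Q: "apply_bcontfun (Q u) = P (apply_bcontfun u)" for u
    unfolding Q_def by (rule Bcontfun_inverse[OF Pc])
  have K0: "K * norm (x - y) \<ge> 0" for x y :: 'a using lip[of x y] norm_ge_zero order_trans by blast
  have "dist (Q u) (Q w) \<le> 1/2 * dist u w" for u w
  proof (rule dist_bound)
    fix t
    let ?f = "\<lambda>s. H (apply_bcontfun u s) - H (apply_bcontfun w s)"
    have b: "norm (?f s) \<le> \<bar>K\<bar> * dist u w" for s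
    proof -
      have "norm (?f s) \<le> \<bar>K\<bar> * norm (u s - w s)"
        using lip[of "u s" "w s"] by (rule order_trans) (simp add: mult_right_mono)
      also have "\<dots> \<le> \<bar>K\<bar> * dist u w" using dist_bounded[of u s w] by (simp add: dist_norm mult_left_mono)
      finally show ?thesis .
    qed
    have c: "continuous_on T ?f" for T by (intro continuous_intros cont)
    have "dist (Q u t) (Q w t) = norm (integral {-e..cl t} ?f - integral {-e..0} ?f)"
      unfolding Q P_def dist_norm Henstock_Kurzweil_Integration.integral_diff[OF int int]
      by (rule arg_cong[of _ _ norm]) simp
    also have "\<dots> \<le> norm (integral {-e..cl t} ?f) + norm (integral {-e..0} ?f)" by (rule norm_triangle_ineq4)
    also have "\<dots> \<le> \<bar>K\<bar> * dist u w * (cl t + e) + \<bar>K\<bar> * dist u w * (0 + e)"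
      using e cl by (intro add_mono nb c b) auto
    also have "\<dots> \<le> \<bar>K\<bar> * dist u w * (e + e) + \<bar>K\<bar> * dist u w * (0 + e)"
      using cl(2)[of t] by (intro add_mono mult_left_mono) auto
    also have "\<dots> = (3 * e * \<bar>K\<bar>) * dist u w" by (simp add: algebra_simps)
    also have "\<dots> \<le> 1/2 * dist u w"
    proof (cases "u = w")
      case False
      then obtain s where "u s \<noteq> w s" using bcontfun_eqI by blast
      then have "K \<ge> 0" using K0[of "u s" "w s"] by (simp add: zero_le_mult_iff)
      then show ?thesis using e(2) by (intro mult_right_mono) auto
    qed simp
    finally show "dist (Q u t) (Q w t) \<le> 1/2 * dist u w" .
  qed
  then obtain u where u: "Q u = u" using banach_fix_type[of "1/2" Q] by auto
  have ue: "apply_bcontfun u t = P (apply_bcontfun u) t" for t using Q[of u] u by simp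
  show thesis
  proof (rule that[of "apply_bcontfun u"])
    show "apply_bcontfun u 0 = u0" using e by (subst ue) (simp add: P_def cl_def)
    show "norm (apply_bcontfun u t - u0) \<le> 3 * e * M" for t by (subst ue) (rule PB)
    fix t assume t: "t \<in> {-e<..<e}"
    have "((\<lambda>t. integral {-e..t} (\<lambda>s. H (apply_bcontfun u s))) has_vector_derivative H (apply_bcontfun u t)) (at t within {-e..e})"
      using t by (intro integral_has_vector_derivative cont) auto
    then have "((\<lambda>t. integral {-e..t} (\<lambda>s. H (apply_bcontfun u s))) has_vector_derivative H (apply_bcontfun u t)) (at t)"
      using at_within_interior[of t "{-e..e}"] t by simp
    then have "((\<lambda>t. u0 + (integral {-e..t} (\<lambda>s. H (apply_bcontfun u s)) - integral {-e..0} (\<lambda>s. H (apply_bcontfun u s))))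
        has_vector_derivative H (apply_bcontfun u t)) (at t)"
      by (auto intro!: derivative_eq_intros)
    then show "(apply_bcontfun u has_vector_derivative H (apply_bcontfun u t)) (at t)"
    proof (rule has_vector_derivative_transform_within_open[of _ _ _ "{-e<..<e}"])
      fix s assume "s \<in> {-e<..<e}"
      then have "cl s = s" by (auto simp: cl_def)
      then show "u0 + (integral {-e..s} (\<lambda>s. H (u s)) - integral {-e..0} (\<lambda>s. H (u s))) = u s"
        using ue[of s] unfolding P_def by simp
    qed (use t in auto)
  qed
qed

text \<open>The vector field is extended from a ball to the whole space through the nearest point projection.\<close>

lemma Picard_Lindelof:
  fixes F :: "'a::euclidean_space \<Rightarrow> 'a"
  assumes F: "smooth_on F U" and U: "open U" "u0 \<in> U"
  obtains e u where "e > 0" "u 0 = u0" "\<And>t. t \<in> {-e<..<e} \<Longrightarrow> u t \<in> U"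
    "\<And>t. t \<in> {-e<..<e} \<Longrightarrow> (u has_vector_derivative F (u t)) (at t)"
proof -
  obtain r where r: "r > 0" "cball u0 r \<subseteq> U" using U open_contains_cball by blast
  obtain K where K: "K \<ge> 0" "\<And>x y. x \<in> cball u0 r \<Longrightarrow> y \<in> cball u0 r \<Longrightarrow> norm (F x - F y) \<le> K * norm (x - y)"
    using smooth_on_Lipschitz_cball[OF F r(2)] by metis
  have "bounded (F ` cball u0 r)"
    using smooth_on_continuous[OF F] r(2) compact_continuous_image compact_imp_bounded compact_cball continuous_on_subset by metis
  then obtain M where M: "M > 0" "\<And>x. x \<in> cball u0 r \<Longrightarrow> norm (F x) \<le> M" unfolding bounded_pos by auto
  define pr where "pr = closest_point (cball u0 r)"
  have pr: "pr x \<in> cball u0 r" for x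
    unfolding pr_def using r(1) by (intro closest_point_in_set) auto
  have prl: "norm (pr x - pr y) \<le> norm (x - y)" for x y
    using closest_point_lipschitz[of "cball u0 r" x y] r(1) by (simp add: pr_def dist_norm less_imp_le)
  define e where "e = min (1 / (6 * (K + 1))) (r / (3 * M))"
  have e: "e > 0" using K(1) M r by (simp add: e_def)
  have "e \<le> 1 / (6 * (K + 1))" by (simp add: e_def)
  then have "e * (6 * (K + 1)) \<le> 1" using K(1) by (simp add: pos_le_divide_eq)
  then have e1: "3 * e * K \<le> 1/2" using e by (simp add: algebra_simps)
  have "e \<le> r / (3 * M)" by (simp add: e_def)
  then have e2: "3 * e * M \<le> r" using M(1) by (simp add: field_simps)
  have "norm (F (pr x) - F (pr y)) \<le> K * norm (x - y)" for x y
    using K(2)[OF pr pr, of x y] prl[of x y] K(1) by (meson mult_left_mono order_trans)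
  from Picard_Lindelof_Lipschitz[of "\<lambda>x. F (pr x)", OF this M(2)[OF pr] e e1]
  obtain u where u: "u 0 = u0" "\<And>t. t \<in> {-e<..<e} \<Longrightarrow> (u has_vector_derivative F (pr (u t))) (at t)"
    "\<And>t. norm (u t - u0) \<le> 3 * e * M" by metis
  have ub: "u t \<in> cball u0 r" for t using order_trans[OF u(3) e2] by (simp add: dist_norm norm_minus_commute)
  then have "pr (u t) = u t" for t unfolding pr_def by (rule closest_point_self)
  then show thesis using that[of e u] e u(1,2) subsetD[OF r(2) ub] by simp
qed

lemma smooth_on_vector_derivative:
  fixes u :: "real \<Rightarrow> 'a::euclidean_space"
  assumes "open I" "\<And>t. t \<in> I \<Longrightarrow> (u has_vector_derivative u' t) (at t)" "smooth_on u' I"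
  shows "smooth_on u I"
  unfolding smooth_on_def
proof
  fix k
  have "Ck_on (Suc k) u I" for k
  proof (rule Ck_on_SucI[OF assms(1)])
    show "(u has_derivative (\<lambda>r. r *\<^sub>R u' t)) (at t)" if "t \<in> I" for t
      using assms(2)[OF that] by (simp add: has_vector_derivative_def)
    show "Ck_on k (\<lambda>t. r *\<^sub>R u' t) I" for r
      using smooth_on_scaleR[OF smooth_on_const assms(3,1), of r] unfolding smooth_on_def by blast
  qed
  then show "Ck_on k u I" using Ck_on_SucD by blast
qed

text \<open>Each differentiability class of \<open>u\<close> passes to \<open>F (u t)\<close> and thus gains one derivative.\<close>

lemma smooth_on_ODE_solution:
  fixes u :: "real \<Rightarrow> 'a::euclidean_space"
  assumes F: "smooth_on F U" "open U" and I: "open I"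
    and u: "\<And>t. t \<in> I \<Longrightarrow> u t \<in> U" "\<And>t. t \<in> I \<Longrightarrow> (u has_vector_derivative F (u t)) (at t)"
  shows "smooth_on u I"
  unfolding smooth_on_def
proof
  fix k show "Ck_on k u I"
  proof (induction k)
    case 0
    have "continuous (at t) u" if "t \<in> I" for t using u(2)[OF that] has_vector_derivative_continuous by blast
    then show ?case by (simp add: continuous_at_imp_continuous_on)
  next
    case (Suc k)
    show ?case
    proof (rule Ck_on_SucI[OF I])
      show "(u has_derivative (\<lambda>r. r *\<^sub>R F (u t))) (at t)" if "t \<in> I" for t
        using u(2)[OF that] by (simp add: has_vector_derivative_def)
      have "Ck_on k (\<lambda>t. F (u t)) I"
        using Ck_on_compose[OF Suc, of F U] F I u(1) unfolding smooth_on_def by blast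
      then show "Ck_on k (\<lambda>t. r *\<^sub>R F (u t)) I" for r
        by (intro Ck_on_bilinear[OF bounded_bilinear_scaleR] Ck_on_const I)
    qed
  qed
qed

lemma smooth_on_exp: "smooth_on a I \<Longrightarrow> open I \<Longrightarrow> smooth_on (\<lambda>t. exp (a t)) I" for a :: "real \<Rightarrow> real"
proof -
  assume a: "smooth_on a I" "open I"
  have "smooth_on (exp :: real \<Rightarrow> real) UNIV"
    by (rule smooth_on_ODE_solution[where F = "\<lambda>x. x" and U = UNIV])
       (auto intro: smooth_on_ident DERIV_exp simp: has_real_derivative_iff_has_vector_derivative[symmetric])
  then show ?thesis using smooth_on_compose[OF a(1), of exp UNIV] a(2) by auto
qed

lemma open_interval_antiderivative:
  fixes a :: "real \<Rightarrow> real"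
  assumes I: "open_interval I" and a: "smooth_on a I"
  obtains b where "smooth_on b I" "\<And>t. t \<in> I \<Longrightarrow> (b has_real_derivative a t) (at t)"
proof -
  note oi = I[unfolded open_interval_def]
  let ?l = "Inf (ereal ` I)" and ?r = "Sup (ereal ` I)"
  have sides: "\<exists>x\<in>I. x < t" "\<exists>x\<in>I. t < x" if t: "t \<in> I" for t
  proof -
    obtain e where e: "e > 0" "cball t e \<subseteq> I" using oi t open_contains_cball by blast
    have "t - e \<in> I" "t + e \<in> I" using e by (auto simp: dist_real_def subset_iff)
    then show "\<exists>x\<in>I. x < t" "\<exists>x\<in>I. t < x" using e(1) by (metis diff_less_eq less_add_same_cancel1, metis less_add_same_cancel1)
  qed
  have mem: "t \<in> I \<longleftrightarrow> ?l < ereal t \<and> ereal t < ?r" for t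
  proof
    assume "t \<in> I"
    from sides[OF this] show "?l < ereal t \<and> ereal t < ?r"
      unfolding Inf_less_iff less_Sup_iff by auto
  next
    assume "?l < ereal t \<and> ereal t < ?r"
    then obtain x z where "x \<in> I" "x < t" "z \<in> I" "t < z" unfolding Inf_less_iff less_Sup_iff by auto
    then show "t \<in> I" using oi unfolding is_interval_1 by (meson less_imp_le)
  qed
  obtain t0 where "t0 \<in> I" using oi by blast
  then have "?l < ?r" using mem[of t0] by (meson less_trans)
  moreover have "isCont a t" if "?l < ereal t" "ereal t < ?r" for t
    using smooth_on_continuous[OF a] oi mem that continuous_on_eq_continuous_at by blast
  ultimately obtain b where "\<And>t. ?l < ereal t \<Longrightarrow> ereal t < ?r \<Longrightarrow> (b has_vector_derivative a t) (at t)"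
    using einterval_antiderivative by blast
  then have b: "(b has_vector_derivative a t) (at t)" if "t \<in> I" for t using mem that by blast
  moreover have "smooth_on b I" using oi by (intro smooth_on_vector_derivative[OF _ b a]) auto
  ultimately show thesis using that by (simp add: has_real_derivative_iff_has_vector_derivative)
qed

text \<open>The equation \<open>\<psi>'' = - a(\<psi>) \<psi>'\<^sup>2\<close> is solved through the inverse \<open>\<tau>\<close> of \<open>\<psi>\<close>, for
  which it reads \<open>\<tau>'' = a \<tau>'\<close>; this linear equation has a solution on all of \<open>I\<close>.\<close>

lemma damped_reparametrisation:
  fixes a :: "real \<Rightarrow> real"
  assumes I: "open_interval I" and a: "smooth_on a I"
  obtains J \<psi> where "open_interval J" "smooth_on \<psi> J" "\<psi> ` J = I" "\<And>s. s \<in> J \<Longrightarrow> deriv \<psi> s > 0"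
    "\<And>s. s \<in> J \<Longrightarrow> (deriv \<psi> has_real_derivative - (a (\<psi> s) * (deriv \<psi> s)\<^sup>2)) (at s)"
proof -
  note oi = I[unfolded open_interval_def]
  have opI: "open I" using oi by blast
  obtain b where b: "smooth_on b I" "\<And>t. t \<in> I \<Longrightarrow> (b has_real_derivative a t) (at t)"
    using open_interval_antiderivative[OF I a] by blast
  obtain \<tau> where \<tau>: "smooth_on \<tau> I" "\<And>t. t \<in> I \<Longrightarrow> (\<tau> has_real_derivative exp (b t)) (at t)"
    using open_interval_antiderivative[OF I smooth_on_exp[OF b(1) opI]] by blast
  have less: "\<tau> s < \<tau> t" if "s \<in> I" "t \<in> I" "s < t" for s t
  proof (rule DERIV_pos_imp_increasing[OF that(3)])
    fix x assume "s \<le> x" "x \<le> t"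
    then have "x \<in> I" using oi that unfolding is_interval_1 by blast
    then show "\<exists>y. (\<tau> has_real_derivative y) (at x) \<and> y > 0" using \<tau>(2) exp_gt_zero by blast
  qed
  have inj: "inj_on \<tau> I" using less by (metis inj_onI linorder_neqE_linordered_idom order_less_irrefl)
  define J where "J = \<tau> ` I"
  define \<psi> where "\<psi> = inv_into I \<tau>"
  have \<psi>: "\<psi> (\<tau> t) = t" if "t \<in> I" for t unfolding \<psi>_def by (rule inv_into_f_f[OF inj that])
  have opJ: "open J" unfolding J_def by (rule invariance_of_domain[OF smooth_on_continuous[OF \<tau>(1)] opI inj])
  have "connected J" unfolding J_def
    using connected_continuous_image[OF smooth_on_continuous[OF \<tau>(1)]] oi is_interval_connected_1 by blast
  then have J: "open_interval J" unfolding open_interval_def using opJ oi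
    by (auto simp: is_interval_connected_1 J_def)
  have im: "\<psi> ` J = I" unfolding J_def image_image using \<psi> by simp
  have d: "(\<psi> has_real_derivative exp (- b (\<psi> s))) (at s)" if s: "s \<in> J" for s
  proof -
    obtain t where t: "t \<in> I" "s = \<tau> t" using s unfolding J_def by blast
    have "(\<psi> has_derivative (*) (exp (- b t))) (at (\<tau> t))"
    proof (rule has_derivative_inverse_strong[OF opI t(1) smooth_on_continuous[OF \<tau>(1)] \<psi>])
      show "(\<tau> has_derivative (*) (exp (b t))) (at t)" using \<tau>(2)[OF t(1)] by (simp add: has_field_derivative_def)
      show "(*) (exp (b t)) \<circ> (*) (exp (- b t)) = id" by (simp add: fun_eq_iff mult.assoc[symmetric] exp_add[symmetric])
    qed
    then show ?thesis using t \<psi> by (simp add: has_field_derivative_def)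
  qed
  have sm: "smooth_on (\<lambda>t. exp (- b t)) I" by (intro smooth_on_exp smooth_on_minus b(1) opI)
  have "smooth_on \<psi> J"
    by (rule smooth_on_ODE_solution[OF sm opI opJ])
       (use im d in \<open>auto simp: has_real_derivative_iff_has_vector_derivative[symmetric]\<close>)
  moreover have dd: "deriv \<psi> s = exp (- b (\<psi> s))" if "s \<in> J" for s using DERIV_imp_deriv[OF d[OF that]] .
  moreover have "(deriv \<psi> has_real_derivative - (a (\<psi> s) * (deriv \<psi> s)\<^sup>2)) (at s)" if s: "s \<in> J" for s
  proof -
    have "((\<lambda>s. b (\<psi> s)) has_real_derivative a (\<psi> s) * exp (- b (\<psi> s))) (at s)"
      using DERIV_chain2[OF b(2) d[OF s]] s im by blast
    then have "((\<lambda>s. exp (- b (\<psi> s))) has_real_derivative exp (- b (\<psi> s)) * - (a (\<psi> s) * exp (- b (\<psi> s)))) (at s)"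
      by (auto intro!: derivative_eq_intros)
    then have "(deriv \<psi> has_real_derivative exp (- b (\<psi> s)) * - (a (\<psi> s) * exp (- b (\<psi> s)))) (at s)"
      by (rule has_field_derivative_transform_within_open[OF _ opJ s]) (simp add: dd)
    then show ?thesis by (simp add: dd[OF s] power2_eq_square mult_ac)
  qed
  ultimately show thesis using that J im by simp
qed

section \<open>Geodesics\<close>

lemma Ck_on_local:
  assumes "\<And>x. x \<in> S \<Longrightarrow> \<exists>T. x \<in> T \<and> open T \<and> Ck_on k f T"
  shows "Ck_on k f S"
  using assms
proof (induction k arbitrary: f)
  case 0
  have "continuous (at x) f" if "x \<in> S" for x
    using 0[OF that] continuous_on_eq_continuous_at by auto
  then show ?case by (simp add: continuous_at_imp_continuous_on)
next
  case (Suc k)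
  have "f differentiable (at x)" if "x \<in> S" for x using Suc.prems[OF that] by auto
  moreover have "Ck_on k (\<lambda>x. frechet_derivative f (at x) v) S" for v
  proof (rule Suc.IH)
    fix x assume "x \<in> S"
    from Suc.prems[OF this] show "\<exists>T. x \<in> T \<and> open T \<and> Ck_on k (\<lambda>x. frechet_derivative f (at x) v) T" by auto
  qed
  ultimately show ?case by simp
qed

lemma smooth_on_local:
  assumes "\<And>x. x \<in> S \<Longrightarrow> \<exists>T. x \<in> T \<and> open T \<and> smooth_on f T"
  shows "smooth_on f S"
  unfolding smooth_on_def
proof
  fix k show "Ck_on k f S"
  proof (rule Ck_on_local)
    fix x assume "x \<in> S"
    from assms[OF this] show "\<exists>T. x \<in> T \<and> open T \<and> Ck_on k f T" unfolding smooth_on_def by blast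
  qed
qed

lemma smooth_on_has_vector_derivative:
  fixes f :: "real \<Rightarrow> 'a::euclidean_space"
  assumes "smooth_on f S" "t \<in> S"
  shows "(f has_vector_derivative vector_derivative f (at t)) (at t)"
  using smooth_on_differentiable[OF assms] vector_derivative_works
  by (metis differentiable_def frechet_derivative_works has_vector_derivative_def has_derivative_scaleR_right vector_derivative_works frechet_derivative_eq_vector_derivative)

lemma smooth_on_vector_derivative':
  fixes f :: "real \<Rightarrow> 'a::euclidean_space"
  assumes "smooth_on f S" "open S"
  shows "smooth_on (\<lambda>t. vector_derivative f (at t)) S"
proof (rule smooth_on_cong[OF smooth_on_frechet[OF assms(1), of 1] assms(2)])
  fix t assume "t \<in> S"
  then show "frechet_derivative f (at t) 1 = vector_derivative f (at t)"
    using smooth_on_differentiable[OF assms(1)] by (simp add: frechet_derivative_eq_vector_derivative)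
qed

lemma smooth_on_DERIV:
  fixes f :: "real \<Rightarrow> real"
  assumes "smooth_on f S" "open S"
  shows "smooth_on (deriv f) S" "t \<in> S \<Longrightarrow> (f has_real_derivative deriv f t) (at t)"
proof -
  have d: "(f has_real_derivative vector_derivative f (at t)) (at t)" if "t \<in> S" for t
    using smooth_on_has_vector_derivative[OF assms(1) that] by (simp add: has_real_derivative_iff_has_vector_derivative)
  then show "t \<in> S \<Longrightarrow> (f has_real_derivative deriv f t) (at t)" using DERIV_imp_deriv by metis
  show "smooth_on (deriv f) S"
    by (rule smooth_on_cong[OF smooth_on_vector_derivative'[OF assms] assms(2)]) (use DERIV_imp_deriv[OF d] in auto)
qed

context conic_manifold
begin

definition chart_times :: "real set \<Rightarrow> (real \<Rightarrow> 'm) \<Rightarrow> ('m, 'n) chart \<Rightarrow> real set" where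
  "chart_times I \<gamma> c = {t \<in> I. \<gamma> t \<in> cdom c}"

lemma open_chart_times:
  assumes "open I" "continuous_on I \<gamma>" "c \<in> C" shows "open (chart_times I \<gamma> c)"
proof -
  have "open (I \<inter> \<gamma> -` cdom c)" using continuous_open_preimage[OF assms(2,1) chartD(1)[OF assms(3)]] .
  then show ?thesis by (simp add: chart_times_def Int_def vimage_def)
qed

lemma smooth_curveD:
  assumes "smooth_curve C I \<gamma>" "c \<in> C"
  shows "open I" "continuous_on I \<gamma>" "open (chart_times I \<gamma> c)" "smooth_on (cmap c \<circ> \<gamma>) (chart_times I \<gamma> c)"
proof -
  show I: "open I" "continuous_on I \<gamma>" "smooth_on (cmap c \<circ> \<gamma>) (chart_times I \<gamma> c)"
    using assms unfolding smooth_curve_def open_interval_def chart_times_def by auto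
  show "open (chart_times I \<gamma> c)" by (rule open_chart_times[OF I(1,2) assms(2)])
qed

lemma velocity_comp:
  "c \<in> C \<Longrightarrow> \<gamma> t \<in> cdom c \<Longrightarrow> snd (velocity C \<gamma> t) c = vector_derivative (cmap c \<circ> \<gamma>) (at t)"
  by (simp add: velocity_def)

lemma fst_velocity [simp]: "fst (velocity C \<gamma> t) = \<gamma> t"
  by (simp add: velocity_def)

lemma has_velocity:
  assumes "smooth_curve C I \<gamma>" "c \<in> C" "t \<in> chart_times I \<gamma> c"
  shows "(cmap c \<circ> \<gamma> has_vector_derivative snd (velocity C \<gamma> t) c) (at t)"
  using smooth_on_has_vector_derivative[OF smooth_curveD(4)[OF assms(1,2)] assms(3)] assms
  by (simp add: velocity_comp chart_times_def)

lemma smooth_velocity: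
  assumes "smooth_curve C I \<gamma>" "c \<in> C"
  shows "smooth_on (\<lambda>t. snd (velocity C \<gamma> t) c) (chart_times I \<gamma> c)"
  by (rule smooth_on_cong[OF smooth_on_vector_derivative'[OF smooth_curveD(4)[OF assms]] smooth_curveD(3)[OF assms]])
     (use smooth_curveD(3)[OF assms] assms in \<open>auto simp: velocity_comp chart_times_def\<close>)

lemma velocity_has_deriv:
  assumes "smooth_curve C I \<gamma>" "c \<in> C" "t \<in> chart_times I \<gamma> c"
  shows "((\<lambda>s. snd (velocity C \<gamma> s) c $ k) has_real_derivative deriv (\<lambda>s. snd (velocity C \<gamma> s) c $ k) t) (at t)"
  by (rule smooth_on_DERIV(2)[OF smooth_on_vec_nth[OF smooth_velocity[OF assms(1,2)]] _ assms(3)])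
     (rule smooth_curveD(3)[OF assms(1,2)])+

lemma DERIV_along_curve:
  assumes g: "smooth_on g U" "open U" "cmap c (\<gamma> t) \<in> U"
    and \<gamma>: "smooth_curve C I \<gamma>" "c \<in> C" "t \<in> chart_times I \<gamma> c"
  shows "((\<lambda>s. g (cmap c (\<gamma> s))) has_vector_derivative frechet_derivative g (at (cmap c (\<gamma> t))) (snd (velocity C \<gamma> t) c)) (at t)"
proof -
  let ?D = "frechet_derivative g (at (cmap c (\<gamma> t)))"
  have D: "(g has_derivative ?D) (at (cmap c (\<gamma> t)))" by (rule smooth_on_has_derivative[OF g(1,3)])
  have "((\<lambda>s. cmap c (\<gamma> s)) has_derivative (\<lambda>r. r *\<^sub>R snd (velocity C \<gamma> t) c)) (at t)"
    using has_velocity[OF \<gamma>] by (simp add: has_vector_derivative_def o_def)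
  from diff_chain_at[OF this D] show ?thesis
    by (simp add: has_vector_derivative_def o_def linear_scale[OF has_derivative_linear[OF D]])
qed

lemma velocity_TM:
  assumes \<gamma>: "smooth_curve C I \<gamma>" "t \<in> I"
  shows "velocity C \<gamma> t \<in> TM C"
proof -
  have "snd (velocity C \<gamma> t) c' $ k = (\<Sum>a\<in>UNIV. jac c c' (cmap c (\<gamma> t)) k a * snd (velocity C \<gamma> t) c $ a)"
    if c: "c \<in> C" "c' \<in> C" "\<gamma> t \<in> cdom c" "\<gamma> t \<in> cdom c'" for c c' k
  proof -
    have t: "t \<in> chart_times I \<gamma> c" "t \<in> chart_times I \<gamma> c'" using c \<gamma>(2) by (auto simp: chart_times_def)
    have x: "cmap c (\<gamma> t) \<in> overlap c c'" using c by (auto simp: overlap_def)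
    let ?T = "chart_times I \<gamma> c \<inter> chart_times I \<gamma> c'"
    have "open ?T" using smooth_curveD(3)[OF \<gamma>(1)] c by blast
    have "((\<lambda>s. transition c c' (cmap c (\<gamma> s))) has_vector_derivative
        frechet_derivative (transition c c') (at (cmap c (\<gamma> t))) (snd (velocity C \<gamma> t) c)) (at t)"
      by (rule DERIV_along_curve[OF smooth_transition[OF c(1,2)] open_overlap[OF c(1,2)] x \<gamma>(1) c(1) t(1)])
    then have "(cmap c' \<circ> \<gamma> has_vector_derivative
        frechet_derivative (transition c c') (at (cmap c (\<gamma> t))) (snd (velocity C \<gamma> t) c)) (at t)"
      by (rule has_vector_derivative_transform_within_open[OF _ \<open>open ?T\<close>])
         (use t c in \<open>auto simp: chart_times_def transition_cmap\<close>)
    then have "snd (velocity C \<gamma> t) c' = frechet_derivative (transition c c') (at (cmap c (\<gamma> t))) (snd (velocity C \<gamma> t) c)"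
      by (rule vector_derivative_unique_at[OF has_velocity[OF \<gamma>(1) c(2) t(2)]])
    then show ?thesis by (simp add: frechet_transition[OF c(1,2) x])
  qed
  moreover have "snd (velocity C \<gamma> t) c = 0" if "\<not> (c \<in> C \<and> \<gamma> t \<in> cdom c)" for c
    using that by (auto simp: velocity_def)
  ultimately show ?thesis unfolding TM_def by (simp only: case_prod_beta mem_Collect_eq fst_velocity) blast
qed

text \<open>The left-hand side of the geodesic equation.\<close>

definition defect :: "('m, 'n) fam2 \<Rightarrow> (real \<Rightarrow> 'm) \<Rightarrow> ('m, 'n) chart \<Rightarrow> real \<Rightarrow> 'n \<Rightarrow> real" where
  "defect N \<gamma> c t k = deriv (\<lambda>s. snd (velocity C \<gamma> s) c $ k) t +
     (\<Sum>a\<in>UNIV. N c a k (tcoord c (velocity C \<gamma> t)) * snd (velocity C \<gamma> t) c $ a)"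

lemma geodesic_iff:
  "geodesic C A N I \<gamma> \<longleftrightarrow> smooth_curve C I \<gamma> \<and> (\<forall>t\<in>I. velocity C \<gamma> t \<in> A) \<and>
     (\<forall>c\<in>C. \<forall>t\<in>I. \<gamma> t \<in> cdom c \<longrightarrow> (\<forall>k. defect N \<gamma> c t k = 0))"
  unfolding geodesic_def defect_def ..

text \<open>The inhomogeneous term in the transformation law of a nonlinear connection is what makes the
  left-hand side of the geodesic equation a vector.\<close>

lemma defect_transform:
  assumes N: "nonlinear_connection C A N" and \<gamma>: "smooth_curve C I \<gamma>" "t \<in> I" "velocity C \<gamma> t \<in> A"
    and c: "c \<in> C" "c' \<in> C" "\<gamma> t \<in> cdom c" "\<gamma> t \<in> cdom c'"
  shows "defect N \<gamma> c' t k = (\<Sum>d\<in>UNIV. jac c c' (cmap c (\<gamma> t)) k d * defect N \<gamma> c t d)"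
proof -
  let ?y = "\<lambda>t. snd (velocity C \<gamma> t) c" and ?y' = "\<lambda>t. snd (velocity C \<gamma> t) c'"
  let ?j = "jac c c' (cmap c (\<gamma> t))" and ?j' = "\<lambda>t. jac c' c (cmap c' (\<gamma> t))"
  let ?h' = "hess c' c (cmap c' (\<gamma> t))"
  define H where "H d = (\<Sum>i\<in>UNIV. \<Sum>b\<in>UNIV. ?h' d i b * ?y' t $ b * ?y' t $ i)" for d
  have t: "t \<in> chart_times I \<gamma> c" "t \<in> chart_times I \<gamma> c'" using c \<gamma>(2) by (auto simp: chart_times_def)
  have x: "cmap c' (\<gamma> t) \<in> overlap c' c" using c by (auto simp: overlap_def)
  let ?T = "chart_times I \<gamma> c \<inter> chart_times I \<gamma> c'"
  have oT: "open ?T" using smooth_curveD(3)[OF \<gamma>(1)] c by blast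
  have dj: "((\<lambda>s. ?j' s d i) has_real_derivative (\<Sum>b\<in>UNIV. ?h' d i b * ?y' t $ b)) (at t)" for d i
  proof -
    let ?g = "\<lambda>z. jac c' c z d i"
    have l: "linear (frechet_derivative ?g (at (cmap c' (\<gamma> t))))"
      by (rule has_derivative_linear[OF smooth_on_has_derivative[OF smooth_jac[OF c(2,1)] x]])
    have "frechet_derivative ?g (at (cmap c' (\<gamma> t))) (?y' t) =
        frechet_derivative ?g (at (cmap c' (\<gamma> t))) (\<Sum>b\<in>UNIV. ?y' t $ b *\<^sub>R axis b 1)"
      by (simp only: basis_expansion scalar_mult_eq_scaleR[symmetric])
    also have "\<dots> = (\<Sum>b\<in>UNIV. ?h' d i b * ?y' t $ b)"
      by (simp add: linear_sum[OF l] linear_scale[OF l] hess_def mult.commute)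
    finally show ?thesis
      using DERIV_along_curve[OF smooth_jac[OF c(2,1)] open_overlap[OF c(2,1)] x \<gamma>(1) c(2) t(2), of d i]
      by (simp add: has_real_derivative_iff_has_vector_derivative)
  qed
  have "deriv (\<lambda>s. ?y s $ d) t = H d + (\<Sum>i\<in>UNIV. ?j' t d i * deriv (\<lambda>s. ?y' s $ i) t)" for d
  proof -
    have "((\<lambda>s. \<Sum>i\<in>UNIV. ?j' s d i * ?y' s $ i) has_real_derivative
        (\<Sum>i\<in>UNIV. (\<Sum>b\<in>UNIV. ?h' d i b * ?y' t $ b) * ?y' t $ i + deriv (\<lambda>s. ?y' s $ i) t * ?j' t d i)) (at t)"
      by (intro DERIV_sum DERIV_mult dj velocity_has_deriv[OF \<gamma>(1) c(2) t(2)])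
    then have "((\<lambda>s. ?y s $ d) has_real_derivative
        (\<Sum>i\<in>UNIV. (\<Sum>b\<in>UNIV. ?h' d i b * ?y' t $ b) * ?y' t $ i + deriv (\<lambda>s. ?y' s $ i) t * ?j' t d i)) (at t)"
    proof (rule has_field_derivative_transform_within_open[OF _ oT])
      fix s assume s: "s \<in> ?T"
      then have "velocity C \<gamma> s \<in> TM C" using velocity_TM[OF \<gamma>(1)] by (auto simp: chart_times_def)
      from TM_law[OF this c(2,1), of d] s show "(\<Sum>i\<in>UNIV. ?j' s d i * ?y' s $ i) = ?y s $ d"
        by (simp add: chart_times_def)
    qed (use t in auto)
    from DERIV_imp_deriv[OF this] show ?thesis
      by (simp add: H_def sum.distrib sum_distrib_right sum_distrib_left mult_ac)
  qed
  then have "(\<Sum>d\<in>UNIV. ?j k d * deriv (\<lambda>s. ?y s $ d) t) =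
      (\<Sum>d\<in>UNIV. ?j k d * H d) + (\<Sum>d\<in>UNIV. \<Sum>i\<in>UNIV. ?j k d * ?j' t d i * deriv (\<lambda>s. ?y' s $ i) t)"
    by (simp add: distrib_left sum.distrib sum_distrib_left mult.assoc)
  also have "(\<Sum>d\<in>UNIV. \<Sum>i\<in>UNIV. ?j k d * ?j' t d i * deriv (\<lambda>s. ?y' s $ i) t) =
      (\<Sum>i\<in>UNIV. (\<Sum>d\<in>UNIV. ?j k d * ?j' t d i) * deriv (\<lambda>s. ?y' s $ i) t)"
    by (subst sum.swap) (simp add: sum_distrib_right)
  also have "\<dots> = deriv (\<lambda>s. ?y' s $ k) t" by (simp only: jac_inverse[OF c] sum_kronecker)
  finally have acc: "deriv (\<lambda>s. ?y' s $ k) t = (\<Sum>d\<in>UNIV. ?j k d * deriv (\<lambda>s. ?y s $ d) t) - (\<Sum>d\<in>UNIV. ?j k d * H d)"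
    by simp
  let ?N = "\<lambda>a d. N c a d (tcoord c (velocity C \<gamma> t))"
  have law: "N c' i k (tcoord c' (velocity C \<gamma> t)) = (\<Sum>d\<in>UNIV. \<Sum>b\<in>UNIV. ?j k d * ?h' d i b * ?y' t $ b) +
      (\<Sum>d\<in>UNIV. \<Sum>a\<in>UNIV. ?j k d * ?j' t a i * ?N a d)" for i
    using connectionD(3)[OF N c(1,2) \<gamma>(3), of i k] c by simp
  have "(\<Sum>i\<in>UNIV. N c' i k (tcoord c' (velocity C \<gamma> t)) * ?y' t $ i) =
     (\<Sum>i\<in>UNIV. \<Sum>d\<in>UNIV. ?j k d * (\<Sum>b\<in>UNIV. ?h' d i b * ?y' t $ b * ?y' t $ i)) +
     (\<Sum>i\<in>UNIV. \<Sum>d\<in>UNIV. ?j k d * (\<Sum>a\<in>UNIV. ?N a d * (?j' t a i * ?y' t $ i)))"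
    by (simp only: law distrib_right sum.distrib) (simp only: sum_distrib_right sum_distrib_left mult_ac)
  also have "(\<Sum>i\<in>UNIV. \<Sum>d\<in>UNIV. ?j k d * (\<Sum>b\<in>UNIV. ?h' d i b * ?y' t $ b * ?y' t $ i)) = (\<Sum>d\<in>UNIV. ?j k d * H d)"
    by (subst sum.swap) (simp add: H_def sum_distrib_left)
  also have "(\<Sum>i\<in>UNIV. \<Sum>d\<in>UNIV. ?j k d * (\<Sum>a\<in>UNIV. ?N a d * (?j' t a i * ?y' t $ i))) =
      (\<Sum>d\<in>UNIV. ?j k d * (\<Sum>i\<in>UNIV. \<Sum>a\<in>UNIV. ?N a d * (?j' t a i * ?y' t $ i)))"
    by (subst sum.swap) (simp only: sum_distrib_left)
  also have "\<dots> = (\<Sum>d\<in>UNIV. ?j k d * (\<Sum>a\<in>UNIV. ?N a d * ?y t $ a))"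
  proof -
    have "(\<Sum>i\<in>UNIV. ?j' t a i * ?y' t $ i) = ?y t $ a" for a
      using TM_law[OF A_TM[OF \<gamma>(3)] c(2,1), of a] c by simp
    then have "(\<Sum>i\<in>UNIV. \<Sum>a\<in>UNIV. ?N a d * (?j' t a i * ?y' t $ i)) = (\<Sum>a\<in>UNIV. ?N a d * ?y t $ a)" for d
      by (subst sum.swap) (simp only: sum_distrib_left[symmetric])
    then show ?thesis by (simp only:)
  qed
  finally show ?thesis unfolding defect_def acc by (simp add: distrib_left sum.distrib)
qed

text \<open>The geodesic equation is solved as a first order system for \<open>(x, y)\<close> in one chart;
  \<open>defect_transform\<close> carries it to all others.\<close>

lemma geodesic_exists:
  assumes N: "nonlinear_connection C A N" and v: "v \<in> A"
  obtains I \<gamma> where "geodesic C A N I \<gamma>" "0 \<in> I" "velocity C \<gamma> 0 = v"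
proof -
  obtain c where c: "c \<in> C" "fst v \<in> cdom c" using charts_cover by blast
  interpret conic_region "adom A c" by (rule conic_region_adom[OF c(1)])
  define F where "F p = (snd p, - (\<chi> k. \<Sum>a\<in>UNIV. N c a k p * snd p $ a))" for p
  have "smooth_on (\<lambda>p. \<chi> k. \<Sum>a\<in>UNIV. N c a k p * snd p $ a) (adom A c)"
    using smooth_homD[OF connectionD(1)[OF N c(1)]] by (intro smooth_on_vecI open_S) (simp add: smooth_intros)
  then have F: "smooth_on F (adom A c)"
    unfolding F_def by (intro smooth_on_Pair smooth_on_minus smooth_on_snd smooth_on_ident open_S)
  obtain e u where e: "e > 0" and u: "u 0 = tcoord c v" "\<And>t. t \<in> {-e<..<e} \<Longrightarrow> u t \<in> adom A c"
    "\<And>t. t \<in> {-e<..<e} \<Longrightarrow> (u has_vector_derivative F (u t)) (at t)"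
    using Picard_Lindelof[OF F open_S adomI[OF v c(2)]] by metis
  define I where "I = {-e<..<e}"
  have oI: "open I" unfolding I_def by simp
  note u' = u(2,3)[folded I_def]
  have su: "smooth_on u I" by (rule smooth_on_ODE_solution[OF F open_S oI u'])
  have sx: "smooth_on (\<lambda>t. fst (u t)) I" by (rule smooth_on_fst[OF su oI])
  define \<gamma> where "\<gamma> t = cinv c (fst (u t))" for t
  have "\<exists>w\<in>A. fst w \<in> cdom c \<and> u t = tcoord c w" if "t \<in> I" for t using u'(1)[OF that] adomE by blast
  then obtain w where w: "\<And>t. t \<in> I \<Longrightarrow> w t \<in> A" "\<And>t. t \<in> I \<Longrightarrow> fst (w t) \<in> cdom c" "\<And>t. t \<in> I \<Longrightarrow> u t = tcoord c (w t)"
    by metis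
  have g: "\<gamma> t = fst (w t)" "cmap c (\<gamma> t) = fst (u t)" if "t \<in> I" for t
    using w[OF that] by (simp_all add: \<gamma>_def tcoord_def cinv_cmap[OF c(1)])
  have gc: "\<gamma> t \<in> cdom c" if "t \<in> I" for t using g(1) w(2) that by simp
  have "continuous_on (cmap c ` cdom c) (cinv c)" using chartD(3)[OF c(1)] by (simp add: homeomorphism_def)
  then have cont: "continuous_on I \<gamma>" unfolding \<gamma>_def
  proof (rule continuous_on_compose2[OF _ smooth_on_continuous[OF sx]], intro image_subsetI)
    fix t assume "t \<in> I"
    from imageI[OF gc[OF this], of "cmap c"] g(2)[OF this] show "fst (u t) \<in> cmap c ` cdom c" by simp
  qed
  have "smooth_on (cmap c' \<circ> \<gamma>) (chart_times I \<gamma> c')" if c': "c' \<in> C" for c'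
  proof -
    have o: "open (chart_times I \<gamma> c')" by (rule open_chart_times[OF oI cont c'])
    have "smooth_on (\<lambda>t. transition c c' (fst (u t))) (chart_times I \<gamma> c')"
    proof (rule smooth_on_compose[OF _ smooth_transition[OF c(1) c'] _ o open_overlap[OF c(1) c']])
      show "smooth_on (\<lambda>t. fst (u t)) (chart_times I \<gamma> c')" by (rule smooth_on_subset[OF sx]) (auto simp: chart_times_def)
      show "(\<lambda>t. fst (u t)) ` chart_times I \<gamma> c' \<subseteq> overlap c c'"
      proof (rule image_subsetI)
        fix t assume t: "t \<in> chart_times I \<gamma> c'"
        then have "\<gamma> t \<in> cdom c \<inter> cdom c'" using gc by (auto simp: chart_times_def)
        from imageI[OF this, of "cmap c"] show "fst (u t) \<in> overlap c c'"
          using t g(2)[of t] by (simp add: overlap_def chart_times_def)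
      qed
    qed
    then show ?thesis by (rule smooth_on_cong[OF _ o]) (simp add: transition_def \<gamma>_def)
  qed
  then have \<gamma>: "smooth_curve C I \<gamma>"
    unfolding smooth_curve_def open_interval_def chart_times_def[symmetric]
    using e cont by (auto simp: I_def is_interval_1)
  have vel: "snd (velocity C \<gamma> t) c = snd (u t)" if t: "t \<in> I" for t
  proof -
    have "((\<lambda>t. fst (u t)) has_vector_derivative fst (F (u t))) (at t)"
      using bounded_linear.has_vector_derivative[OF bounded_linear_fst u'(2)[OF t]] .
    then have "(cmap c \<circ> \<gamma> has_vector_derivative snd (u t)) (at t)"
      by (rule has_vector_derivative_transform_within_open[OF _ oI t, THEN back_subst[of "\<lambda>z. (cmap c \<circ> \<gamma> has_vector_derivative z) (at t)"]])
         (simp_all add: F_def g(2))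
    then show ?thesis using velocity_comp[of c \<gamma> t, OF c(1) gc[OF t]] vector_derivative_at by metis
  qed
  have velw: "velocity C \<gamma> t = w t" if t: "t \<in> I" for t
  proof (rule TM_eqI[OF A_TM[OF w(1)[OF t]] velocity_TM[OF \<gamma> t] c(1) w(2)[OF t]])
    show "snd (velocity C \<gamma> t) c = snd (w t) c" using vel[OF t] w(3)[OF t] by (simp add: tcoord_def)
  qed (simp add: g(1)[OF t])
  have d0: "defect N \<gamma> c t k = 0" if t: "t \<in> I" for t k
  proof -
    have "((\<lambda>t. snd (u t) $ k) has_vector_derivative snd (F (u t)) $ k) (at t)"
      using bounded_linear.has_vector_derivative[OF bounded_linear_compose[OF bounded_linear_vec_nth bounded_linear_snd] u'(2)[OF t], of k] .
    then have "((\<lambda>s. snd (velocity C \<gamma> s) c $ k) has_vector_derivative snd (F (u t)) $ k) (at t)"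
      by (rule has_vector_derivative_transform_within_open[OF _ oI t]) (simp add: vel)
    then have "deriv (\<lambda>s. snd (velocity C \<gamma> s) c $ k) t = snd (F (u t)) $ k"
      using DERIV_imp_deriv has_real_derivative_iff_has_vector_derivative by blast
    then show ?thesis unfolding defect_def using vel[OF t] velw[OF t] w(3)[OF t] by (simp add: F_def)
  qed
  have "geodesic C A N I \<gamma>" unfolding geodesic_iff
  proof (intro conjI ballI impI allI \<gamma>)
    fix t assume t: "t \<in> I" then show vA: "velocity C \<gamma> t \<in> A" using velw w(1) by simp
    fix c' k assume "c' \<in> C" "\<gamma> t \<in> cdom c'"
    then show "defect N \<gamma> c' t k = 0" using defect_transform[OF N \<gamma> t vA c(1) _ gc[OF t]] d0[OF t] by simp
  qed
  moreover have "0 \<in> I" using e by (simp add: I_def)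
  moreover have "velocity C \<gamma> 0 = v"
  proof (rule TM_eqI[OF A_TM[OF v] velocity_TM[OF \<gamma> \<open>0 \<in> I\<close>] c])
    show "fst (velocity C \<gamma> 0) = fst v" using u(1) by (simp add: \<gamma>_def tcoord_def cinv_cmap[OF c])
    show "snd (velocity C \<gamma> 0) c = snd v c" using vel[OF \<open>0 \<in> I\<close>] u(1) by (simp add: tcoord_def)
  qed
  ultimately show thesis by (rule that)
qed

end

section \<open>Reparametrization and pregeodesics\<close>

context conic_manifold
begin

lemma reparametrise:
  assumes \<gamma>: "smooth_curve C I \<gamma>" and \<phi>: "open_interval J" "smooth_on \<phi> J" "\<phi> ` J \<subseteq> I"
  shows "smooth_curve C J (\<gamma> \<circ> \<phi>)"
    and "s \<in> J \<Longrightarrow> velocity C (\<gamma> \<circ> \<phi>) s = tscale (deriv \<phi> s) (velocity C \<gamma> (\<phi> s))"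
proof -
  have oJ: "open J" using \<phi>(1) by (simp add: open_interval_def)
  have cont: "continuous_on J (\<gamma> \<circ> \<phi>)"
    using \<gamma> smooth_on_continuous[OF \<phi>(2)] \<phi>(3) unfolding smooth_curve_def
    by (metis continuous_on_compose continuous_on_subset)
  have "smooth_on (cmap c \<circ> (\<gamma> \<circ> \<phi>)) (chart_times J (\<gamma> \<circ> \<phi>) c)" if c: "c \<in> C" for c
  proof -
    have "smooth_on (\<lambda>s. (cmap c \<circ> \<gamma>) (\<phi> s)) (chart_times J (\<gamma> \<circ> \<phi>) c)"
      by (rule smooth_on_compose[OF smooth_on_subset[OF \<phi>(2)] smooth_curveD(4)[OF \<gamma> c] _
            open_chart_times[OF oJ cont c] smooth_curveD(3)[OF \<gamma> c]])
         (use \<phi>(3) in \<open>auto simp: chart_times_def\<close>)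
    then show ?thesis by (simp add: o_def)
  qed
  then show "smooth_curve C J (\<gamma> \<circ> \<phi>)"
    unfolding smooth_curve_def chart_times_def[symmetric] using \<phi>(1) cont by blast
  assume s: "s \<in> J"
  have "vector_derivative (cmap c \<circ> (\<gamma> \<circ> \<phi>)) (at s) = deriv \<phi> s *\<^sub>R snd (velocity C \<gamma> (\<phi> s)) c"
    if c: "c \<in> C" "\<gamma> (\<phi> s) \<in> cdom c" for c
  proof -
    have "\<phi> s \<in> chart_times I \<gamma> c" using s c \<phi>(3) by (auto simp: chart_times_def)
    from vector_diff_chain_at[OF smooth_on_DERIV(2)[OF \<phi>(2) oJ s, unfolded has_real_derivative_iff_has_vector_derivative]
        has_velocity[OF \<gamma> c(1) this]]
    show ?thesis unfolding o_assoc by (rule vector_derivative_at)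
  qed
  then show "velocity C (\<gamma> \<circ> \<phi>) s = tscale (deriv \<phi> s) (velocity C \<gamma> (\<phi> s))"
    by (auto simp: velocity_def tscale_def fun_eq_iff)
qed

lemma connection_tscale:
  assumes "nonlinear_connection C A N" "c \<in> C" "v \<in> A" "fst v \<in> cdom c" "l > 0"
  shows "N c i k (tcoord c (tscale l v)) = l * N c i k (tcoord c v)"
proof -
  interpret conic_region "adom A c" by (rule conic_region_adom[OF assms(2)])
  have "pos_homogeneous 1 (N c i k) (adom A c)"
    using connectionD(1)[OF assms(1,2)] unfolding smooth_hom_def by blast
  then show ?thesis using adomI[OF assms(3,4)] assms(5)
    by (simp add: pos_homogeneous_iff tcoord_def tscale_def)
qed

text \<open>By homogeneity both terms of the geodesic equation scale with the square of the speed, and the acceleration of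
  the parameter only contributes along the velocity.\<close>

lemma defect_reparametrise:
  assumes N: "nonlinear_connection C A N" and \<gamma>: "smooth_curve C I \<gamma>"
    and \<phi>: "open_interval J" "smooth_on \<phi> J" "\<phi> ` J \<subseteq> I"
    and s: "s \<in> J" "deriv \<phi> s > 0" "(deriv \<phi> has_real_derivative d2) (at s)" "velocity C \<gamma> (\<phi> s) \<in> A"
    and c: "c \<in> C" "\<gamma> (\<phi> s) \<in> cdom c"
  shows "defect N (\<gamma> \<circ> \<phi>) c s k = d2 * snd (velocity C \<gamma> (\<phi> s)) c $ k + (deriv \<phi> s)\<^sup>2 * defect N \<gamma> c (\<phi> s) k"
proof -
  let ?y = "\<lambda>t. snd (velocity C \<gamma> t) c" and ?d = "deriv \<phi> s"
  have oJ: "open J" using \<phi>(1) by (simp add: open_interval_def)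
  have t: "\<phi> s \<in> chart_times I \<gamma> c" using s(1) c \<phi>(3) by (auto simp: chart_times_def)
  have "((\<lambda>s. deriv \<phi> s * ?y (\<phi> s) $ k) has_real_derivative
      d2 * ?y (\<phi> s) $ k + deriv (\<lambda>t. ?y t $ k) (\<phi> s) * ?d * ?d) (at s)"
    by (rule DERIV_mult[OF s(3) DERIV_chain2[OF velocity_has_deriv[OF \<gamma> c(1) t] smooth_on_DERIV(2)[OF \<phi>(2) oJ s(1)]]])
  then have "((\<lambda>s. snd (velocity C (\<gamma> \<circ> \<phi>) s) c $ k) has_real_derivative
      d2 * ?y (\<phi> s) $ k + deriv (\<lambda>t. ?y t $ k) (\<phi> s) * ?d * ?d) (at s)"
    by (rule has_field_derivative_transform_within_open[OF _ oJ s(1)])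
       (simp add: reparametrise(2)[OF \<gamma> \<phi>] tscale_def)
  then have "deriv (\<lambda>s. snd (velocity C (\<gamma> \<circ> \<phi>) s) c $ k) s = d2 * ?y (\<phi> s) $ k + ?d\<^sup>2 * deriv (\<lambda>t. ?y t $ k) (\<phi> s)"
    by (simp add: DERIV_imp_deriv power2_eq_square mult_ac)
  moreover have "(\<Sum>a\<in>UNIV. N c a k (tcoord c (velocity C (\<gamma> \<circ> \<phi>) s)) * snd (velocity C (\<gamma> \<circ> \<phi>) s) c $ a) =
      ?d\<^sup>2 * (\<Sum>a\<in>UNIV. N c a k (tcoord c (velocity C \<gamma> (\<phi> s))) * ?y (\<phi> s) $ a)"
    unfolding reparametrise(2)[OF \<gamma> \<phi> s(1)] sum_distrib_left
    by (intro sum.cong refl, subst connection_tscale[OF N c(1) s(4) _ s(2)])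
       (simp_all add: c tscale_def power2_eq_square mult_ac)
  ultimately show ?thesis unfolding defect_def by (simp add: distrib_left)
qed

lemma tscale_A: "v \<in> A \<Longrightarrow> l > 0 \<Longrightarrow> tscale l v \<in> A"
  using domain_A unfolding conic_domain_def by blast

lemma covector_contract_law:
  assumes B: "B \<in> hT01 C A \<alpha>" and c: "c \<in> C" "c' \<in> C" and v: "v \<in> A" "fst v \<in> cdom c" "fst v \<in> cdom c'"
  shows "(\<Sum>i\<in>UNIV. B c' i (tcoord c' v) * snd v c' $ i) = (\<Sum>a\<in>UNIV. B c a (tcoord c v) * snd v c $ a)"
proof -
  let ?j' = "jac c' c (cmap c' (fst v))"
  have "(\<Sum>i\<in>UNIV. B c' i (tcoord c' v) * snd v c' $ i) =
      (\<Sum>i\<in>UNIV. \<Sum>a\<in>UNIV. B c a (tcoord c v) * (?j' a i * snd v c' $ i))"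
    unfolding hT01_law[OF B c v] sum_distrib_right by (simp add: mult_ac)
  also have "\<dots> = (\<Sum>a\<in>UNIV. B c a (tcoord c v) * (\<Sum>i\<in>UNIV. ?j' a i * snd v c' $ i))"
    by (subst sum.swap) (simp only: sum_distrib_left)
  also have "\<dots> = (\<Sum>a\<in>UNIV. B c a (tcoord c v) * snd v c $ a)"
    by (simp only: TM_law[OF A_TM[OF v(1)] c(2,1) v(3,2), symmetric])
  finally show ?thesis .
qed

text \<open>Adding \<open>B \<otimes> y\<close> to the connection adds \<open>B(y) y\<close> to the geodesic equation, a force along
  the velocity, which a reparametrization absorbs.\<close>

lemma geodesic_add_radial:
  assumes N: "nonlinear_connection C A N" "nonlinear_connection C A N'" and B: "B \<in> hT01 C A 0"
    and N': "\<And>c i k p. c \<in> C \<Longrightarrow> p \<in> adom A c \<Longrightarrow> N' c i k p = N c i k p + B c i p * snd p $ k"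
    and \<gamma>: "geodesic C A N I \<gamma>"
  obtains J \<psi> where "open_interval J" "smooth_on \<psi> J" "\<psi> ` J = I" "\<And>s. s \<in> J \<Longrightarrow> deriv \<psi> s > 0"
    "geodesic C A N' J (\<gamma> \<circ> \<psi>)"
proof -
  have sc: "smooth_curve C I \<gamma>" and vA: "\<And>t. t \<in> I \<Longrightarrow> velocity C \<gamma> t \<in> A"
    and d0: "\<And>c t k. c \<in> C \<Longrightarrow> t \<in> I \<Longrightarrow> \<gamma> t \<in> cdom c \<Longrightarrow> defect N \<gamma> c t k = 0"
    using \<gamma> unfolding geodesic_iff by blast+
  \<comment> \<open>\<open>B(y)\<close> along the curve does not depend on the chart, so any choice of charts gives a smooth function\<close>
  define chart_at where "chart_at m = (SOME c. c \<in> C \<and> m \<in> cdom c)" for m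
  have ca: "chart_at m \<in> C" "m \<in> cdom (chart_at m)" for m
    unfolding chart_at_def using someI_ex[of "\<lambda>c. c \<in> C \<and> m \<in> cdom c"] charts_cover by metis+
  define force where "force c t = (\<Sum>i\<in>UNIV. B c i (tcoord c (velocity C \<gamma> t)) * snd (velocity C \<gamma> t) c $ i)" for c t
  define a where "a t = force (chart_at (\<gamma> t)) t" for t
  have a: "a t = force c t" if "c \<in> C" "t \<in> I" "\<gamma> t \<in> cdom c" for c t
    unfolding a_def force_def using covector_contract_law[OF B that(1) ca(1) vA[OF that(2)], of "\<gamma> t"] that ca(2)[of "\<gamma> t"] by simp
  have "smooth_on a I"
  proof (rule smooth_on_local)
    fix t assume t: "t \<in> I"
    let ?c = "chart_at (\<gamma> t)" let ?T = "chart_times I \<gamma> ?c"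
    have o: "open ?T" by (rule smooth_curveD(3)[OF sc ca(1)])
    have "smooth_on (\<lambda>s. cmap ?c (\<gamma> s)) ?T" using smooth_curveD(4)[OF sc ca(1)] by (simp add: o_def)
    then have tc: "smooth_on (\<lambda>s. tcoord ?c (velocity C \<gamma> s)) ?T"
      unfolding tcoord_def fst_velocity by (intro smooth_on_Pair smooth_velocity[OF sc ca(1)] o)
    have im: "(\<lambda>s. tcoord ?c (velocity C \<gamma> s)) ` ?T \<subseteq> adom A ?c"
      using vA by (auto simp: chart_times_def intro!: adomI)
    have "smooth_on (\<lambda>s. B ?c i (tcoord ?c (velocity C \<gamma> s))) ?T" for i
      by (rule smooth_on_compose[OF tc _ im o conic_region.open_S[OF conic_region_adom[OF ca(1)]]])
         (rule conic_region.smooth_homD[OF conic_region_adom[OF ca(1)] hT_sh(2)[OF B ca(1)]])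
    then have "smooth_on (force ?c) ?T"
      unfolding force_def by (intro smooth_on_sum smooth_on_mult smooth_on_vec_nth smooth_velocity[OF sc ca(1)] o)
    then have "smooth_on a ?T"
      by (rule smooth_on_cong[OF _ o]) (use a[OF ca(1)] in \<open>auto simp: chart_times_def\<close>)
    moreover have "t \<in> ?T" using t ca(2) by (simp add: chart_times_def)
    ultimately show "\<exists>T. t \<in> T \<and> open T \<and> smooth_on a T" using o by blast
  qed
  moreover have I: "open_interval I" using sc by (simp add: smooth_curve_def)
  ultimately obtain J \<psi> where \<psi>: "open_interval J" "smooth_on \<psi> J" "\<psi> ` J = I" "\<And>s. s \<in> J \<Longrightarrow> deriv \<psi> s > 0"
    "\<And>s. s \<in> J \<Longrightarrow> (deriv \<psi> has_real_derivative - (a (\<psi> s) * (deriv \<psi> s)\<^sup>2)) (at s)"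
    using damped_reparametrisation by metis
  have im: "\<psi> ` J \<subseteq> I" "\<And>s. s \<in> J \<Longrightarrow> \<psi> s \<in> I" using \<psi>(3) by auto
  have "geodesic C A N' J (\<gamma> \<circ> \<psi>)" unfolding geodesic_iff
  proof (intro conjI ballI impI allI)
    show "smooth_curve C J (\<gamma> \<circ> \<psi>)" by (rule reparametrise(1)[OF sc \<psi>(1,2) im(1)])
    fix s assume s: "s \<in> J"
    show "velocity C (\<gamma> \<circ> \<psi>) s \<in> A"
      unfolding reparametrise(2)[OF sc \<psi>(1,2) im(1) s] by (intro tscale_A vA im s \<psi>)
    fix c k assume c: "c \<in> C" "(\<gamma> \<circ> \<psi>) s \<in> cdom c"
    let ?v = "velocity C \<gamma> (\<psi> s)"
    have "(\<Sum>i\<in>UNIV. N' c i k (tcoord c ?v) * snd ?v c $ i) =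
        (\<Sum>i\<in>UNIV. N c i k (tcoord c ?v) * snd ?v c $ i) + force c (\<psi> s) * snd ?v c $ k"
      using N'[OF c(1) adomI[OF vA[OF im(2)[OF s]]]] c(2)
      by (simp add: force_def sum.distrib[symmetric] sum_distrib_left tcoord_def algebra_simps)
    then have "defect N' \<gamma> c (\<psi> s) k = defect N \<gamma> c (\<psi> s) k + force c (\<psi> s) * snd ?v c $ k"
      by (simp add: defect_def)
    then have "defect N' \<gamma> c (\<psi> s) k = a (\<psi> s) * snd ?v c $ k"
      using d0[OF c(1) im(2)[OF s]] a[OF c(1) im(2)[OF s]] c(2) by simp
    then show "defect N' (\<gamma> \<circ> \<psi>) c s k = 0"
      using defect_reparametrise[OF N(2) sc \<psi>(1,2) im(1) s \<psi>(4,5)[OF s] vA[OF im(2)[OF s]] c(1)] s c(2) by simp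
  qed
  then show thesis using that \<psi> by blast
qed

lemma pregeodesic_add_radial:
  assumes N: "nonlinear_connection C A N" "nonlinear_connection C A N'" and B: "B \<in> hT01 C A 0"
    and N': "\<And>c i k p. c \<in> C \<Longrightarrow> p \<in> adom A c \<Longrightarrow> N' c i k p = N c i k p + B c i p * snd p $ k"
    and \<gamma>: "pregeodesic C A N I \<gamma>"
  shows "pregeodesic C A N' I \<gamma>"
proof -
  obtain I' \<phi> where \<phi>: "open_interval I'" "smooth_on \<phi> I'" "\<And>t. t \<in> I' \<Longrightarrow> deriv \<phi> t > 0" "\<phi> ` I' = I"
    "geodesic C A N I' (\<gamma> \<circ> \<phi>)" and sc: "smooth_curve C I \<gamma>"
    using \<gamma> unfolding pregeodesic_def by blast
  obtain J \<psi> where \<psi>: "open_interval J" "smooth_on \<psi> J" "\<psi> ` J = I'" "\<And>s. s \<in> J \<Longrightarrow> deriv \<psi> s > 0"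
    "geodesic C A N' J ((\<gamma> \<circ> \<phi>) \<circ> \<psi>)"
    using geodesic_add_radial[OF N B N' \<phi>(5)] by blast
  have o: "open J" "open I'" using \<phi>(1) \<psi>(1) by (auto simp: open_interval_def)
  have "smooth_on (\<phi> \<circ> \<psi>) J"
    unfolding o_def by (rule smooth_on_compose[OF \<psi>(2) \<phi>(2) _ o]) (simp add: \<psi>(3))
  moreover have "deriv (\<phi> \<circ> \<psi>) s > 0" if s: "s \<in> J" for s
  proof -
    have t: "\<psi> s \<in> I'" using \<psi>(3) s by blast
    have "(\<phi> \<circ> \<psi> has_real_derivative deriv \<phi> (\<psi> s) * deriv \<psi> s) (at s)"
      by (rule DERIV_chain[OF smooth_on_DERIV(2)[OF \<phi>(2) o(2) t] smooth_on_DERIV(2)[OF \<psi>(2) o(1) s]])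
    then show ?thesis using DERIV_imp_deriv \<phi>(3)[OF t] \<psi>(4)[OF s] by (metis mult_pos_pos)
  qed
  moreover have "(\<phi> \<circ> \<psi>) ` J = I" using \<phi>(4) \<psi>(3) by (metis image_comp)
  moreover have "geodesic C A N' J (\<gamma> \<circ> (\<phi> \<circ> \<psi>))" using \<psi>(5) by (simp add: o_assoc)
  ultimately show ?thesis unfolding pregeodesic_def using sc \<psi>(1) by blast
qed

lemma share_pregeodesics_add_radial:
  assumes N: "nonlinear_connection C A N" "nonlinear_connection C A N'" and B: "B \<in> hT01 C A 0"
    and N': "\<And>c i k p. c \<in> C \<Longrightarrow> p \<in> adom A c \<Longrightarrow> N' c i k p = N c i k p + B c i p * snd p $ k"
  shows "share_pregeodesics C A N N'"
proof -
  have mB: "(\<lambda>c i p. - B c i p) \<in> hT01 C A 0"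
  proof (rule hT01I)
    show "sh c 0 (\<lambda>p. - B c i p)" if "c \<in> C" for c i
      using conic_region.smooth_hom_cmult[OF conic_region_adom[OF that] hT_sh(2)[OF B that], of "-1"] by simp
  qed (use hT_off(2)[OF B] hT01_law[OF B] in \<open>auto simp: sum_negf\<close>)
  show ?thesis unfolding share_pregeodesics_def
  proof (intro allI iffI)
    fix I \<gamma>
    show "pregeodesic C A N I \<gamma> \<Longrightarrow> pregeodesic C A N' I \<gamma>"
      by (rule pregeodesic_add_radial[OF N B N'])
    show "pregeodesic C A N' I \<gamma> \<Longrightarrow> pregeodesic C A N I \<gamma>"
      by (rule pregeodesic_add_radial[OF N(2,1) mB]) (simp add: N')
  qed
qed

text \<open>Conversely, the geodesic of \<open>N\<close> with velocity \<open>v\<close> is a reparametrized geodesic of \<open>N'\<close>.  Comparing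
  the two geodesic equations at \<open>v\<close> leaves a multiple of \<open>v\<close>.\<close>

lemma share_pregeodesics_imp_radial:
  assumes N: "nonlinear_connection C A N" "nonlinear_connection C A N'" and sh: "share_pregeodesics C A N N'"
    and c: "c \<in> C" and p: "p \<in> adom A c"
  shows "\<exists>\<sigma>. \<forall>k. (\<Sum>i\<in>UNIV. N' c i k p * snd p $ i) - (\<Sum>i\<in>UNIV. N c i k p * snd p $ i) = \<sigma> * snd p $ k"
proof -
  obtain v where v: "v \<in> A" "fst v \<in> cdom c" "p = tcoord c v" using adomE[OF p] by blast
  obtain I \<gamma> where g: "geodesic C A N I \<gamma>" "0 \<in> I" "velocity C \<gamma> 0 = v" using geodesic_exists[OF N(1) v(1)] by blast
  have sc: "smooth_curve C I \<gamma>" using g(1) unfolding geodesic_iff by blast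
  then have I: "open_interval I" by (simp add: smooth_curve_def)
  have gc: "\<gamma> 0 \<in> cdom c" using v(2) g(3) by (metis fst_velocity)
  have "pregeodesic C A N I \<gamma>"
    unfolding pregeodesic_def
    using sc I g(1) smooth_on_ident[of I] by (intro conjI exI[of _ I] exI[of _ "\<lambda>x. x"]) (auto simp: open_interval_def o_def)
  then have "pregeodesic C A N' I \<gamma>" using sh unfolding share_pregeodesics_def by blast
  then obtain J \<phi> where \<phi>: "open_interval J" "smooth_on \<phi> J" "\<And>t. t \<in> J \<Longrightarrow> deriv \<phi> t > 0" "\<phi> ` J = I"
    "geodesic C A N' J (\<gamma> \<circ> \<phi>)" unfolding pregeodesic_def by blast
  obtain s where s: "s \<in> J" "\<phi> s = 0" using \<phi>(4) g(2) by (metis imageE)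
  have oJ: "open J" using \<phi>(1) by (simp add: open_interval_def)
  let ?d = "deriv \<phi> s" and ?d2 = "deriv (deriv \<phi>) s"
  have d2: "(deriv \<phi> has_real_derivative ?d2) (at s)"
    by (rule smooth_on_DERIV(2)[OF smooth_on_DERIV(1)[OF \<phi>(2) oJ] oJ s(1)])
  have d: "?d > 0" by (rule \<phi>(3)[OF s(1)])
  have "(\<Sum>i\<in>UNIV. N' c i k p * snd p $ i) - (\<Sum>i\<in>UNIV. N c i k p * snd p $ i) = - (?d2 / ?d\<^sup>2) * snd p $ k" for k
  proof -
    have "defect N' (\<gamma> \<circ> \<phi>) c s k = 0" using \<phi>(5) s gc c unfolding geodesic_iff by simp
    then have "?d2 * snd v c $ k + ?d\<^sup>2 * defect N' \<gamma> c 0 k = 0"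
      using defect_reparametrise[OF N(2) sc \<phi>(1,2) _ s(1) d d2 _ c, of k] s(2) g(3) v(1) gc \<phi>(4) by simp
    then have "defect N' \<gamma> c 0 k = - (?d2 / ?d\<^sup>2) * snd v c $ k" using d by (simp add: field_simps)
    moreover have "defect N \<gamma> c 0 k = 0" using g(1,2) gc c unfolding geodesic_iff by blast
    ultimately have "defect N' \<gamma> c 0 k - defect N \<gamma> c 0 k = - (?d2 / ?d\<^sup>2) * snd v c $ k" by simp
    then show ?thesis by (simp add: defect_def g(3) v(3)) (simp add: tcoord_def)
  qed
  then show ?thesis by blast
qed

end

section \<open>The projection onto the symmetric solutions\<close>

locale finsler_manifold = conic_manifold C A
  for C :: "('m::{second_countable_topology, t2_space}, 'n::finite) chart set" and A :: "('m, 'n) tvec set" +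
  fixes L :: "('m, 'n) tvec \<Rightarrow> real"
  assumes finsler_L: "pseudo_Finsler C A L" and L_pos: "\<And>v. v \<in> A \<Longrightarrow> L v > 0" and dim: "CARD('n) \<ge> 2"
begin

abbreviation lx where "lx c \<equiv> local_expr C L c"

lemma local_expr_tcoord:
  assumes "c \<in> C" "v \<in> A" "fst v \<in> cdom c" shows "lx c (tcoord c v) = L v"
proof -
  let ?V = "{v \<in> TM C. fst v \<in> cdom c}"
  have "inj_on (tcoord c) ?V"
  proof (rule inj_onI)
    fix u v assume u: "u \<in> ?V" "v \<in> ?V" "tcoord c u = tcoord c v"
    then have "fst u = fst v" "snd u c = snd v c"
      using cmap_inj[OF assms(1)] by (auto simp: tcoord_def)
    then show "u = v" using TM_eqI[of v u c] u assms(1) by simp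
  qed
  then have "tpoint C c (tcoord c v) = v"
    unfolding tpoint_def by (rule inv_into_f_f) (use assms A_TM in auto)
  then show ?thesis by (simp add: local_expr_def)
qed

lemma finsler_region_adom:
  assumes c: "c \<in> C" shows "finsler_region (adom A c) (lx c)"
proof -
  interpret conic_region "adom A c" by (rule conic_region_adom[OF c])
  have "pos_homogeneous 2 (lx c) (adom A c)" unfolding pos_homogeneous_iff
  proof (intro allI impI)
    fix x y :: "real^'n" and l :: real assume "(x, y) \<in> adom A c" and l: "l > 0"
    then obtain v where v: "v \<in> A" "fst v \<in> cdom c" "(x, y) = tcoord c v" using adomE by blast
    have "L (tscale l v) = l\<^sup>2 * L v" using finsler_L v(1) l unfolding pseudo_Finsler_def by blast
    moreover have "tcoord c (tscale l v) = (x, l *\<^sub>R y)" using v(3) by (simp add: tcoord_def tscale_def)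
    moreover have "fst (tscale l v) \<in> cdom c" using v(2) by (simp add: tscale_def)
    ultimately show "lx c (x, l *\<^sub>R y) = l powr 2 * lx c (x, y)"
      using local_expr_tcoord[OF c tscale_A[OF v(1) l]] local_expr_tcoord[OF c v(1,2)] v(3) l
      by simp
  qed
  then have "smooth_hom 2 (lx c)" using finsler_L c unfolding smooth_hom_def pseudo_Finsler_def by blast
  moreover have "\<And>p. p \<in> adom A c \<Longrightarrow> invertible (metric_matrix (lx c) p)"
    using finsler_L c unfolding pseudo_Finsler_def by blast
  ultimately show ?thesis by unfold_locales
qed

lemma local_expr_pos:
  assumes "c \<in> C" "p \<in> adom A c" shows "lx c p > 0"
proof -
  obtain v where "v \<in> A" "fst v \<in> cdom c" "p = tcoord c v" using adomE[OF assms(2)] by blast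
  then show ?thesis using local_expr_tcoord[OF assms(1)] L_pos by simp
qed

abbreviation hshift :: "('m, 'n) fam1 \<Rightarrow> ('m, 'n) fam2" where
  "hshift Z \<equiv> NL C A L \<oplus>\<^sub>f vertical_deriv C A Z"

lemma hshift_eq:
  "c \<in> C \<Longrightarrow> p \<in> adom A c \<Longrightarrow> hshift Z c i k p = NL_loc (lx c) i k p + pdy i (Z c k) p"
  by (simp add: fam_add_def NL_def vertical_deriv_def)

lemma decomposesD:
  assumes "decomposes C A L N Z B"
  shows "Z \<in> hT10 C A 2" "B \<in> hT01 C A 0" "N = hshift Z \<oplus>\<^sub>f tensor_liouville B"
    "N c i k p = hshift Z c i k p + B c i p * snd p $ k"
  using assms unfolding decomposes_def by (auto simp: fam_add_def tensor_liouville_def)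

lemma SolE:
  assumes "N \<in> Sol C A L"
  obtains J where "J \<in> hT11 C A 1" "N = NL C A L \<oplus>\<^sub>f J" "nonlinear_connection C A N"
    "\<And>c p. c \<in> C \<Longrightarrow> p \<in> adom A c \<Longrightarrow> affine_equation (lx c) (J c) p"
  using assms unfolding Sol_def by blast

lemma Sol_decomposes:
  assumes "N \<in> Sol C A L" shows "\<exists>Z B. decomposes C A L N Z B"
proof -
  obtain J where J: "J \<in> hT11 C A 1" "N = NL C A L \<oplus>\<^sub>f J"
    "\<And>c p. c \<in> C \<Longrightarrow> p \<in> adom A c \<Longrightarrow> affine_equation (lx c) (J c) p" using SolE[OF assms] by metis
  obtain Z B where "Z \<in> hT10 C A 2" "B \<in> hT01 C A 0"
    "J = (\<lambda>c i k p. vertical_deriv C A Z c i k p + tensor_liouville B c i k p)"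
    using affine_solution_decomposition[OF dim J(1,3)] by blast
  then have "decomposes C A L N Z B" unfolding decomposes_def J(2) by (simp add: fam_add_def add.assoc)
  then show ?thesis by blast
qed

text \<open>The transformation law is inherited from \<open>N\<close>, by subtracting a tensor.\<close>

lemma connection_hshift:
  assumes "nonlinear_connection C A N" "decomposes C A L N Z B"
  shows "nonlinear_connection C A (hshift Z)"
proof -
  have "hshift Z = (\<lambda>c i k p. N c i k p - tensor_liouville B c i k p)"
    unfolding decomposesD(3)[OF assms(2)] by (simp add: fam_add_def)
  then show ?thesis using connection_diff[OF assms(1) tensor_liouville_hT11[OF decomposesD(2)[OF assms(2)]]] by simp
qed

lemma symmetric_hshift:
  assumes Z: "Z \<in> hT10 C A 2" shows "symmetric_connection C A (hshift Z)"
  unfolding symmetric_connection_def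
proof (intro ballI allI)
  fix c p i j k assume c: "c \<in> C" and p: "p \<in> adom A c"
  interpret finsler_region "adom A c" "lx c" by (rule finsler_region_adom[OF c])
  note sm = smooth_homD[OF smooth_hom_NL_loc] smooth_homD[OF hT_sh(1)[OF Z c]]
  have "pdy j (hshift Z c i k) p = pdy j (NL_loc (lx c) i k) p + pdy j (pdy i (Z c k)) p" for i j
  proof -
    have "pdy j (\<lambda>q. NL_loc (lx c) i k q + pdy i (Z c k) q) p = pdy j (hshift Z c i k) p"
      by (rule pd_cong(2)[OF _ open_S p]) (intro smooth_intros sm, simp add: hshift_eq[OF c])
    then show ?thesis by (simp add: pd_add(2)[OF sm(1) smooth_on_pdy[OF sm(2)] p])
  qed
  then show "pdy j (hshift Z c i k) p = pdy i (hshift Z c j k) p"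
    using NL_loc_sym[OF p] pd_commute(1)[OF sm(2) open_S p] by simp
qed

lemma hshift_Sol_sym:
  assumes N: "N \<in> Sol C A L" and d: "decomposes C A L N Z B"
  shows "hshift Z \<in> Sol_sym C A L"
proof -
  note Z = decomposesD(1)[OF d] and B = decomposesD(2)[OF d]
  obtain J where J: "J \<in> hT11 C A 1" "N = NL C A L \<oplus>\<^sub>f J" "nonlinear_connection C A N"
    "\<And>c p. c \<in> C \<Longrightarrow> p \<in> adom A c \<Longrightarrow> affine_equation (lx c) (J c) p" using SolE[OF N] by metis
  have J': "J c i k p = vertical_deriv C A Z c i k p + B c i p * snd p $ k" for c i k p
    using decomposesD(4)[OF d, of c i k p] unfolding J(2) by (simp add: fam_add_def)
  have "affine_equation (lx c) (vertical_deriv C A Z c) p" if c: "c \<in> C" and p: "p \<in> adom A c" for c p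
  proof -
    interpret finsler_region "adom A c" "lx c" by (rule finsler_region_adom[OF c])
    show ?thesis
    proof (rule affine_equation_add_radial[where J="J c" and B="\<lambda>i q. -1 * B c i q", OF _ _ p ylow_unit[OF p] mean_Cartan_contract[OF p] _ J(4)[OF c p]])
      show "smooth_hom 1 (J c i j)" for i j by (rule hT_sh(3)[OF J(1) c])
      show "smooth_hom 0 (\<lambda>q. -1 * B c i q)" for i by (rule smooth_hom_cmult[OF hT_sh(2)[OF B c]])
      show "lx c p \<noteq> 0" using local_expr_pos[OF c p] by simp
    qed (simp add: J')
  qed
  then have "hshift Z \<in> Sol C A L"
    unfolding Sol_def using connection_hshift[OF J(3) d] vertical_deriv_hT11[OF Z] by blast
  then show ?thesis unfolding Sol_sym_def using symmetric_hshift[OF Z] by blast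
qed

lemma decomposes_unique:
  assumes d: "decomposes C A L N Z B" "decomposes C A L N Z' B'"
  shows "Z = Z'"
proof -
  note Z = decomposesD(1)[OF d(1)] and Z' = decomposesD(1)[OF d(2)]
  have "Z c k p = Z' c k p" for c k p
  proof (cases "c \<in> C \<and> p \<in> adom A c")
    case True
    then have c: "c \<in> C" and p: "p \<in> adom A c" by auto
    interpret conic_region "adom A c" by (rule conic_region_adom[OF c])
    note sh = hT_sh(1)[OF Z c] hT_sh(1)[OF Z' c]
    have "pdy i (\<lambda>q. Z c k q - Z' c k q) q = (B' c i q - B c i q) * snd q $ k" if q: "q \<in> adom A c" for i k q
      using decomposesD(4)[OF d(1), of c i k q] decomposesD(4)[OF d(2), of c i k q]
      by (simp add: hshift_eq[OF c q] pd_diff(2)[OF smooth_homD[OF sh(1)] smooth_homD[OF sh(2)] q] algebra_simps)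
    then have "Z c k p - Z' c k p = 0"
      by (intro vertical_radial_imp_zero[OF dim, of "\<lambda>k q. Z c k q - Z' c k q", OF smooth_hom_diff[OF sh] _ p]
          exI[of _ "\<lambda>i. B' c i _ - B c i _"] allI)
    then show ?thesis by simp
  next
    case False
    then show ?thesis using hT_off(1)[OF Z False] hT_off(1)[OF Z' False] by simp
  qed
  then show ?thesis by (simp add: fun_eq_iff)
qed

lemma Pi_map_eq: "decomposes C A L N Z B \<Longrightarrow> Pi_map C A L N = hshift Z"
  unfolding Pi_map_def by (rule the_equality) (use decomposes_unique in blast)+

text \<open>Both \<open>S\<close> and \<open>N\<^sup>L + \<partial>Z\<close> are symmetric, hence so is their difference \<open>B \<otimes> y\<close>.\<close>

lemma Sol_sym_decomposes:
  assumes S: "S \<in> Sol_sym C A L" and d: "decomposes C A L S Z B"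
  shows "S = hshift Z"
proof -
  note Z = decomposesD(1)[OF d] and B = decomposesD(2)[OF d]
  have "S \<in> Sol C A L" and sym: "symmetric_connection C A S" using S unfolding Sol_sym_def by auto
  then have con: "nonlinear_connection C A (hshift Z)" using SolE connection_hshift[OF _ d] by metis
  have "B c i p = 0" for c i p
  proof (cases "c \<in> C \<and> p \<in> adom A c")
    case True
    then have c: "c \<in> C" and p: "p \<in> adom A c" by auto
    interpret conic_region "adom A c" by (rule conic_region_adom[OF c])
    note sm = smooth_homD[OF connectionD(1)[OF con c]] smooth_homD[OF hT_sh(2)[OF B c]] smooth_on_snd_nth[OF open_S]
    show ?thesis
    proof (rule symmetric_radial_imp_zero[OF dim hT_sh(2)[OF B c] p])
      fix i j k q assume q: "q \<in> adom A c"
      have "pdy j (S c i k) q = pdy j (hshift Z c i k) q + pdy j (\<lambda>p. B c i p * snd p $ k) q" for i j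
      proof -
        have "S c i k = (\<lambda>p. hshift Z c i k p + B c i p * snd p $ k)" using decomposesD(4)[OF d] by (intro ext)
        then show ?thesis using pd_add(2)[OF sm(1) smooth_on_mult[OF sm(2,3) open_S] q] by simp
      qed
      from this[of j i] this[of i j]
      show "pdy j (\<lambda>p. B c i p * snd p $ k) q = pdy i (\<lambda>p. B c j p * snd p $ k) q"
        using sym[unfolded symmetric_connection_def, rule_format, OF c q, of j i k]
          symmetric_hshift[OF Z, unfolded symmetric_connection_def, rule_format, OF c q, of j i k] by linarith
    qed
  next
    case False
    then show ?thesis by (rule hT_off(2)[OF B])
  qed
  then show ?thesis using decomposesD(4)[OF d] by (simp add: fun_eq_iff)
qed

lemma bracket_hshift_zero:
  assumes S: "hshift Z \<in> Sol C A L" and Z: "Z \<in> hT10 C A 2" and c: "c \<in> C" and p: "p \<in> adom A c"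
  shows "(\<Sum>b\<in>UNIV. bracket (lx c) (vertical_deriv C A Z c) b p * snd p $ b) = 0"
proof -
  interpret conic_region "adom A c" by (rule conic_region_adom[OF c])
  obtain J where "hshift Z = NL C A L \<oplus>\<^sub>f J" and aff: "affine_equation (lx c) (J c) p"
    using SolE[OF S] c p by metis
  then have "J = vertical_deriv C A Z" by (simp add: fam_add_def fun_eq_iff)
  then show ?thesis
    using bracket_contracted_zero[where Z="Z c" and J="vertical_deriv C A Z c" and f="lx c",
        OF dim hT_sh(1)[OF Z c] _ _ p] aff
    by (simp add: vertical_deriv_def c)
qed

text \<open>The geodesic equations of the two connections differ by \<open>2 (Z' - Z)\<close>, a multiple of the velocity.  The
  contracted bracket is affine in \<open>Z\<close> and vanishes for both fields, so \<open>radial_imp_zero\<close> applies to the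
  difference.\<close>

lemma hshift_share_unique:
  assumes Z: "Z \<in> hT10 C A 2" "Z' \<in> hT10 C A 2"
    and con: "nonlinear_connection C A (hshift Z)" "nonlinear_connection C A (hshift Z')"
    and sh: "share_pregeodesics C A (hshift Z) (hshift Z')"
    and br: "\<And>c p. c \<in> C \<Longrightarrow> p \<in> adom A c \<Longrightarrow> (\<Sum>b\<in>UNIV. bracket (lx c) (vertical_deriv C A Z c) b p * snd p $ b) = 0"
      "\<And>c p. c \<in> C \<Longrightarrow> p \<in> adom A c \<Longrightarrow> (\<Sum>b\<in>UNIV. bracket (lx c) (vertical_deriv C A Z' c) b p * snd p $ b) = 0"
  shows "Z = Z'"
proof -
  have "Z' c k p = Z c k p" for c k p
  proof (cases "c \<in> C \<and> p \<in> adom A c")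
    case True
    then have c: "c \<in> C" and p: "p \<in> adom A c" by auto
    interpret finsler_region "adom A c" "lx c" by (rule finsler_region_adom[OF c])
    note h = hT_sh(1)[OF Z(1) c] hT_sh(1)[OF Z(2) c]
    let ?D = "\<lambda>k q. (Z' c k q - Z c k q)"
    have rad: "\<exists>\<sigma>. \<forall>k. ?D k q = \<sigma> * snd q $ k" if q: "q \<in> adom A c" for q
    proof -
      obtain \<sigma> where \<sigma>: "\<And>k. (\<Sum>i\<in>UNIV. hshift Z' c i k q * snd q $ i) - (\<Sum>i\<in>UNIV. hshift Z c i k q * snd q $ i) = \<sigma> * snd q $ k"
        using share_pregeodesics_imp_radial[OF con sh c q] by blast
      have "2 * ?D k q = \<sigma> * snd q $ k" for k
        using \<sigma>[of k] euler[OF h(1) q, of k] euler[OF h(2) q, of k]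
        by (simp add: hshift_eq[OF c q] distrib_right sum.distrib)
      then show ?thesis by (intro exI[of _ "\<sigma> / 2"] allI) (simp add: field_simps)
    qed
    have pdD: "pdy a (?D k) p = pdy a (Z' c k) p - pdy a (Z c k) p" for a k
      by (rule pd_diff(2)[OF smooth_homD[OF h(2)] smooth_homD[OF h(1)] p])
    have F: "2 * (real CARD('n) + 2) * (\<Sum>a\<in>UNIV. ylow (lx c) a p / lx c p * W c a p) -
        4 * (\<Sum>a\<in>UNIV. mean_Cartan (lx c) a p * W c a p) - 2 * (\<Sum>a\<in>UNIV. pdy a (W c a) p) = 0"
      if "W \<in> hT10 C A 2" "(\<Sum>b\<in>UNIV. bracket (lx c) (vertical_deriv C A W c) b p * snd p $ b) = 0" for W
      using bracket_vertical_contracted[where Z="W c" and J="vertical_deriv C A W c" and f="lx c", OF hT_sh(1)[OF that(1) c] _ p]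
        that(2) mean_Landsberg_contract[OF p] by (simp add: vertical_deriv_def c)
    have "?D k p = 0"
    proof (rule radial_imp_zero[of ?D, OF smooth_hom_diff[OF h(2,1)] rad p ylow_unit[OF p] mean_Cartan_contract[OF p]])
      show "lx c p \<noteq> 0" using local_expr_pos[OF c p] by simp
      show "2 * (real CARD('n) + 2) * (\<Sum>a\<in>UNIV. ylow (lx c) a p / lx c p * ?D a p) -
          4 * (\<Sum>a\<in>UNIV. mean_Cartan (lx c) a p * ?D a p) = 2 * (\<Sum>a\<in>UNIV. pdy a (?D a) p)"
        using F[OF Z(1) br(1)[OF c p]] F[OF Z(2) br(2)[OF c p]]
        by (simp add: pdD sum_subtractf right_diff_distrib)
    qed
    then show ?thesis by simp
  next
    case False
    then show ?thesis using hT_off(1)[OF Z(1) False] hT_off(1)[OF Z(2) False] by simp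
  qed
  then show ?thesis by (simp add: fun_eq_iff)
qed

lemma share_hshift:
  assumes "N \<in> Sol C A L" "decomposes C A L N Z B"
  shows "share_pregeodesics C A (hshift Z) N"
proof -
  have N: "nonlinear_connection C A N" using SolE[OF assms(1)] by metis
  show ?thesis
    by (rule share_pregeodesics_add_radial[OF connection_hshift[OF N assms(2)] N decomposesD(2)[OF assms(2)]])
       (rule decomposesD(4)[OF assms(2)])
qed

lemma share_sym: "share_pregeodesics C A N N' \<Longrightarrow> share_pregeodesics C A N' N"
  unfolding share_pregeodesics_def by blast

lemma share_trans: "share_pregeodesics C A N N' \<Longrightarrow> share_pregeodesics C A N' N'' \<Longrightarrow> share_pregeodesics C A N N''"
  unfolding share_pregeodesics_def by blast

lemma Pi_map_Sol_sym:
  assumes "S \<in> Sol_sym C A L" shows "Pi_map C A L S = S"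
proof -
  obtain Z B where "decomposes C A L S Z B" using Sol_decomposes assms unfolding Sol_sym_def by blast
  then show ?thesis using Sol_sym_decomposes[OF assms] Pi_map_eq by metis
qed

lemma share_iff_Pi_map:
  assumes N: "N \<in> Sol C A L" "N0 \<in> Sol C A L"
  shows "share_pregeodesics C A N N0 \<longleftrightarrow> Pi_map C A L N = Pi_map C A L N0"
proof -
  obtain Z B Z0 B0 where d: "decomposes C A L N Z B" "decomposes C A L N0 Z0 B0" using Sol_decomposes N by blast
  note sh = share_hshift[OF N(1) d(1)] share_hshift[OF N(2) d(2)]
  have Z: "Z \<in> hT10 C A 2" "Z0 \<in> hT10 C A 2" using decomposesD(1) d by blast+
  have S: "hshift Z \<in> Sol C A L" "hshift Z0 \<in> Sol C A L"
    using hshift_Sol_sym[OF N(1) d(1)] hshift_Sol_sym[OF N(2) d(2)] unfolding Sol_sym_def by auto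
  have con: "nonlinear_connection C A (hshift Z)" "nonlinear_connection C A (hshift Z0)"
    using SolE[OF S(1)] SolE[OF S(2)] by metis+
  show ?thesis unfolding Pi_map_eq[OF d(1)] Pi_map_eq[OF d(2)]
  proof
    assume "share_pregeodesics C A N N0"
    then have "share_pregeodesics C A (hshift Z) (hshift Z0)" using sh share_sym share_trans by blast
    then have "Z = Z0"
      using hshift_share_unique[OF Z con] bracket_hshift_zero[OF S(1) Z(1)] bracket_hshift_zero[OF S(2) Z(2)] by blast
    then show "hshift Z = hshift Z0" by simp
  next
    assume "hshift Z = hshift Z0"
    then show "share_pregeodesics C A N N0" using sh share_sym share_trans by metis
  qed
qed

text \<open>The connection \<open>N\<^sup>L\<close> is \<open>hshift 0\<close>.  It may fail to solve the affine equation, but its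
  contracted bracket vanishes because the mean Landsberg tensor is transverse to \<open>y\<close>.\<close>

lemma share_NL_iff:
  assumes N: "N \<in> Sol C A L"
  shows "share_pregeodesics C A N (NL C A L) \<longleftrightarrow> Pi_map C A L N = NL C A L"
proof -
  obtain Z B where d: "decomposes C A L N Z B" using Sol_decomposes N by blast
  note sh = share_hshift[OF N d]
  have Z: "Z \<in> hT10 C A 2" using decomposesD(1) d by blast
  have S: "hshift Z \<in> Sol C A L" using hshift_Sol_sym[OF N d] unfolding Sol_sym_def by auto
  have con: "nonlinear_connection C A (hshift Z)" using SolE[OF S] by metis
  define O0 :: "('m, 'n) fam1" where "O0 = (\<lambda>c k p. 0)"
  have O0: "O0 \<in> hT10 C A 2"
  proof (rule hT10I)
    show "sh c 2 (O0 c k)" if "c \<in> C" for c k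
      unfolding O0_def conic_region.smooth_hom_def[OF conic_region_adom[OF that]]
      by (simp add: smooth_on_const pos_homogeneous_iff)
  qed (simp_all add: O0_def)
  have v0: "vertical_deriv C A O0 = (\<lambda>c i k p. 0)"
    by (simp add: vertical_deriv_def O0_def pd_const fun_eq_iff)
  then have h0: "hshift O0 = NL C A L" by (simp add: fam_add_def)
  have "hshift O0 = (\<lambda>c i k p. hshift Z c i k p - vertical_deriv C A Z c i k p)"
    unfolding h0 by (simp add: fam_add_def)
  then have con0: "nonlinear_connection C A (hshift O0)"
    using connection_diff[OF con vertical_deriv_hT11[OF Z]] by simp
  have br0: "(\<Sum>b\<in>UNIV. bracket (lx c) (vertical_deriv C A O0 c) b p * snd p $ b) = 0"
    if c: "c \<in> C" and p: "p \<in> adom A c" for c p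
  proof -
    interpret finsler_region "adom A c" "lx c" by (rule finsler_region_adom[OF c])
    show ?thesis
      using bracket_vertical_contracted[where Z="O0 c" and J="vertical_deriv C A O0 c" and f="lx c", OF hT_sh(1)[OF O0 c] _ p]
        mean_Landsberg_contract[OF p] by (simp add: v0) (simp add: O0_def pd_const)
  qed
  show ?thesis unfolding Pi_map_eq[OF d]
  proof
    assume "share_pregeodesics C A N (NL C A L)"
    then have "share_pregeodesics C A (hshift Z) (hshift O0)" unfolding h0 using sh share_trans by blast
    then have "Z = O0"
      using hshift_share_unique[OF Z O0 con con0] bracket_hshift_zero[OF S Z] br0 by blast
    then show "hshift Z = NL C A L" using h0 by simp
  next
    assume "hshift Z = NL C A L"
    then show "share_pregeodesics C A N (NL C A L)" using share_sym[OF sh] by simp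
  qed
qed

lemma Ricci_scalar_Pi_map:
  assumes N: "N \<in> Sol C A L" and c: "c \<in> C" and p: "p \<in> adom A c"
  shows "Ricci_scalar (N c) p = Ricci_scalar (Pi_map C A L N c) p"
proof -
  obtain Z B where d: "decomposes C A L N Z B" using Sol_decomposes N by blast
  interpret conic_region "adom A c" by (rule conic_region_adom[OF c])
  have "nonlinear_connection C A N" using SolE[OF N] by metis
  note con = connection_hshift[OF this d]
  show ?thesis unfolding Pi_map_eq[OF d]
    by (rule Ricci_scalar_add_radial[OF connectionD(1)[OF con c] hT_sh(2)[OF decomposesD(2)[OF d] c] p])
       (rule decomposesD(4)[OF d])
qed

end

theorem corollary4p12:
  fixes C :: "('m::{second_countable_topology, t2_space}, 'n::finite) chart set"
    and A :: "('m, 'n) tvec set"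
    and L :: "('m, 'n) tvec \<Rightarrow> real"
  assumes "smooth_structure C"
    and "connected (UNIV :: 'm set)"
    and "CARD('n) \<ge> 2"
    and "conic_domain C A"
    and "pseudo_Finsler C A L"
    and "\<forall>v\<in>A. L v > 0"
  shows "(\<forall>N\<in>Sol C A L. \<exists>Z B. decomposes C A L N Z B) \<and>
    (\<forall>N\<in>Sol C A L. \<forall>Z B. decomposes C A L N Z B \<longrightarrow>
       NL C A L \<oplus>\<^sub>f vertical_deriv C A Z \<in> Sol_sym C A L \<and>
       Pi_map C A L N = NL C A L \<oplus>\<^sub>f vertical_deriv C A Z) \<and>
    (\<forall>S\<in>Sol_sym C A L. Pi_map C A L S = S) \<and>
    (\<forall>S\<in>Sol_sym C A L. {N \<in> fiber C A L S. symmetric_connection C A N} = {S}) \<and>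
    (\<forall>N\<in>Sol C A L. \<forall>N0\<in>Sol C A L.
       share_pregeodesics C A N N0 \<longleftrightarrow>
       (\<exists>S\<in>Sol_sym C A L. N \<in> fiber C A L S \<and> N0 \<in> fiber C A L S)) \<and>
    (\<forall>N\<in>Sol C A L. share_pregeodesics C A N (NL C A L) \<longleftrightarrow> Pi_map C A L N = NL C A L) \<and>
    (\<forall>S\<in>Sol_sym C A L. \<forall>N\<in>fiber C A L S. \<forall>N0\<in>fiber C A L S.
       \<forall>c\<in>C. \<forall>p\<in>adom A c. Ricci_scalar (N c) p = Ricci_scalar (N0 c) p)"
proof -
  interpret finsler_manifold C A L by unfold_locales (use assms in auto)
  have part0: "\<forall>N\<in>Sol C A L. \<exists>Z B. decomposes C A L N Z B" using Sol_decomposes by blast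
  have part1: "\<forall>N\<in>Sol C A L. \<forall>Z B. decomposes C A L N Z B \<longrightarrow>
       NL C A L \<oplus>\<^sub>f vertical_deriv C A Z \<in> Sol_sym C A L \<and>
       Pi_map C A L N = NL C A L \<oplus>\<^sub>f vertical_deriv C A Z"
    using hshift_Sol_sym Pi_map_eq by blast
  have part2: "\<forall>S\<in>Sol_sym C A L. Pi_map C A L S = S" using Pi_map_Sol_sym by blast
  have sub: "Sol_sym C A L \<subseteq> Sol C A L" unfolding Sol_sym_def by blast
  have part3: "\<forall>S\<in>Sol_sym C A L. {N \<in> fiber C A L S. symmetric_connection C A N} = {S}"
  proof
    fix S assume S: "S \<in> Sol_sym C A L"
    have "N = S" if "N \<in> fiber C A L S" "symmetric_connection C A N" for N
    proof -
      have "N \<in> Sol_sym C A L" "Pi_map C A L N = S" using that unfolding fiber_def Sol_sym_def by auto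
      then show ?thesis using Pi_map_Sol_sym by simp
    qed
    moreover have "S \<in> fiber C A L S" "symmetric_connection C A S"
      using S Pi_map_Sol_sym[OF S] unfolding fiber_def Sol_sym_def by auto
    ultimately show "{N \<in> fiber C A L S. symmetric_connection C A N} = {S}" by blast
  qed
  have Pi_in: "Pi_map C A L N \<in> Sol_sym C A L" if "N \<in> Sol C A L" for N
    using part0 part1 that by metis
  have part4: "\<forall>N\<in>Sol C A L. \<forall>N0\<in>Sol C A L. share_pregeodesics C A N N0 \<longleftrightarrow>
       (\<exists>S\<in>Sol_sym C A L. N \<in> fiber C A L S \<and> N0 \<in> fiber C A L S)"
    using share_iff_Pi_map Pi_in unfolding fiber_def by auto
  have part5: "\<forall>N\<in>Sol C A L. share_pregeodesics C A N (NL C A L) \<longleftrightarrow> Pi_map C A L N = NL C A L"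
    using share_NL_iff by blast
  have part6: "\<forall>S\<in>Sol_sym C A L. \<forall>N\<in>fiber C A L S. \<forall>N0\<in>fiber C A L S.
       \<forall>c\<in>C. \<forall>p\<in>adom A c. Ricci_scalar (N c) p = Ricci_scalar (N0 c) p"
    using Ricci_scalar_Pi_map unfolding fiber_def by simp
  show ?thesis by (intro conjI part0 part1 part2 part3 part4 part5 part6)
qed

end
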